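(* Let $\mathcal{H}$ be a separable, infinite-dimensional complex Hilbert space, $\mathcal{M}=\mathcal{B}(\mathcal{H})$, and $\tau$ a faithful, normal, semifinite, tracial weight on $\mathcal{B}(\mathcal{H})$. Let $\mathcal{K}_\Phi(\mathcal{M},\tau)$ be a normed ideal of $(\mathcal{M},\tau)$ with unitarily invariant norm $\Phi$. Assume that $$\lim_{\substack{\tau(e)\to\infty\\ e\in\mathcal{PF}(\mathcal{M},\tau)}}\frac{\Phi(e)}{\tau(e)}=0.$$ Then for each $x\in\mathcal{M}$ and every $\epsilon>0$ there exists an irreducible operator $y\in\mathcal{M}$ such that $x-y\in\mathcal{K}^0_\Phi(\mathcal{M},\tau)$ and $\Phi(x-y)\le\epsilon$.
   Context: For $x\in\mathcal{M}$ let $R(x)$ be its range projection. $\mathcal{F}(\mathcal{M},\tau)=\{x\in\mathcal{M}:\tau(R(x))<\infty\}$, $\mathcal{K}(\mathcal{M},\tau)$ is its operator-norm closure, and $\mathcal{PF}(\mathcal{M},\tau)$ is the set of projections in $\mathcal{F}(\mathcal{M},\tau)$. A normed ideal $\mathcal{K}_\Phi(\mathcal{M},\tau)$ is a two-sided ideal of $\mathcal{M}$ with a norm $\Phi$ such that: (i) $\Phi(uxv)=\Phi(x)$ for all $x$ in the ideal and unitaries $u,v\in\mathcal{M}$; (ii) there is $\lambda>0$ with $\Phi(x)\ge\lambda\|x\|$ on the ideal; (iii) the ideal is complete under $\Phi$; (iv) $\mathcal{F}(\mathcal{M},\tau)\subseteq\mathcal{K}_\Phi(\mathcal{M},\tau)\subseteq\mathcal{K}(\mathcal{M},\tau)$.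 $\mathcal{K}^0_\Phi(\mathcal{M},\tau)$ is the $\Phi$-closure of $\mathcal{F}(\mathcal{M},\tau)$. The limit condition means: for every $\delta>0$ there is $N$ with $\Phi(e)/\tau(e)<\delta$ for all $e\in\mathcal{PF}(\mathcal{M},\tau)$ with $\tau(e)>N$. An operator $y\in\mathcal{M}$ is irreducible in $\mathcal{M}$ if $W^*(y)'\cap\mathcal{M}=\mathbb{C}I$, where $W^*(y)$ is the von Neumann algebra generated by $y$ and $I$. *)

theory Defs
  imports "HOL-Analysis.Analysis"
begin

class sep_inf_chilbert = ab_group_add +
  fixes hs_scale :: "complex \<Rightarrow> 'a \<Rightarrow> 'a"
    and hs_inner :: "'a \<Rightarrow> 'a \<Rightarrow> complex"
  assumes hs_scale_add_right: "hs_scale a (x + y) = hs_scale a x + hs_scale a y"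
    and hs_scale_add_left: "hs_scale (a + b) x = hs_scale a x + hs_scale b x"
    and hs_scale_scale: "hs_scale a (hs_scale b x) = hs_scale (a * b) x"
    and hs_scale_one: "hs_scale 1 x = x"
    and hs_inner_add_right: "hs_inner x (y + z) = hs_inner x y + hs_inner x z"
    and hs_inner_scale_right: "hs_inner x (hs_scale a y) = a * hs_inner x y"
    and hs_inner_conj_sym: "hs_inner y x = cnj (hs_inner x y)"
    and hs_inner_pos: "0 \<le> Re (hs_inner x x)"
    and hs_inner_definite: "hs_inner x x = 0 \<Longrightarrow> x = 0"
    and hs_complete:
      "(\<forall>e>0. \<exists>N. \<forall>m\<ge>N. \<forall>n\<ge>N. sqrt (Re (hs_inner (X m - X n) (X m - X n))) < e)
        \<Longrightarrow> \<exists>L. (\<lambda>n. sqrt (Re (hs_inner (X n - L) (X n - L)))) \<longlonglongrightarrow> 0"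
    and hs_separable:
      "\<exists>D. countable D \<and> (\<forall>x. \<forall>e>0. \<exists>d\<in>D. sqrt (Re (hs_inner (x - d) (x - d))) < e)"
    and hs_infinite_dim:
      "\<exists>f::nat \<Rightarrow> 'a. \<forall>i<n. \<forall>j<n. hs_inner (f i) (f j) = (if i = j then 1 else 0)"

definition hnorm :: "'h::sep_inf_chilbert \<Rightarrow> real" where
  "hnorm x = sqrt (Re (hs_inner x x))"

definition bounded_op :: "('h::sep_inf_chilbert \<Rightarrow> 'h) \<Rightarrow> bool" where
  "bounded_op T \<longleftrightarrow> (\<forall>x y. T (x + y) = T x + T y) \<and> (\<forall>a x. T (hs_scale a x) = hs_scale a (T x))
     \<and> (\<exists>K. \<forall>x. hnorm (T x) \<le> K * hnorm x)"

definition BH :: "('h::sep_inf_chilbert \<Rightarrow> 'h) set" where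
  "BH = {T. bounded_op T}"

definition opnorm :: "('h::sep_inf_chilbert \<Rightarrow> 'h) \<Rightarrow> real" where
  "opnorm T = Sup {hnorm (T x) | x. hnorm x \<le> 1}"

definition op_diff :: "('h::sep_inf_chilbert \<Rightarrow> 'h) \<Rightarrow> ('h \<Rightarrow> 'h) \<Rightarrow> ('h \<Rightarrow> 'h)" where
  "op_diff S T = (\<lambda>v. S v - T v)"

definition op_add :: "('h::sep_inf_chilbert \<Rightarrow> 'h) \<Rightarrow> ('h \<Rightarrow> 'h) \<Rightarrow> ('h \<Rightarrow> 'h)" where
  "op_add S T = (\<lambda>v. S v + T v)"

definition op_scale :: "complex \<Rightarrow> ('h::sep_inf_chilbert \<Rightarrow> 'h) \<Rightarrow> ('h \<Rightarrow> 'h)" where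
  "op_scale c T = (\<lambda>v. hs_scale c (T v))"

definition adj :: "('h::sep_inf_chilbert \<Rightarrow> 'h) \<Rightarrow> ('h \<Rightarrow> 'h)" where
  "adj T = (THE S. \<forall>x y. hs_inner (T x) y = hs_inner x (S y))"

definition positive_op :: "('h::sep_inf_chilbert \<Rightarrow> 'h) \<Rightarrow> bool" where
  "positive_op T \<longleftrightarrow> bounded_op T \<and> (\<forall>x. Im (hs_inner x (T x)) = 0 \<and> 0 \<le> Re (hs_inner x (T x)))"

definition op_le :: "('h::sep_inf_chilbert \<Rightarrow> 'h) \<Rightarrow> ('h \<Rightarrow> 'h) \<Rightarrow> bool" where
  "op_le a b \<longleftrightarrow> positive_op (op_diff b a)"

definition is_proj :: "('h::sep_inf_chilbert \<Rightarrow> 'h) \<Rightarrow> bool" where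
  "is_proj p \<longleftrightarrow> bounded_op p \<and> p \<circ> p = p \<and> adj p = p"

definition unitary_op :: "('h::sep_inf_chilbert \<Rightarrow> 'h) \<Rightarrow> bool" where
  "unitary_op u \<longleftrightarrow> bounded_op u \<and> adj u \<circ> u = id \<and> u \<circ> adj u = id"

definition range_proj :: "('h::sep_inf_chilbert \<Rightarrow> 'h) \<Rightarrow> ('h \<Rightarrow> 'h)" where
  "range_proj x = (THE p. is_proj p \<and> p \<circ> x = x \<and> (\<forall>q. is_proj q \<and> q \<circ> x = x \<longrightarrow> q \<circ> p = p))"

definition fns_trace :: "(('h::sep_inf_chilbert \<Rightarrow> 'h) \<Rightarrow> ennreal) \<Rightarrow> bool" where
  "fns_trace \<tau> \<longleftrightarrow>
     \<comment> \<open>weight: additive and positively homogeneous on the positive cone\<close>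
     (\<forall>a b. positive_op a \<and> positive_op b \<longrightarrow> \<tau> (op_add a b) = \<tau> a + \<tau> b) \<and>
     (\<forall>a (c::real). positive_op a \<and> 0 \<le> c \<longrightarrow> \<tau> (op_scale (complex_of_real c) a) = ennreal c * \<tau> a) \<and>
     \<comment> \<open>tracial\<close>
     (\<forall>x. bounded_op x \<longrightarrow> \<tau> (adj x \<circ> x) = \<tau> (x \<circ> adj x)) \<and>
     \<comment> \<open>faithful\<close>
     (\<forall>a. positive_op a \<and> \<tau> a = 0 \<longrightarrow> a = (\<lambda>v. 0)) \<and>
     \<comment> \<open>normal: for every upward directed bounded family of positive operators with
         least upper bound a, tau a is the supremum of the values\<close>
     (\<forall>S a. S \<noteq> {} \<and> (\<forall>s\<in>S. positive_op s) \<and> (\<forall>s\<in>S. \<forall>t\<in>S. \<exists>r\<in>S. op_le s r \<and> op_le t r)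
        \<and> bounded_op a \<and> (\<forall>s\<in>S. op_le s a) \<and> (\<forall>b. bounded_op b \<and> (\<forall>s\<in>S. op_le s b) \<longrightarrow> op_le a b)
        \<longrightarrow> \<tau> a = (SUP s\<in>S. \<tau> s)) \<and>
     \<comment> \<open>semifinite\<close>
     (\<forall>a. positive_op a \<and> a \<noteq> (\<lambda>v. 0) \<longrightarrow>
        (\<exists>b. positive_op b \<and> b \<noteq> (\<lambda>v. 0) \<and> op_le b a \<and> \<tau> b < \<infinity>))"

definition FF :: "(('h::sep_inf_chilbert \<Rightarrow> 'h) \<Rightarrow> ennreal) \<Rightarrow> ('h \<Rightarrow> 'h) set" where
  "FF \<tau> = {x \<in> BH. \<tau> (range_proj x) < \<infinity>}"

definition KK :: "(('h::sep_inf_chilbert \<Rightarrow> 'h) \<Rightarrow> ennreal) \<Rightarrow> ('h \<Rightarrow> 'h) set" where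
  "KK \<tau> = {x \<in> BH. \<forall>e>0. \<exists>f\<in>FF \<tau>. opnorm (op_diff x f) < e}"

definition PF :: "(('h::sep_inf_chilbert \<Rightarrow> 'h) \<Rightarrow> ennreal) \<Rightarrow> ('h \<Rightarrow> 'h) set" where
  "PF \<tau> = {e \<in> FF \<tau>. is_proj e}"

definition normed_ideal ::
  "(('h::sep_inf_chilbert \<Rightarrow> 'h) \<Rightarrow> ennreal) \<Rightarrow> ('h \<Rightarrow> 'h) set \<Rightarrow> (('h \<Rightarrow> 'h) \<Rightarrow> real) \<Rightarrow> bool" where
  "normed_ideal \<tau> I \<Phi> \<longleftrightarrow>
     \<comment> \<open>two-sided ideal of M\<close>
     I \<subseteq> BH \<and> (\<lambda>v. 0) \<in> I \<and>
     (\<forall>x\<in>I. \<forall>y\<in>I. op_add x y \<in> I) \<and> (\<forall>c. \<forall>x\<in>I. op_scale c x \<in> I) \<and>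
     (\<forall>a\<in>BH. \<forall>b\<in>BH. \<forall>x\<in>I. a \<circ> x \<circ> b \<in> I) \<and>
     \<comment> \<open>Phi is a norm on I\<close>
     (\<forall>x\<in>I. 0 \<le> \<Phi> x) \<and> (\<forall>x\<in>I. \<Phi> x = 0 \<longleftrightarrow> x = (\<lambda>v. 0)) \<and>
     (\<forall>c. \<forall>x\<in>I. \<Phi> (op_scale c x) = cmod c * \<Phi> x) \<and>
     (\<forall>x\<in>I. \<forall>y\<in>I. \<Phi> (op_add x y) \<le> \<Phi> x + \<Phi> y) \<and>
     \<comment> \<open>(i) unitary invariance\<close>
     (\<forall>x\<in>I. \<forall>u v. unitary_op u \<and> unitary_op v \<longrightarrow> \<Phi> (u \<circ> x \<circ> v) = \<Phi> x) \<and>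
     \<comment> \<open>(ii) domination of the operator norm\<close>
     (\<exists>c>0. \<forall>x\<in>I. c * opnorm x \<le> \<Phi> x) \<and>
     \<comment> \<open>(iii) completeness\<close>
     (\<forall>X. (\<forall>n. X n \<in> I) \<and> (\<forall>e>0. \<exists>N. \<forall>m\<ge>N. \<forall>n\<ge>N. \<Phi> (op_diff (X m) (X n)) < e) \<longrightarrow>
        (\<exists>L\<in>I. (\<lambda>n. \<Phi> (op_diff (X n) L)) \<longlonglongrightarrow> 0)) \<and>
     \<comment> \<open>(iv)\<close>
     FF \<tau> \<subseteq> I \<and> I \<subseteq> KK \<tau>"

definition K0 ::
  "(('h::sep_inf_chilbert \<Rightarrow> 'h) \<Rightarrow> ennreal) \<Rightarrow> ('h \<Rightarrow> 'h) set \<Rightarrow> (('h \<Rightarrow> 'h) \<Rightarrow> real) \<Rightarrow> ('h \<Rightarrow> 'h) set" where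
  "K0 \<tau> I \<Phi> = {x \<in> I. \<forall>e>0. \<exists>f\<in>FF \<tau>. \<Phi> (op_diff x f) < e}"

definition limit_condition ::
  "(('h::sep_inf_chilbert \<Rightarrow> 'h) \<Rightarrow> ennreal) \<Rightarrow> (('h \<Rightarrow> 'h) \<Rightarrow> real) \<Rightarrow> bool" where
  "limit_condition \<tau> \<Phi> \<longleftrightarrow>
     (\<forall>\<delta>>0. \<exists>N::real. \<forall>e\<in>PF \<tau>. \<tau> e > ennreal N \<longrightarrow> \<Phi> e / enn2real (\<tau> e) < \<delta>)"

definition wot_closed :: "('h::sep_inf_chilbert \<Rightarrow> 'h) set \<Rightarrow> bool" where
  "wot_closed A \<longleftrightarrow> (\<forall>T\<in>BH.
     (\<forall>e>0. \<forall>xs::('h \<times> 'h) list. \<exists>a\<in>A. \<forall>(\<xi>, \<eta>)\<in>set xs. cmod (hs_inner \<eta> (T \<xi> - a \<xi>)) < e)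
     \<longrightarrow> T \<in> A)"

definition von_neumann_subalg :: "('h::sep_inf_chilbert \<Rightarrow> 'h) set \<Rightarrow> bool" where
  "von_neumann_subalg A \<longleftrightarrow> A \<subseteq> BH \<and> id \<in> A \<and>
     (\<forall>x\<in>A. \<forall>y\<in>A. op_add x y \<in> A \<and> x \<circ> y \<in> A) \<and> (\<forall>c. \<forall>x\<in>A. op_scale c x \<in> A) \<and>
     (\<forall>x\<in>A. adj x \<in> A) \<and> wot_closed A"

definition Wstar :: "('h::sep_inf_chilbert \<Rightarrow> 'h) \<Rightarrow> ('h \<Rightarrow> 'h) set" where
  "Wstar y = \<Inter> {A. von_neumann_subalg A \<and> y \<in> A}"

definition commutant_in_BH :: "('h::sep_inf_chilbert \<Rightarrow> 'h) set \<Rightarrow> ('h \<Rightarrow> 'h) set" where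
  "commutant_in_BH S = {b \<in> BH. \<forall>a\<in>S. a \<circ> b = b \<circ> a}"

definition irreducible_op :: "('h::sep_inf_chilbert \<Rightarrow> 'h) \<Rightarrow> bool" where
  "irreducible_op y \<longleftrightarrow> commutant_in_BH (Wstar y) = {op_scale c id | c. True}"

end

theory Submission
  imports Defs
begin

text \<open>
  A self-adjoint \<open>a\<close> splits into at most \<open>m + 1\<close> spectral bins of width \<open>w = O(1/m)\<close>. The
  components of a given vector in the bins span a space that contains the vector and reduces
  \<open>a\<close> up to an off-diagonal operator \<open>\<Sum> s\<^sub>j u\<^sub>j \<otimes> v\<^sub>j\<close> with \<open>s\<^sub>j \<le> w\<close> and orthonormal \<open>u\<^sub>j\<close>, \<open>v\<^sub>j\<close>; its
  \<open>\<Phi>\<close>-norm is at most \<open>w \<Phi>(e)\<close> for a projection \<open>e\<close> of rank at most \<open>m + 1\<close>, which tends to 0 by the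
  limit condition. Iterating over a dense sequence (Weyl, von Neumann, Kuroda) makes the real part
  of \<open>x\<close> diagonal with distinct eigenvalues after a small perturbation. A further small rank-two
  perturbation makes one row of the imaginary part nonzero off the diagonal; an operator commuting with both
  parts is then diagonal with constant diagonal (Radjavi, Rosenthal).
\<close>

text \<open>The norm \<open>\<Phi>\<close> comes with unitary invariance but with no inequality
  bounding \<open>\<Phi> (a \<circ> x \<circ> b)\<close> by operator norms of \<open>a\<close> and
  \<open>b\<close>. All estimates are therefore drawn from reflections, convexity and the triangle
  inequality, which is why the off-diagonal part is written with two orthonormal families. On
  finite-rank projections the trace is a positive constant times the rank, so the limit condition
  says that \<open>\<Phi>\<close> grows more slowly than the rank; this is what a bin width
  inversely proportional to the number of bins can absorb. No spectral measure is built: the bins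
  come from splitting shifted operators by sign, which rests on a square root obtained by iteration.
  The bin projections must commute with everything that commutes with \<open>a\<close>; only then
  are the components of a new vector orthogonal to the eigenvectors already found, so that later
  corrections vanish on those and leave them intact. The eigenvalues are kept distinct through all
  steps because a repeated one would leave a non-diagonal block in the commutant of the real part.
  At each step only finitely many values have to be avoided.\<close>

notation hs_inner ("\<langle>_, _\<rangle>")
notation hs_scale (infixr "*\<^sub>C" 75)
notation hnorm ("\<parallel>_\<parallel>")

subsection \<open>Hilbert space geometry\<close>

lemma scale_zero_right [simp]: "c *\<^sub>C (0::'h::sep_inf_chilbert) = 0"
  using hs_scale_add_right[of c 0 0] by simp

lemma scale_zero_left [simp]: "0 *\<^sub>C (x::'h::sep_inf_chilbert) = 0"
  using hs_scale_add_left[of 0 0 x] by simp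

lemma scale_minus_right [simp]: "c *\<^sub>C (- (x::'h::sep_inf_chilbert)) = - (c *\<^sub>C x)"
  using hs_scale_add_right[of c x "-x"] by (simp add: eq_neg_iff_add_eq_0 add.commute)

lemma scale_minus_left [simp]: "(- c) *\<^sub>C (x::'h::sep_inf_chilbert) = - (c *\<^sub>C x)"
  using hs_scale_add_left[of c "-c" x] by (simp add: eq_neg_iff_add_eq_0 add.commute)

lemma scale_diff_right: "c *\<^sub>C (x - (y::'h::sep_inf_chilbert)) = c *\<^sub>C x - c *\<^sub>C y"
  using hs_scale_add_right[of c x "-y"] by simp

lemma scale_diff_left: "(a - b) *\<^sub>C (x::'h::sep_inf_chilbert) = a *\<^sub>C x - b *\<^sub>C x"
  using hs_scale_add_left[of a "-b" x] by simp

lemma scale_sum: "c *\<^sub>C (\<Sum>i\<in>A. f i) = (\<Sum>i\<in>A. c *\<^sub>C (f i :: 'h::sep_inf_chilbert))"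
  by (induction A rule: infinite_finite_induct) (auto simp: hs_scale_add_right)

lemmas scale_simps = hs_scale_add_right hs_scale_add_left scale_diff_right scale_diff_left
  hs_scale_scale

declare hs_scale_one [simp]

lemma inner_zero_right [simp]: "\<langle>x, 0\<rangle> = 0"
  using hs_inner_add_right[of x 0 0] by simp

lemma inner_minus_right [simp]: "\<langle>x, - y\<rangle> = - \<langle>x, y\<rangle>"
  using hs_inner_add_right[of x y "-y"] by (simp add: eq_neg_iff_add_eq_0 add.commute)

lemma inner_diff_right: "\<langle>x, y - z\<rangle> = \<langle>x, y\<rangle> - \<langle>x, z\<rangle>"
  using hs_inner_add_right[of x y "-z"] by simp

lemma inner_add_left: "\<langle>x + y, z\<rangle> = \<langle>x, z\<rangle> + \<langle>y, z\<rangle>"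
  by (metis complex_cnj_add hs_inner_add_right hs_inner_conj_sym)

lemma inner_scale_left: "\<langle>c *\<^sub>C x, y\<rangle> = cnj c * \<langle>x, y\<rangle>"
  by (metis complex_cnj_mult hs_inner_conj_sym hs_inner_scale_right)

lemma inner_zero_left [simp]: "\<langle>0, x\<rangle> = 0"
  using inner_add_left[of 0 0 x] by simp

lemma inner_minus_left [simp]: "\<langle>- x, y\<rangle> = - \<langle>x, y\<rangle>"
  using inner_add_left[of x "-x" y] by (simp add: eq_neg_iff_add_eq_0 add.commute)

lemma inner_diff_left: "\<langle>x - y, z\<rangle> = \<langle>x, z\<rangle> - \<langle>y, z\<rangle>"
  using inner_add_left[of x "-y" z] by simp

lemma inner_sum_right: "\<langle>x, \<Sum>i\<in>A. f i\<rangle> = (\<Sum>i\<in>A. \<langle>x, f i\<rangle>)"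
  by (induction A rule: infinite_finite_induct) (auto simp: hs_inner_add_right)

lemma inner_sum_left: "\<langle>\<Sum>i\<in>A. f i, x\<rangle> = (\<Sum>i\<in>A. \<langle>f i, x\<rangle>)"
  by (induction A rule: infinite_finite_induct) (auto simp: inner_add_left)

lemmas inner_simps = hs_inner_add_right inner_add_left inner_diff_right inner_diff_left
  hs_inner_scale_right inner_scale_left inner_sum_right inner_sum_left

lemma inner_self_Im [simp]: "Im \<langle>x, x\<rangle> = 0"
  using hs_inner_conj_sym[of x x] by (metis Im_complex_of_real Reals_cnj_iff Reals_cases)

lemma hnorm_nonneg [simp]: "0 \<le> \<parallel>x\<parallel>"
  by (simp add: hnorm_def hs_inner_pos)

lemma hnorm_sq: "\<parallel>x\<parallel>\<^sup>2 = Re \<langle>x, x\<rangle>"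
  by (simp add: hnorm_def hs_inner_pos)

lemma inner_self: "\<langle>x, x\<rangle> = complex_of_real (\<parallel>x\<parallel>\<^sup>2)"
  by (simp add: complex_eq_iff hnorm_sq)

lemma hnorm_zero [simp]: "\<parallel>0\<parallel> = 0"
  by (simp add: hnorm_def)

lemma hnorm_eq_0 [simp]: "\<parallel>x\<parallel> = 0 \<longleftrightarrow> x = 0"
  using hs_inner_definite[of x] inner_self[of x] by auto

lemma hnorm_pos: "x \<noteq> 0 \<Longrightarrow> 0 < \<parallel>x\<parallel>"
  using hnorm_eq_0[of x] hnorm_nonneg[of x] by linarith

lemma hnorm_scale: "\<parallel>c *\<^sub>C x\<parallel> = cmod c * \<parallel>x\<parallel>"
proof -
  have "\<parallel>c *\<^sub>C x\<parallel>\<^sup>2 = Re (cnj c * c * \<langle>x, x\<rangle>)"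
    by (simp add: hnorm_sq inner_simps mult.assoc)
  also have "cnj c * c = complex_of_real ((cmod c)\<^sup>2)"
    by (metis complex_norm_square mult.commute)
  finally have "\<parallel>c *\<^sub>C x\<parallel>\<^sup>2 = (cmod c * \<parallel>x\<parallel>)\<^sup>2"
    by (simp add: hnorm_sq power_mult_distrib)
  then show ?thesis by (simp add: power2_eq_iff_nonneg)
qed

lemma hnorm_minus [simp]: "\<parallel>- x\<parallel> = \<parallel>x\<parallel>"
  by (simp add: hnorm_def)

lemma hnorm_minus_commute: "\<parallel>x - y\<parallel> = \<parallel>y - x\<parallel>"
  using hnorm_minus[of "x - y"] by simp

lemma hnorm_add_sq: "\<parallel>x + y\<parallel>\<^sup>2 = \<parallel>x\<parallel>\<^sup>2 + 2 * Re \<langle>x, y\<rangle> + \<parallel>y\<parallel>\<^sup>2"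
  unfolding hnorm_sq using hs_inner_conj_sym[of x y] by (simp add: inner_simps)

text \<open>Taking \<open>c\<close> to be a negative real multiple of \<open>cnj \<beta>\<close>
  turns the form into a real quadratic in \<open>t\<close>, whose value at
  \<open>t = 1/\<gamma>\<close> gives the bound. It serves the Cauchy-Schwarz inequality of the
  space, that of a positive operator, and the orthogonality of a nearest point.\<close>

lemma hermitian_form_discriminant:
  fixes \<alpha> \<gamma> :: real and \<beta> :: complex
  assumes "\<And>c. 0 \<le> \<alpha> + 2 * Re (c * \<beta>) + (cmod c)\<^sup>2 * \<gamma>" and "0 \<le> \<gamma>"
  shows "(cmod \<beta>)\<^sup>2 \<le> \<alpha> * \<gamma>"
proof -
  have r: "0 \<le> \<alpha> - 2 * t * (cmod \<beta>)\<^sup>2 + t\<^sup>2 * (cmod \<beta>)\<^sup>2 * \<gamma>" for t :: real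
  proof -
    have "cnj \<beta> * \<beta> = complex_of_real ((cmod \<beta>)\<^sup>2)"
      by (metis complex_norm_square mult.commute)
    then have "Re (- complex_of_real t * cnj \<beta> * \<beta>) = - t * (cmod \<beta>)\<^sup>2"
      by (metis Re_complex_of_real mult.assoc of_real_minus of_real_mult)
    then show ?thesis using assms(1)[of "- complex_of_real t * cnj \<beta>"]
      by (simp add: norm_mult power_mult_distrib)
  qed
  show ?thesis
  proof (cases "\<gamma> = 0")
    case True
    have "(cmod \<beta>)\<^sup>2 = 0"
    proof (rule ccontr)
      assume "(cmod \<beta>)\<^sup>2 \<noteq> 0"
      \<comment> \<open>With \<open>\<gamma> = 0\<close> the expression is affine in
        \<open>t\<close>; this \<open>t\<close> makes it equal to -1.\<close>
      with r[of "(\<alpha> + 1) / (2 * (cmod \<beta>)\<^sup>2)"] True show False by simp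
    qed
    with True show ?thesis by simp
  next
    case False
    then have "\<gamma> > 0" using assms(2) by simp
    then have "0 \<le> \<gamma> * (\<alpha> - 2 * (1/\<gamma>) * (cmod \<beta>)\<^sup>2 + (1/\<gamma>)\<^sup>2 * (cmod \<beta>)\<^sup>2 * \<gamma>)"
      using r[of "1/\<gamma>"] by simp
    also have "\<dots> = \<alpha> * \<gamma> - (cmod \<beta>)\<^sup>2"
      using \<open>\<gamma> > 0\<close> by (simp add: field_simps power2_eq_square)
    finally show ?thesis by simp
  qed
qed

lemma cauchy_schwarz: "cmod \<langle>x, y\<rangle> \<le> \<parallel>x\<parallel> * \<parallel>y\<parallel>"
proof -
  have "0 \<le> \<parallel>x\<parallel>\<^sup>2 + 2 * Re (c * \<langle>x, y\<rangle>) + (cmod c)\<^sup>2 * \<parallel>y\<parallel>\<^sup>2" for c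
  proof -
    have "0 \<le> \<parallel>x + c *\<^sub>C y\<parallel>\<^sup>2" by simp
    then show ?thesis unfolding hnorm_add_sq by (simp add: hnorm_scale power_mult_distrib hs_inner_scale_right)
  qed
  from hermitian_form_discriminant[OF this] have "(cmod \<langle>x, y\<rangle>)\<^sup>2 \<le> (\<parallel>x\<parallel> * \<parallel>y\<parallel>)\<^sup>2"
    by (simp add: power_mult_distrib)
  then show ?thesis by (rule power2_le_imp_le) simp
qed

lemma hnorm_triangle: "\<parallel>x + y\<parallel> \<le> \<parallel>x\<parallel> + \<parallel>y\<parallel>"
proof (rule power2_le_imp_le)
have "Re \<langle>x, y\<rangle> \<le> \<parallel>x\<parallel> * \<parallel>y\<parallel>"
    using cauchy_schwarz[of x y] complex_Re_le_cmod[of "\<langle>x, y\<rangle>"] by linarith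
  then show "\<parallel>x + y\<parallel>\<^sup>2 \<le> (\<parallel>x\<parallel> + \<parallel>y\<parallel>)\<^sup>2" by (simp add: hnorm_add_sq power2_sum)
qed simp

lemma hnorm_triangle_diff: "\<parallel>x - y\<parallel> \<le> \<parallel>x\<parallel> + \<parallel>y\<parallel>"
  using hnorm_triangle[of x "-y"] by simp

lemma hnorm_diff_triangle: "\<parallel>x - z\<parallel> \<le> \<parallel>x - y\<parallel> + \<parallel>y - z\<parallel>"
  using hnorm_triangle[of "x - y" "y - z"] by simp

lemma hnorm_add_orthogonal: "\<langle>x, y\<rangle> = 0 \<Longrightarrow> \<parallel>x + y\<parallel>\<^sup>2 = \<parallel>x\<parallel>\<^sup>2 + \<parallel>y\<parallel>\<^sup>2"
  by (simp add: hnorm_add_sq)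

lemma inner_eqI: "(\<And>x. \<langle>x, y\<rangle> = \<langle>x, z\<rangle>) \<Longrightarrow> y = z"
  using hs_inner_definite[of "y - z"] by (simp add: inner_diff_right)

lemma inner_commute_zero: "\<langle>x, y\<rangle> = 0 \<longleftrightarrow> \<langle>y, x\<rangle> = 0"
  using hs_inner_conj_sym[of x y] by simp

section \<open>Completeness and norm limits\<close>

lemma hcauchy_convergent:
  assumes "\<And>e. e > 0 \<Longrightarrow> \<exists>N. \<forall>m\<ge>N. \<forall>n\<ge>N. \<parallel>X m - X n\<parallel> < e"
  obtains L where "(\<lambda>n. \<parallel>X n - L\<parallel>) \<longlonglongrightarrow> 0"
  using hs_complete[of X] assms unfolding hnorm_def by blast

text \<open>The increments are dominated by those of a bounded increasing real sequence, so the
  distances telescope and the Cauchy property is inherited from \<open>r\<close>.\<close>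

lemma hcauchy_increments:
  assumes "\<And>n. \<parallel>X (Suc n) - X n\<parallel> \<le> r (Suc n) - r n" and "\<And>n. r n \<le> (B::real)"
  obtains L where "(\<lambda>n. \<parallel>X n - L\<parallel>) \<longlonglongrightarrow> 0"
proof -
  have le: "\<parallel>X (n + k) - X n\<parallel> \<le> r (n + k) - r n" for n k
  proof (induction k)
    case (Suc k)
    then show ?case using assms(1)[of "n + k"] hnorm_diff_triangle[of "X (Suc (n + k))" "X n" "X (n + k)"]
      by simp
  qed simp
  have "incseq r"
    by (rule incseq_SucI) (use assms(1) hnorm_nonneg in \<open>smt (verit)\<close>)
  then have "Cauchy r"
    using assms(2) by (metis LIMSEQ_imp_Cauchy incseq_convergent)
  have "\<exists>N. \<forall>m\<ge>N. \<forall>n\<ge>N. \<parallel>X m - X n\<parallel> < e" if e: "e > 0" for e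
  proof -
    obtain N where N: "\<And>m n. m \<ge> N \<Longrightarrow> n \<ge> N \<Longrightarrow> \<bar>r m - r n\<bar> < e"
      using CauchyD[OF \<open>Cauchy r\<close> e] by auto
    have "\<parallel>X m - X n\<parallel> < e" if "m \<ge> N" "n \<ge> N" for m n
    proof (cases "m \<ge> n")
      case True
      then show ?thesis using le[of n "m - n"] N[OF that] by auto
    next
      case False
      then show ?thesis using le[of m "n - m"] N[OF that] hnorm_minus_commute[of "X m" "X n"] by auto
    qed
    then show ?thesis by blast
  qed
  from hcauchy_convergent[OF this] that show thesis by blast
qed

definition hlim :: "(nat \<Rightarrow> 'h::sep_inf_chilbert) \<Rightarrow> 'h \<Rightarrow> bool" where
  "hlim X L \<longleftrightarrow> (\<lambda>n. \<parallel>X n - L\<parallel>) \<longlonglongrightarrow> 0"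

lemma hlim_inner:
  assumes "hlim X L"
  shows "(\<lambda>n. \<langle>u, X n\<rangle>) \<longlonglongrightarrow> \<langle>u, L\<rangle>"
proof -
  have "(\<lambda>n. \<langle>u, X n\<rangle> - \<langle>u, L\<rangle>) \<longlonglongrightarrow> 0"
  proof (rule Lim_null_comparison)
    show "\<forall>\<^sub>F n in sequentially. norm (\<langle>u, X n\<rangle> - \<langle>u, L\<rangle>) \<le> \<parallel>u\<parallel> * \<parallel>X n - L\<parallel>"
      using cauchy_schwarz[of u] by (auto simp only: inner_diff_right[symmetric] intro!: always_eventually)
    show "(\<lambda>n. \<parallel>u\<parallel> * \<parallel>X n - L\<parallel>) \<longlonglongrightarrow> 0"
      using tendsto_mult_right_zero assms[unfolded hlim_def] by blast
  qed
  then show ?thesis by (rule LIM_zero_cancel)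
qed

lemma hlim_inner_left:
  assumes "hlim X L"
  shows "(\<lambda>n. \<langle>X n, u\<rangle>) \<longlonglongrightarrow> \<langle>L, u\<rangle>"
  using tendsto_cnj[OF hlim_inner[OF assms, of u]] by (simp add: hs_inner_conj_sym[symmetric])

lemma hlim_unique: "hlim X L \<Longrightarrow> hlim X M \<Longrightarrow> L = M"
  by (rule inner_eqI) (metis LIMSEQ_unique hlim_inner)

lemma hlim_const [simp]: "hlim (\<lambda>n. x) x"
  by (simp add: hlim_def)

lemma hlim_add: "hlim X L \<Longrightarrow> hlim Y M \<Longrightarrow> hlim (\<lambda>n. X n + Y n) (L + M)"
  unfolding hlim_def
proof (rule Lim_null_comparison[where g = "\<lambda>n. \<parallel>X n - L\<parallel> + \<parallel>Y n - M\<parallel>"])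
  show "\<forall>\<^sub>F n in sequentially. norm \<parallel>X n + Y n - (L + M)\<parallel> \<le> \<parallel>X n - L\<parallel> + \<parallel>Y n - M\<parallel>"
    using hnorm_triangle by (auto simp: add_diff_add intro!: always_eventually)
qed (auto intro: tendsto_add_zero)

lemma hlim_scale: "hlim X L \<Longrightarrow> hlim (\<lambda>n. c *\<^sub>C X n) (c *\<^sub>C L)"
  unfolding hlim_def scale_diff_right[symmetric] hnorm_scale by (rule tendsto_mult_right_zero)

lemma hlim_lipschitz:
  assumes "hlim X L" and "\<And>x y. \<parallel>f x - f y\<parallel> \<le> K * \<parallel>x - y\<parallel>"
  shows "hlim (\<lambda>n. f (X n)) (f L)"
  unfolding hlim_def
proof (rule Lim_null_comparison)
  show "\<forall>\<^sub>F n in sequentially. norm \<parallel>f (X n) - f L\<parallel> \<le> K * \<parallel>X n - L\<parallel>" using assms(2) by simp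
  show "(\<lambda>n. K * \<parallel>X n - L\<parallel>) \<longlonglongrightarrow> 0" using assms(1) unfolding hlim_def by (rule tendsto_mult_right_zero)
qed

lemma hlim_hnorm_le:
  assumes "hlim X L" and "\<And>n. \<parallel>X n\<parallel> \<le> b"
  shows "\<parallel>L\<parallel> \<le> b"
proof (rule field_le_epsilon)
  fix e :: real assume "e > 0"
  then obtain n where "\<parallel>X n - L\<parallel> < e"
    using assms(1) unfolding hlim_def LIMSEQ_iff by fastforce
  then show "\<parallel>L\<parallel> \<le> b + e"
    using hnorm_triangle_diff[of "X n" "X n - L"] assms(2)[of n] by simp
qed

section \<open>Closed subspaces and nearest points\<close>

definition closed_subspace :: "'h::sep_inf_chilbert set \<Rightarrow> bool" where
  "closed_subspace N \<longleftrightarrow> 0 \<in> N \<and> (\<forall>x\<in>N. \<forall>y\<in>N. x + y \<in> N) \<and> (\<forall>c. \<forall>x\<in>N. c *\<^sub>C x \<in> N)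
     \<and> (\<forall>X L. (\<forall>n. X n \<in> N) \<and> hlim X L \<longrightarrow> L \<in> N)"

lemma parallelogram: "\<parallel>x + y\<parallel>\<^sup>2 + \<parallel>x - y\<parallel>\<^sup>2 = 2 * \<parallel>x\<parallel>\<^sup>2 + 2 * \<parallel>y\<parallel>\<^sup>2"
  unfolding hnorm_sq by (simp add: inner_simps)

text \<open>The parallelogram law makes a minimizing sequence for the distance from \<open>x\<close>
  Cauchy; minimality of its limit \<open>p\<close> forces \<open>x - p\<close> to be orthogonal to
  \<open>N\<close>.\<close>

lemma orthogonal_decomposition:
  assumes N: "closed_subspace N"
  obtains p where "p \<in> N" and "\<And>u. u \<in> N \<Longrightarrow> \<langle>u, x - p\<rangle> = 0"
proof -
  define d where "d = Inf ((\<lambda>u. \<parallel>x - u\<parallel>\<^sup>2) ` N)"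
  have ne: "(\<lambda>u. \<parallel>x - u\<parallel>\<^sup>2) ` N \<noteq> {}" using N by (auto simp: closed_subspace_def)
  have bb: "bdd_below ((\<lambda>u. \<parallel>x - u\<parallel>\<^sup>2) ` N)" by (rule bdd_belowI[of _ 0]) auto
  have low: "d \<le> \<parallel>x - u\<parallel>\<^sup>2" if "u \<in> N" for u
    unfolding d_def by (rule cInf_lower[OF _ bb]) (use that in auto)
  have "\<exists>u\<in>N. \<parallel>x - u\<parallel>\<^sup>2 < d + inverse (real (Suc n))" for n
    using cInf_lessD[OF ne, of "d + inverse (real (Suc n))"] unfolding d_def[symmetric] by auto
  then obtain X where XN: "\<And>n. X n \<in> N" and X: "\<And>n. \<parallel>x - X n\<parallel>\<^sup>2 < d + inverse (real (Suc n))"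
    by metis
  \<comment> \<open>The midpoint of \<open>X m\<close> and \<open>X n\<close> lies in
    \<open>N\<close>, so its distance from \<open>x\<close> cannot beat \<open>d\<close>; the
    parallelogram law then leaves little room for \<open>X m - X n\<close>.\<close>
  have gap: "\<parallel>X m - X n\<parallel>\<^sup>2 \<le> 2 * inverse (real (Suc m)) + 2 * inverse (real (Suc n))" for m n
  proof -
    have "(1/2) *\<^sub>C (X m + X n) \<in> N" using N XN by (simp add: closed_subspace_def)
    from low[OF this] have "d \<le> \<parallel>x - (1/2) *\<^sub>C (X m + X n)\<parallel>\<^sup>2" .
    moreover have "(x - X n) + (x - X m) = 2 *\<^sub>C (x - (1/2) *\<^sub>C (X m + X n))"
      using hs_scale_add_left[of 1 1 x] by (simp add: scale_simps)
    then have "\<parallel>(x - X n) + (x - X m)\<parallel>\<^sup>2 = 4 * \<parallel>x - (1/2) *\<^sub>C (X m + X n)\<parallel>\<^sup>2"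
      by (simp add: hnorm_scale power_mult_distrib)
    ultimately show ?thesis
      using parallelogram[of "x - X n" "x - X m"] X[of m] X[of n] by simp
  qed
  have "\<exists>K. \<forall>m\<ge>K. \<forall>n\<ge>K. \<parallel>X m - X n\<parallel> < e" if "e > 0" for e
  proof -
    obtain K where K: "inverse (real (Suc K)) < e\<^sup>2 / 4"
      using reals_Archimedean[of "e\<^sup>2/4"] \<open>e > 0\<close> by (metis zero_less_power zero_less_divide_iff zero_less_numeral)
    have "\<parallel>X m - X n\<parallel> < e" if "m \<ge> K" "n \<ge> K" for m n
    proof -
      have "inverse (real (Suc m)) \<le> inverse (real (Suc K))" "inverse (real (Suc n)) \<le> inverse (real (Suc K))"
        using that by (auto intro!: le_imp_inverse_le)
      then have "\<parallel>X m - X n\<parallel>\<^sup>2 < e\<^sup>2" using gap[of m n] K by linarith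
      then show ?thesis using \<open>e > 0\<close> by (simp add: power_less_imp_less_base)
    qed
    then show ?thesis by blast
  qed
  then obtain p where p: "(\<lambda>n. \<parallel>X n - p\<parallel>) \<longlonglongrightarrow> 0" using hcauchy_convergent by blast
  then have pN: "p \<in> N" using N XN unfolding closed_subspace_def hlim_def by blast
  have lim: "(\<lambda>n. \<parallel>X n - p\<parallel> + \<parallel>x - X n\<parallel>) \<longlonglongrightarrow> 0 + sqrt d"
  proof (rule tendsto_add[OF p])
    have "d \<ge> 0" unfolding d_def by (rule cInf_greatest[OF ne]) auto
    show "(\<lambda>n. \<parallel>x - X n\<parallel>) \<longlonglongrightarrow> sqrt d"
    proof (rule tendsto_sandwich[where f = "\<lambda>n. sqrt d"])
      show "(\<lambda>n. sqrt (d + inverse (real (Suc n)))) \<longlonglongrightarrow> sqrt d"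
        using tendsto_real_sqrt[OF tendsto_add[OF tendsto_const LIMSEQ_inverse_real_of_nat, of d]] by simp
      show "\<forall>\<^sub>F n in sequentially. \<parallel>x - X n\<parallel> \<le> sqrt (d + inverse (real (Suc n)))"
        using X less_imp_le real_le_rsqrt by (auto intro!: always_eventually simp: less_imp_le)
      show "\<forall>\<^sub>F n in sequentially. sqrt d \<le> \<parallel>x - X n\<parallel>"
        using low[OF XN] by (auto intro!: always_eventually real_le_lsqrt)
    qed simp
  qed
  have "\<parallel>x - p\<parallel> \<le> 0 + sqrt d"
    using hnorm_diff_triangle[of x p] by (intro LIMSEQ_le_const[OF lim]) (metis add.commute)
  then have dp: "\<parallel>x - p\<parallel>\<^sup>2 \<le> d"
    using low[OF pN] real_le_rsqrt by (metis add_0 hnorm_nonneg real_sqrt_le_iff real_sqrt_unique)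
  have "\<langle>u, x - p\<rangle> = 0" if u: "u \<in> N" for u
  proof -
    \<comment> \<open>Moving \<open>p\<close> within \<open>N\<close> does not bring it closer to
      \<open>x\<close>, so the discriminant lemma applies with \<open>\<alpha> = 0\<close> and
      forces the inner product to vanish.\<close>
    have "0 \<le> 0 + 2 * Re (c * \<langle>x - p, u\<rangle>) + (cmod c)\<^sup>2 * \<parallel>u\<parallel>\<^sup>2" for c
    proof -
      have "p - c *\<^sub>C u \<in> N" using N pN u unfolding closed_subspace_def
        by (metis diff_conv_add_uminus scale_minus_left)
      from low[OF this] have "d \<le> \<parallel>(x - p) + c *\<^sub>C u\<parallel>\<^sup>2" by (simp add: algebra_simps)
      then show ?thesis unfolding hnorm_add_sq using dp
        by (simp add: hnorm_scale power_mult_distrib hs_inner_scale_right)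
    qed
    from hermitian_form_discriminant[OF this] show ?thesis by (simp add: inner_commute_zero[of u])
  qed
  with pN that show thesis by blast
qed

subsection \<open>Bounded operators and adjoints\<close>

lemma bounded_op_add: "bounded_op T \<Longrightarrow> T (x + y) = T x + T y"
  and bounded_op_scale: "bounded_op T \<Longrightarrow> T (c *\<^sub>C x) = c *\<^sub>C T x"
  by (auto simp: bounded_op_def)

lemma bounded_op_zero: "bounded_op T \<Longrightarrow> T 0 = 0"
  using bounded_op_add[of T 0 0] by simp

lemma bounded_op_minus: "bounded_op T \<Longrightarrow> T (- x) = - T x"
  using bounded_op_scale[of T "-1" x] by simp

lemma bounded_op_diff: "bounded_op T \<Longrightarrow> T (x - y) = T x - T y"
  using bounded_op_add[of T x "-y"] bounded_op_minus[of T y] by simp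

lemma bounded_op_sum: "bounded_op T \<Longrightarrow> T (\<Sum>i\<in>A. f i) = (\<Sum>i\<in>A. T (f i))"
  by (induction A rule: infinite_finite_induct) (auto simp: bounded_op_zero bounded_op_add)

lemmas bounded_op_simps = bounded_op_add bounded_op_scale bounded_op_zero bounded_op_minus
  bounded_op_diff bounded_op_sum

lemma bounded_opE:
  assumes "bounded_op T"
  obtains K where "K > 0" and "\<And>x. \<parallel>T x\<parallel> \<le> K * \<parallel>x\<parallel>"
proof -
  obtain K where K: "\<And>x. \<parallel>T x\<parallel> \<le> K * \<parallel>x\<parallel>" using assms by (auto simp: bounded_op_def)
  have "\<parallel>T x\<parallel> \<le> (\<bar>K\<bar> + 1) * \<parallel>x\<parallel>" for x
    using K[of x] mult_right_mono[of K "\<bar>K\<bar> + 1" "\<parallel>x\<parallel>"] by fastforce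
  then show thesis by (intro that[of "\<bar>K\<bar> + 1"]) auto
qed

lemma bounded_opI:
  assumes "\<And>x y. T (x + y) = T x + T y" "\<And>c x. T (c *\<^sub>C x) = c *\<^sub>C T x" "\<And>x. \<parallel>T x\<parallel> \<le> K * \<parallel>x\<parallel>"
  shows "bounded_op T"
  using assms by (auto simp: bounded_op_def)

lemma hlim_bounded_op:
  assumes "bounded_op T" "hlim X L" shows "hlim (\<lambda>n. T (X n)) (T L)"
proof -
  obtain K where "\<And>x. \<parallel>T x\<parallel> \<le> K * \<parallel>x\<parallel>" using bounded_opE[OF assms(1)] by metis
  then show ?thesis using hlim_lipschitz[OF assms(2), of T K] by (simp add: bounded_op_diff[OF assms(1), symmetric])
qed

lemma bounded_op_id [simp]: "bounded_op (\<lambda>x. x)" "bounded_op id"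
  by (auto simp: bounded_op_def intro!: exI[of _ 1])

lemma bounded_op_const_0 [simp]: "bounded_op (\<lambda>x. 0)"
  by (auto simp: bounded_op_def intro!: exI[of _ 0])

lemma bounded_op_plus:
  assumes "bounded_op S" "bounded_op T" shows "bounded_op (\<lambda>x. S x + T x)"
proof -
  obtain K L where "\<And>x. \<parallel>S x\<parallel> \<le> K * \<parallel>x\<parallel>" "\<And>x. \<parallel>T x\<parallel> \<le> L * \<parallel>x\<parallel>"
    using bounded_opE assms by metis
  then show ?thesis using assms
    by (intro bounded_opI[where K = "K + L"])
       (auto simp: bounded_op_simps scale_simps algebra_simps intro: add_mono order_trans[OF hnorm_triangle])
qed

lemma bounded_op_cmult:
  assumes "bounded_op T" shows "bounded_op (\<lambda>x. c *\<^sub>C T x)"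
proof -
  obtain K where "\<And>x. \<parallel>T x\<parallel> \<le> K * \<parallel>x\<parallel>" using bounded_opE[OF assms] by metis
  then show ?thesis using assms
    by (intro bounded_opI[where K = "cmod c * K"])
       (auto simp: bounded_op_simps scale_simps hnorm_scale mult.assoc mult.commute[of c] intro: mult_left_mono)
qed

lemma bounded_op_uminus: "bounded_op T \<Longrightarrow> bounded_op (\<lambda>x. - T x)"
  using bounded_op_cmult[of T "-1"] by simp

lemma bounded_op_minus_op: "bounded_op S \<Longrightarrow> bounded_op T \<Longrightarrow> bounded_op (\<lambda>x. S x - T x)"
  using bounded_op_plus[OF _ bounded_op_uminus] by fastforce

lemma bounded_op_comp:
  assumes "bounded_op S" "bounded_op T" shows "bounded_op (\<lambda>x. S (T x))"
proof -
  obtain K L where "K > 0" "\<And>x. \<parallel>S x\<parallel> \<le> K * \<parallel>x\<parallel>" "\<And>x. \<parallel>T x\<parallel> \<le> L * \<parallel>x\<parallel>"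
    using bounded_opE assms by metis
  moreover from this have "\<parallel>S (T x)\<parallel> \<le> K * L * \<parallel>x\<parallel>" for x
    by (smt (verit, ccfv_SIG) mult.assoc mult_left_mono)
  ultimately show ?thesis using assms
    by (intro bounded_opI[where K = "K * L"]) (auto simp: bounded_op_simps)
qed

lemma bounded_op_limit:
  assumes T: "\<And>n. bounded_op (T n)" and L: "\<And>x. hlim (\<lambda>n. T n x) (L x)"
    and K: "\<And>n x. \<parallel>T n x\<parallel> \<le> K * \<parallel>x\<parallel>"
  shows "bounded_op L"
proof (rule bounded_opI[where K = K])
  fix x y c
  show "L (x + y) = L x + L y"
    using hlim_add[OF L[of x] L[of y]] L[of "x + y"] by (simp add: bounded_op_add[OF T] hlim_unique)
  show "L (c *\<^sub>C x) = c *\<^sub>C L x"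
    using hlim_scale[OF L[of x], of c] L[of "c *\<^sub>C x"] by (simp add: bounded_op_scale[OF T] hlim_unique)
  show "\<parallel>L x\<parallel> \<le> K * \<parallel>x\<parallel>" by (rule hlim_hnorm_le[OF L K])
qed

text \<open>The kernel of \<open>\<phi>\<close> is closed, and a vector \<open>e\<close> orthogonal
  to it with \<open>\<phi> e\<close> nonzero exists. Every \<open>x\<close> differs from a multiple
  of \<open>e\<close> by an element of the kernel, which determines the representing multiple of
  \<open>e\<close>.\<close>

lemma riesz_representation:
  assumes add: "\<And>x y. \<phi> (x + y) = \<phi> x + \<phi> y" and scale: "\<And>c x. \<phi> (c *\<^sub>C x) = c * \<phi> x"
    and bd: "\<And>x. cmod (\<phi> x) \<le> K * \<parallel>x\<parallel>"
  obtains z where "\<And>x. \<phi> x = \<langle>z, x\<rangle>"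
proof (cases "\<forall>x. \<phi> x = 0")
  case True
  then show thesis using that[of 0] by simp
next
  case False
  then obtain w where w: "\<phi> w \<noteq> 0" by blast
  have diff: "\<phi> (x - y) = \<phi> x - \<phi> y" for x y
    using add[of x "-y"] scale[of "-1" y] by simp
  have "closed_subspace {x. \<phi> x = 0}"
    unfolding closed_subspace_def
  proof (intro conjI allI impI ballI; (elim conjE)?)
    fix X L assume X: "\<forall>n. X n \<in> {x. \<phi> x = 0}" and L: "hlim X L"
    have "cmod (\<phi> L) \<le> K * \<parallel>X n - L\<parallel>" for n
      using bd[of "X n - L"] X by (simp add: diff)
    moreover have "(\<lambda>n. K * \<parallel>X n - L\<parallel>) \<longlonglongrightarrow> 0"
      using L unfolding hlim_def by (rule tendsto_mult_right_zero)
    ultimately have "cmod (\<phi> L) \<le> 0" by (intro LIMSEQ_le_const) auto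
    then show "L \<in> {x. \<phi> x = 0}" by simp
  qed (use scale[of 0 0] in \<open>auto simp: add scale\<close>)
  then obtain p where p: "\<phi> p = 0" "\<And>u. \<phi> u = 0 \<Longrightarrow> \<langle>u, w - p\<rangle> = 0"
    by (rule orthogonal_decomposition) auto
  define e where "e = w - p"
  have e: "\<phi> e = \<phi> w" by (simp add: e_def diff p)
  then have "e \<noteq> 0" using w scale[of 0 0] by auto
  then have ee: "\<langle>e, e\<rangle> \<noteq> 0" using hs_inner_definite by blast
  have "\<phi> x = \<langle>cnj (\<phi> e / \<langle>e, e\<rangle>) *\<^sub>C e, x\<rangle>" for x
  proof -
    have "\<phi> (x - (\<phi> x / \<phi> e) *\<^sub>C e) = 0" using w by (simp add: diff scale e)
    then have "\<langle>x - (\<phi> x / \<phi> e) *\<^sub>C e, e\<rangle> = 0" using p(2) e_def by blast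
    then have "\<langle>e, x - (\<phi> x / \<phi> e) *\<^sub>C e\<rangle> = 0" by (simp add: inner_commute_zero)
    then show ?thesis using ee w by (simp add: inner_simps e field_simps)
  qed
  then show thesis by (rule that)
qed

lemma adj_unique:
  assumes "\<And>x y. \<langle>T x, y\<rangle> = \<langle>x, S y\<rangle>" shows "adj T = S"
  unfolding adj_def
proof (rule the_equality)
  fix S' assume "\<forall>x y. \<langle>T x, y\<rangle> = \<langle>x, S' y\<rangle>"
  then show "S' = S" using assms by (intro ext inner_eqI) metis
qed (use assms in blast)

text \<open>Riesz representation applied to each functional sending \<open>x\<close> to the inner
  product of \<open>y\<close> with \<open>T x\<close>. Together with \<open>adj_unique\<close> it
  shows that the definite description in \<open>adj\<close> denotes.\<close>

lemma adjoint_exists: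
  assumes T: "bounded_op T"
  obtains S where "bounded_op S" and "\<And>x y. \<langle>T x, y\<rangle> = \<langle>x, S y\<rangle>"
proof -
  obtain K where K: "K > 0" "\<And>x. \<parallel>T x\<parallel> \<le> K * \<parallel>x\<parallel>" using bounded_opE[OF T] by metis
  have "\<exists>z. \<forall>x. \<langle>y, T x\<rangle> = \<langle>z, x\<rangle>" for y
  proof -
    have "cmod \<langle>y, T x\<rangle> \<le> (\<parallel>y\<parallel> * K) * \<parallel>x\<parallel>" for x
      using cauchy_schwarz[of y "T x"] mult_left_mono[OF K(2)[of x], of "\<parallel>y\<parallel>"] by (simp add: mult.assoc)
    then show ?thesis
      by (rule riesz_representation[rotated 2]) (auto simp: bounded_op_simps[OF T] inner_simps)
  qed
  then obtain S where "\<And>x y. \<langle>y, T x\<rangle> = \<langle>S y, x\<rangle>" by metis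
  then have S: "\<langle>T x, y\<rangle> = \<langle>x, S y\<rangle>" for x y by (metis hs_inner_conj_sym)
  have "bounded_op S"
  proof (rule bounded_opI[where K = K])
    fix x y c
    show "S (x + y) = S x + S y" by (rule inner_eqI) (simp add: S[symmetric] inner_simps)
    show "S (c *\<^sub>C x) = c *\<^sub>C S x" by (rule inner_eqI) (simp add: S[symmetric] inner_simps)
    have "\<parallel>S x\<parallel>\<^sup>2 = Re \<langle>T (S x), x\<rangle>" by (simp add: hnorm_sq S)
    also have "\<dots> \<le> \<parallel>T (S x)\<parallel> * \<parallel>x\<parallel>"
      using cauchy_schwarz[of "T (S x)" x] complex_Re_le_cmod order_trans by blast
    also have "\<dots> \<le> K * \<parallel>S x\<parallel> * \<parallel>x\<parallel>" using K(2)[of "S x"] by (simp add: mult_right_mono)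
    finally have "\<parallel>S x\<parallel> * \<parallel>S x\<parallel> \<le> \<parallel>S x\<parallel> * (K * \<parallel>x\<parallel>)" by (simp add: power2_eq_square mult_ac)
    then show "\<parallel>S x\<parallel> \<le> K * \<parallel>x\<parallel>"
      using K(1) by (cases "S x = 0") (auto simp: hnorm_pos)
  qed
  with S that show thesis by blast
qed

lemma adj_bounded: "bounded_op T \<Longrightarrow> bounded_op (adj T)"
  and adj_inner: "bounded_op T \<Longrightarrow> \<langle>T x, y\<rangle> = \<langle>x, adj T y\<rangle>"
  by (metis adjoint_exists adj_unique)+

lemma adj_inner_left: "bounded_op T \<Longrightarrow> \<langle>adj T x, y\<rangle> = \<langle>x, T y\<rangle>"
  by (metis adj_inner hs_inner_conj_sym)

lemma adj_adj: "bounded_op T \<Longrightarrow> adj (adj T) = T"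
  by (rule adj_unique) (simp add: adj_inner_left)

section \<open>Self-adjoint operators and orthogonal projections\<close>

definition self_adjoint :: "('h::sep_inf_chilbert \<Rightarrow> 'h) \<Rightarrow> bool" where
  "self_adjoint T \<longleftrightarrow> bounded_op T \<and> (\<forall>x y. \<langle>T x, y\<rangle> = \<langle>x, T y\<rangle>)"

lemma self_adjointI: "bounded_op T \<Longrightarrow> (\<And>x y. \<langle>T x, y\<rangle> = \<langle>x, T y\<rangle>) \<Longrightarrow> self_adjoint T"
  by (simp add: self_adjoint_def)

lemma self_adjoint_bounded: "self_adjoint T \<Longrightarrow> bounded_op T"
  and self_adjoint_inner: "self_adjoint T \<Longrightarrow> \<langle>T x, y\<rangle> = \<langle>x, T y\<rangle>"
  by (auto simp: self_adjoint_def)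

lemma self_adjoint_adj: "self_adjoint T \<Longrightarrow> adj T = T"
  by (auto simp: self_adjoint_def intro: adj_unique)

lemma self_adjoint_Im: "self_adjoint T \<Longrightarrow> Im \<langle>x, T x\<rangle> = 0"
  using self_adjoint_inner[of T x x] hs_inner_conj_sym[of "T x" x] by (metis Reals_cnj_iff complex_is_Real_iff)

lemma self_adjoint_plus: "self_adjoint S \<Longrightarrow> self_adjoint T \<Longrightarrow> self_adjoint (\<lambda>x. S x + T x)"
  and self_adjoint_diff: "self_adjoint S \<Longrightarrow> self_adjoint T \<Longrightarrow> self_adjoint (\<lambda>x. S x - T x)"
  and self_adjoint_cmult: "self_adjoint T \<Longrightarrow> self_adjoint (\<lambda>x. complex_of_real r *\<^sub>C T x)"
  and self_adjoint_id: "self_adjoint (\<lambda>x. x)"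
  and self_adjoint_0: "self_adjoint (\<lambda>x. 0)"
  by (auto simp: self_adjoint_def inner_simps
      intro: bounded_op_plus bounded_op_minus_op bounded_op_cmult)

lemma self_adjoint_sum:
  "(\<And>i. i \<in> A \<Longrightarrow> self_adjoint (T i)) \<Longrightarrow> self_adjoint (\<lambda>x. \<Sum>i\<in>A. T i x)"
  by (induction A rule: infinite_finite_induct) (auto intro: self_adjoint_plus self_adjoint_0)

lemma self_adjoint_sq: "self_adjoint T \<Longrightarrow> self_adjoint (\<lambda>x. T (T x))"
  by (auto simp: self_adjoint_def bounded_op_comp)

lemma self_adjoint_limit:
  assumes "bounded_op L" "\<And>n. self_adjoint (T n)" "\<And>x. hlim (\<lambda>n. T n x) (L x)"
  shows "self_adjoint L"
proof (rule self_adjointI[OF assms(1)])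
  fix x y
  have "(\<lambda>n. \<langle>T n x, y\<rangle>) \<longlonglongrightarrow> \<langle>L x, y\<rangle>" by (rule hlim_inner_left[OF assms(3)])
  moreover have "(\<lambda>n. \<langle>T n x, y\<rangle>) \<longlonglongrightarrow> \<langle>x, L y\<rangle>"
    using hlim_inner[OF assms(3)] by (simp add: self_adjoint_inner[OF assms(2)])
  ultimately show "\<langle>L x, y\<rangle> = \<langle>x, L y\<rangle>" by (rule LIMSEQ_unique)
qed

lemma is_proj_iff: "is_proj p \<longleftrightarrow> self_adjoint p \<and> (\<forall>x. p (p x) = p x)"
  unfolding is_proj_def self_adjoint_def fun_eq_iff comp_def
  using adj_inner adj_unique by metis

lemma self_adjoint_re: "bounded_op x \<Longrightarrow> self_adjoint (\<lambda>v. (1/2) *\<^sub>C (x v + adj x v))"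
  by (auto simp: self_adjoint_def inner_simps adj_inner adj_inner_left adj_bounded adj_adj
      intro!: bounded_op_plus bounded_op_cmult)

lemma self_adjoint_im: "bounded_op x \<Longrightarrow> self_adjoint (\<lambda>v. (- \<i>/2) *\<^sub>C (x v - adj x v))"
  by (auto simp: self_adjoint_def inner_simps adj_inner adj_inner_left adj_bounded adj_adj algebra_simps
      simp del: scale_minus_left
      intro!: bounded_op_minus_op bounded_op_cmult)

text \<open>The nearest points are chosen one vector at a time. A point of \<open>N\<close> with
  residue orthogonal to \<open>N\<close> is unique, and this alone makes the choice additive,
  homogeneous and idempotent.\<close>

lemma projection_exists:
  assumes N: "closed_subspace N"
  obtains p where "is_proj p" and "\<And>x. p x \<in> N" and "\<And>x. x \<in> N \<Longrightarrow> p x = x"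
    and "\<And>u x. u \<in> N \<Longrightarrow> \<langle>u, x - p x\<rangle> = 0"
proof -
  have "\<exists>q. q \<in> N \<and> (\<forall>u\<in>N. \<langle>u, x - q\<rangle> = 0)" for x
    using orthogonal_decomposition[OF N, of x] by metis
  then obtain p where pN: "\<And>x. p x \<in> N" and p: "\<And>x u. u \<in> N \<Longrightarrow> \<langle>u, x - p x\<rangle> = 0" by metis
  have uniq: "q = p x" if "q \<in> N" "\<And>u. u \<in> N \<Longrightarrow> \<langle>u, x - q\<rangle> = 0" for q x
  proof -
    have d: "q - p x \<in> N" using N that(1) pN[of x] unfolding closed_subspace_def
      by (metis diff_conv_add_uminus scale_minus_left hs_scale_one)
    have "\<langle>q - p x, (x - p x) - (x - q)\<rangle> = 0"
      using that(2)[OF d] p[OF d, of x] by (simp add: inner_diff_right)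
    then have "\<langle>q - p x, q - p x\<rangle> = 0" by simp
    then show ?thesis using hs_inner_definite by fastforce
  qed
  have add: "p (x + y) = p x + p y" for x y
    by (rule uniq[symmetric]) (use N pN p[of _ x] p[of _ y] in \<open>auto simp: closed_subspace_def inner_simps\<close>)
  have scale: "p (c *\<^sub>C x) = c *\<^sub>C p x" for c x
    by (rule uniq[symmetric]) (use N pN p[of _ x] in \<open>auto simp: closed_subspace_def inner_simps\<close>)
  have fixN: "p x = x" if "x \<in> N" for x
    by (rule uniq[symmetric]) (use that in auto)
  have sa: "\<langle>p x, y\<rangle> = \<langle>x, p y\<rangle>" for x y
  proof -
    have "\<langle>p x, y\<rangle> = \<langle>p x, p y\<rangle>" using p[OF pN[of x], of y] by (simp add: inner_simps)
    moreover have "\<langle>x, p y\<rangle> = \<langle>p x, p y\<rangle>"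
      using p[OF pN[of y], of x] inner_commute_zero[of "x - p x" "p y"] by (simp add: inner_simps)
    ultimately show ?thesis by simp
  qed
  have "\<parallel>p x\<parallel> \<le> 1 * \<parallel>x\<parallel>" for x
  proof -
    have "\<parallel>p x + (x - p x)\<parallel>\<^sup>2 = \<parallel>p x\<parallel>\<^sup>2 + \<parallel>x - p x\<parallel>\<^sup>2"
      by (rule hnorm_add_orthogonal) (simp add: p pN)
    then have "\<parallel>p x\<parallel>\<^sup>2 \<le> \<parallel>x\<parallel>\<^sup>2" by simp
    from power2_le_imp_le[OF this] show ?thesis by simp
  qed
  then have "bounded_op p" using add scale by (rule bounded_opI[rotated 2])
  then have "is_proj p" unfolding is_proj_iff self_adjoint_def using sa fixN pN by blast
  then show thesis using that pN fixN p by blast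
qed

lemma is_proj_contraction:
  assumes "is_proj p" shows "\<parallel>p x\<parallel> \<le> \<parallel>x\<parallel>"
proof -
  have sa: "self_adjoint p" and pp: "\<And>x. p (p x) = p x" using assms by (auto simp: is_proj_iff)
  have "\<parallel>p x + (x - p x)\<parallel>\<^sup>2 = \<parallel>p x\<parallel>\<^sup>2 + \<parallel>x - p x\<parallel>\<^sup>2"
    by (rule hnorm_add_orthogonal)
       (simp add: self_adjoint_inner[OF sa] bounded_op_diff[OF self_adjoint_bounded[OF sa]] pp)
  then have "\<parallel>p x\<parallel>\<^sup>2 \<le> \<parallel>x\<parallel>\<^sup>2" by simp
  from power2_le_imp_le[OF this] show ?thesis by simp
qed

text \<open>The kernel used in \<open>sign_projection\<close> and the closed range used in
  \<open>range_proj_minimal\<close> are both written as annihilators, so their closedness comes from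
  here.\<close>

lemma closed_subspace_annihilator: "closed_subspace {v. \<forall>u\<in>S. \<langle>u, v\<rangle> = 0}"
  unfolding closed_subspace_def
proof (intro conjI allI impI ballI; (elim conjE)?)
  fix X L assume X: "\<forall>n. X n \<in> {v. \<forall>u\<in>S. \<langle>u, v\<rangle> = 0}" and L: "hlim X L"
  have "\<langle>u, L\<rangle> = 0" if "u \<in> S" for u
    using hlim_inner[OF L, of u] X that by (simp add: LIMSEQ_const_iff)
  then show "L \<in> {v. \<forall>u\<in>S. \<langle>u, v\<rangle> = 0}" by blast
qed (auto simp: inner_simps)

subsection \<open>Positive operators\<close>

lemma positive_op_bounded: "positive_op A \<Longrightarrow> bounded_op A"
  and positive_op_Re: "positive_op A \<Longrightarrow> 0 \<le> Re \<langle>x, A x\<rangle>"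
  by (auto simp: positive_op_def)

lemma self_adjoint_positive:
  "self_adjoint A \<Longrightarrow> (\<And>x. 0 \<le> Re \<langle>x, A x\<rangle>) \<Longrightarrow> positive_op A"
  by (simp add: positive_op_def self_adjoint_Im self_adjoint_bounded)

text \<open>Polarization: reality of the quadratic form at \<open>x + y\<close> settles the
  imaginary part of the claimed equality, reality at \<open>x + \<i> *\<^sub>C y\<close> the real
  part.\<close>

lemma positive_op_self_adjoint:
  assumes "positive_op A" shows "self_adjoint A"
proof (rule self_adjointI[OF positive_op_bounded[OF assms]])
  fix x y
  have b: "bounded_op A" using assms by (rule positive_op_bounded)
  have im: "Im \<langle>u, A u\<rangle> = 0" for u using assms by (auto simp: positive_op_def)
  have 1: "Im (\<langle>x, A y\<rangle> + \<langle>y, A x\<rangle>) = 0"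
    using im[of "x + y"] im[of x] im[of y] by (simp add: bounded_op_simps[OF b] inner_simps)
  have 2: "Im (\<i> * \<langle>x, A y\<rangle> - \<i> * \<langle>y, A x\<rangle>) = 0"
    using im[of "x + \<i> *\<^sub>C y"] im[of x] im[of y] by (simp add: bounded_op_simps[OF b] inner_simps)
  show "\<langle>A x, y\<rangle> = \<langle>x, A y\<rangle>"
    using 1 2 unfolding hs_inner_conj_sym[of y "A x"] by (simp add: complex_eq_iff)
qed

lemma positive_op_cauchy_schwarz:
  assumes "positive_op A"
  shows "(cmod \<langle>x, A y\<rangle>)\<^sup>2 \<le> Re \<langle>x, A x\<rangle> * Re \<langle>y, A y\<rangle>"
proof (rule hermitian_form_discriminant)
  fix c
  have b: "bounded_op A" using assms by (rule positive_op_bounded)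
  have "\<langle>y, A x\<rangle> = cnj \<langle>x, A y\<rangle>"
    using self_adjoint_inner[OF positive_op_self_adjoint[OF assms], of y x, symmetric]
      hs_inner_conj_sym[of "A y" x] by (rule trans)
  moreover have "Re (c * (cnj c * z)) = (cmod c)\<^sup>2 * Re z" "Re (cnj c * (c * z)) = (cmod c)\<^sup>2 * Re z" for z
    unfolding cmod_power2 by (auto simp: algebra_simps power2_eq_square)
  moreover have "Re (cnj c * cnj z) = Re (c * z)" for z by simp
  ultimately have "Re \<langle>x + c *\<^sub>C y, A (x + c *\<^sub>C y)\<rangle>
     = Re \<langle>x, A x\<rangle> + 2 * Re (c * \<langle>x, A y\<rangle>) + (cmod c)\<^sup>2 * Re \<langle>y, A y\<rangle>"
    by (simp add: bounded_op_simps[OF b] inner_simps distrib_left del: times_complex.sel complex_cnj)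
  then show "0 \<le> Re \<langle>x, A x\<rangle> + 2 * Re (c * \<langle>x, A y\<rangle>) + (cmod c)\<^sup>2 * Re \<langle>y, A y\<rangle>"
    using positive_op_Re[OF assms] by metis
qed (rule positive_op_Re[OF assms])

text \<open>The Cauchy-Schwarz inequality for \<open>A\<close>, taken at \<open>A y\<close> and
  \<open>y\<close>, bounds the norm of \<open>A y\<close> by zero.\<close>

lemma positive_op_null:
  assumes "positive_op A" "Re \<langle>y, A y\<rangle> = 0" shows "A y = 0"
  using positive_op_cauchy_schwarz[OF assms(1), of "A y" y] assms(2) hs_inner_definite by simp

text \<open>The Cauchy-Schwarz inequality for \<open>A\<close> at \<open>A x\<close> and
  \<open>x\<close>, with the form bound used on both factors; one factor of the squared norm of
  \<open>A x\<close> then cancels.\<close>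

lemma positive_op_norm_bound:
  assumes A: "positive_op A" and w: "\<And>x. Re \<langle>x, A x\<rangle> \<le> w * \<parallel>x\<parallel>\<^sup>2" and "0 \<le> w"
  shows "\<parallel>A x\<parallel> \<le> w * \<parallel>x\<parallel>"
proof -
  have "(cmod \<langle>A x, A x\<rangle>)\<^sup>2 \<le> Re \<langle>A x, A (A x)\<rangle> * Re \<langle>x, A x\<rangle>"
    by (rule positive_op_cauchy_schwarz[OF A])
  also have "\<dots> \<le> (w * \<parallel>A x\<parallel>\<^sup>2) * (w * \<parallel>x\<parallel>\<^sup>2)"
    using assms positive_op_Re[OF A] by (intro mult_mono) auto
  finally have "\<parallel>A x\<parallel>\<^sup>2 * \<parallel>A x\<parallel>\<^sup>2 \<le> \<parallel>A x\<parallel>\<^sup>2 * (w * \<parallel>x\<parallel>)\<^sup>2"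
    by (simp add: inner_self norm_power power_mult_distrib mult_ac) (simp add: power2_eq_square mult_ac)
  then show ?thesis
  proof (cases "A x = 0")
    case False
    then have "0 < \<parallel>A x\<parallel>\<^sup>2" by (simp add: hnorm_pos)
    with \<open>\<parallel>A x\<parallel>\<^sup>2 * \<parallel>A x\<parallel>\<^sup>2 \<le> _\<close> have "\<parallel>A x\<parallel>\<^sup>2 \<le> (w * \<parallel>x\<parallel>)\<^sup>2"
      by (rule mult_left_le_imp_le)
    then show ?thesis by (rule power2_le_imp_le) (simp add: \<open>0 \<le> w\<close>)
  qed (simp add: \<open>0 \<le> w\<close>)
qed

subsection \<open>Spectral decomposition into narrow bins\<close>

definition commute :: "('h \<Rightarrow> 'h) \<Rightarrow> ('h \<Rightarrow> 'h) \<Rightarrow> bool" where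
  "commute S T \<longleftrightarrow> (\<forall>x. S (T x) = T (S x))"

lemma commuteD: "commute S T \<Longrightarrow> S (T x) = T (S x)"
  by (simp add: commute_def)

text \<open>For \<^term>\<open>T x = x - a (a x)\<close> the iteration \<open>Y (n + 1) = (T + (Y n)\<^sup>2) / 2\<close> is dominated by the scalar
  iteration \<open>r (n + 1) = (1 + (r n)\<^sup>2) / 2\<close>, which stays below 1; its limit \<open>y\<close> satisfies
  \<open>(1 - y)\<^sup>2 = 1 - T\<close>.\<close>

lemma sqrt_of_square_contraction:
  fixes a :: "'h::sep_inf_chilbert \<Rightarrow> 'h"
  assumes a: "self_adjoint a" and le: "\<And>x. \<parallel>a x\<parallel> \<le> \<parallel>x\<parallel>"
  obtains s where "self_adjoint s" "\<And>x. s (s x) = a (a x)" "\<And>x. 0 \<le> Re \<langle>x, s x\<rangle>"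
    "\<And>T. bounded_op T \<Longrightarrow> commute T a \<Longrightarrow> commute T s"
proof -
  define T where "T x = x - a (a x)" for x
  define Y where "Y = rec_nat (\<lambda>x. 0) (\<lambda>n Z x. (1/2) *\<^sub>C (T x + Z (Z x)))"
  define r where "r = rec_nat (0::real) (\<lambda>n q. (1 + q\<^sup>2) / 2)"
  have Y0: "Y 0 = (\<lambda>x. 0)" and YS: "Y (Suc n) x = (1/2) *\<^sub>C (T x + Y n (Y n x))" for n x
    by (simp_all add: Y_def)
  have r0: "r 0 = 0" and rS: "r (Suc n) = (1 + (r n)\<^sup>2) / 2" for n by (simp_all add: r_def)
  have r01: "0 \<le> r n \<and> r n \<le> 1" for n
    by (induction n) (auto simp: r0 rS power_le_one)
  have rmono: "r n \<le> r (Suc n)" for n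
    using zero_le_power2[of "1 - r n"] by (simp add: rS power2_diff)
  have T_sa: "self_adjoint T" unfolding T_def
    by (intro self_adjoint_diff self_adjoint_id self_adjoint_sq a)
  \<comment> \<open>Since \<open>a\<close> is a contraction, the term in \<open>a (a x)\<close> is
    at most that in \<open>a x\<close>, which enters twice with a minus sign.\<close>
  have T_le: "\<parallel>T x\<parallel> \<le> \<parallel>x\<parallel>" for x
  proof (rule power2_le_imp_le)
    have "\<parallel>T x\<parallel>\<^sup>2 = \<parallel>x\<parallel>\<^sup>2 - 2 * \<parallel>a x\<parallel>\<^sup>2 + \<parallel>a (a x)\<parallel>\<^sup>2"
      using hnorm_add_sq[of x "- a (a x)"] by (simp add: T_def hnorm_sq[of "a x"] self_adjoint_inner[OF a])
    moreover have "\<parallel>a (a x)\<parallel>\<^sup>2 \<le> \<parallel>a x\<parallel>\<^sup>2" using le[of "a x"] by (simp add: power_mono)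
    ultimately show "\<parallel>T x\<parallel>\<^sup>2 \<le> \<parallel>x\<parallel>\<^sup>2" using zero_le_power2[of "\<parallel>a x\<parallel>"] by linarith
  qed simp
  have half: "complex_of_real (1/2) = 1/2" by simp
  have Y_sa: "self_adjoint (Y n)" for n
  proof (induction n)
    case (Suc n)
    have "Y (Suc n) = (\<lambda>x. complex_of_real (1/2) *\<^sub>C (T x + Y n (Y n x)))" by (simp add: fun_eq_iff YS)
    then show ?case using Suc by (simp only:) (intro self_adjoint_cmult self_adjoint_plus T_sa self_adjoint_sq)
  qed (simp add: Y0 self_adjoint_0)
  note Y_b = self_adjoint_bounded[OF Y_sa]
  have Y_le: "\<parallel>Y n x\<parallel> \<le> r n * \<parallel>x\<parallel>" for n x
  proof (induction n arbitrary: x)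
    case (Suc n)
    have "\<parallel>Y n (Y n x)\<parallel> \<le> r n * (r n * \<parallel>x\<parallel>)"
      using Suc[of "Y n x"] mult_left_mono[OF Suc[of x], of "r n"] r01[of n] by linarith
    then have "\<parallel>T x + Y n (Y n x)\<parallel> \<le> \<parallel>x\<parallel> + r n * (r n * \<parallel>x\<parallel>)"
      using hnorm_triangle[of "T x" "Y n (Y n x)"] T_le[of x] by linarith
    then show ?case by (simp add: YS rS hnorm_scale power2_eq_square algebra_simps)
  qed (simp add: Y0 r0)
  have Y_le1: "\<parallel>Y n x\<parallel> \<le> \<parallel>x\<parallel>" for n x
    using Y_le[of n x] r01[of n] mult_right_mono[of "r n" 1 "\<parallel>x\<parallel>"] by simp
  \<comment> \<open>A difference of squares is split as
    \<open>Z Z - Y Y = Z (Z - Y) + (Z - Y) Y\<close>, valid without commutation. The same splitting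
    of the scalar iteration gives exactly the increment of \<open>r\<close>.\<close>
  have Y_inc: "\<parallel>Y (Suc n) x - Y n x\<parallel> \<le> (r (Suc n) - r n) * \<parallel>x\<parallel>" for n x
  proof (induction n arbitrary: x)
    case 0
    show ?case using Y_le[of "Suc 0" x] by (simp add: Y0 r0)
  next
    case (Suc n)
    let ?Z = "Y (Suc n)" and ?q = "r (Suc n)"
    let ?u = "?Z (?Z x - Y n x)" and ?v = "?Z (Y n x) - Y n (Y n x)"
    have "Y (Suc (Suc n)) x - ?Z x = (1/2) *\<^sub>C (?u + ?v)"
      unfolding YS[of "Suc n"] YS[of n x] scale_diff_right[symmetric] bounded_op_diff[OF Y_b] by simp
    moreover have "\<parallel>?u\<parallel> \<le> ?q * ((?q - r n) * \<parallel>x\<parallel>)"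
      using Y_le[of "Suc n" "?Z x - Y n x"] mult_left_mono[OF Suc[of x], of ?q] r01[of "Suc n"] by linarith
    moreover have "\<parallel>?v\<parallel> \<le> (?q - r n) * (r n * \<parallel>x\<parallel>)"
      using Suc[of "Y n x"] mult_left_mono[OF Y_le[of n x], of "?q - r n"] rmono[of n] by linarith
    ultimately have "\<parallel>Y (Suc (Suc n)) x - ?Z x\<parallel> \<le> (1/2) * (?q * ((?q - r n) * \<parallel>x\<parallel>) + (?q - r n) * (r n * \<parallel>x\<parallel>))"
      using hnorm_triangle[of ?u ?v] by (simp add: hnorm_scale)
    also have "\<dots> = (r (Suc (Suc n)) - r (Suc n)) * \<parallel>x\<parallel>"
      unfolding rS[of "Suc n"] rS[of n] by (simp add: field_simps power2_eq_square)
    finally show ?case .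
  qed
  have "\<exists>L. hlim (\<lambda>n. Y n x) L" for x
  proof -
    have "\<parallel>Y (Suc n) x - Y n x\<parallel> \<le> r (Suc n) * \<parallel>x\<parallel> - r n * \<parallel>x\<parallel>" for n
      using Y_inc[of n x] by (simp add: left_diff_distrib)
    then obtain L where "(\<lambda>n. \<parallel>Y n x - L\<parallel>) \<longlonglongrightarrow> 0"
      by (rule hcauchy_increments[where B = "\<parallel>x\<parallel>"])
         (use r01 mult_right_mono[of "r _" 1 "\<parallel>x\<parallel>"] in auto)
    then show ?thesis by (auto simp: hlim_def)
  qed
  then obtain y where y: "\<And>x. hlim (\<lambda>n. Y n x) (y x)" by metis
  have y_b: "bounded_op y" by (rule bounded_op_limit[OF Y_b y, where K = 1]) (simp add: Y_le1)
  have y_sa: "self_adjoint y" by (rule self_adjoint_limit[OF y_b Y_sa y])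
  have y_le: "\<parallel>y x\<parallel> \<le> \<parallel>x\<parallel>" for x by (rule hlim_hnorm_le[OF y Y_le1])
  \<comment> \<open>Operator and argument both vary with \<open>n\<close>; comparing with
    \<open>Y n (y x)\<close> separates them because every \<open>Y n\<close> is a
    contraction.\<close>
  have yy: "hlim (\<lambda>n. Y n (Y n x)) (y (y x))" for x
    unfolding hlim_def
  proof (rule Lim_null_comparison[where g = "\<lambda>n. \<parallel>Y n x - y x\<parallel> + \<parallel>Y n (y x) - y (y x)\<parallel>"])
    have "\<parallel>Y n (Y n x) - y (y x)\<parallel> \<le> \<parallel>Y n x - y x\<parallel> + \<parallel>Y n (y x) - y (y x)\<parallel>" for n
      using hnorm_diff_triangle[of "Y n (Y n x)" "y (y x)" "Y n (y x)"] Y_le1[of n "Y n x - y x"]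
      by (simp add: bounded_op_diff[OF Y_b])
    then show "\<forall>\<^sub>F n in sequentially. norm \<parallel>Y n (Y n x) - y (y x)\<parallel> \<le> \<parallel>Y n x - y x\<parallel> + \<parallel>Y n (y x) - y (y x)\<parallel>"
      by simp
  qed (use y in \<open>auto simp: hlim_def intro: tendsto_add_zero\<close>)
  have fixpoint: "y x = (1/2) *\<^sub>C (T x + y (y x))" for x
  proof (rule hlim_unique)
    show "hlim (\<lambda>n. Y (Suc n) x) (y x)" using y[of x] unfolding hlim_def by (rule LIMSEQ_Suc)
    show "hlim (\<lambda>n. Y (Suc n) x) ((1/2) *\<^sub>C (T x + y (y x)))"
      unfolding YS by (intro hlim_scale hlim_add yy) simp
  qed
  define s where "s x = x - y x" for x
  have s_sa: "self_adjoint s" unfolding s_def by (intro self_adjoint_diff self_adjoint_id y_sa)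
  have ss: "s (s x) = a (a x)" for x
  proof -
    have "2 *\<^sub>C y x = T x + y (y x)" by (subst fixpoint) (simp add: hs_scale_scale)
    then have "y x + y x = T x + y (y x)" using hs_scale_add_left[of 1 1 "y x"] by simp
    then have "y (y x) = y x + y x - T x" by (simp add: algebra_simps)
    then show ?thesis by (simp add: s_def bounded_op_diff[OF y_b] T_def)
  qed
  have s_pos: "0 \<le> Re \<langle>x, s x\<rangle>" for x
  proof -
    have "Re \<langle>x, y x\<rangle> \<le> \<parallel>x\<parallel> * \<parallel>y x\<parallel>"
      using cauchy_schwarz[of x "y x"] complex_Re_le_cmod order_trans by blast
    also have "\<dots> \<le> \<parallel>x\<parallel> * \<parallel>x\<parallel>" using y_le by (simp add: mult_left_mono)
    finally show ?thesis by (simp add: s_def inner_simps hnorm_sq[symmetric] power2_eq_square)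
  qed
  \<comment> \<open>Each iterate is a polynomial in \<open>a\<close>, so commutation passes to the
    iterates by induction and to the limit by continuity of \<open>S\<close>.\<close>
  have s_comm: "commute S s" if S: "bounded_op S" "commute S a" for S
    unfolding commute_def
  proof
    fix x
    have "S (Y n x) = Y n (S x)" for n x
      by (induction n arbitrary: x)
         (simp_all add: Y0 YS T_def bounded_op_simps[OF S(1)] commuteD[OF S(2)])
    then have "hlim (\<lambda>n. Y n (S x)) (S (y x))" using hlim_bounded_op[OF S(1) y[of x]] by simp
    then show "S (s x) = s (S x)"
      using hlim_unique[OF y[of "S x"]] by (simp add: s_def bounded_op_simps[OF S(1)])
  qed
  show thesis using that s_sa ss s_pos s_comm by blast
qed

text \<open>Rescaling by a bound \<open>K\<close> reduces to a contraction. The bound is chosen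
  positive, so that the division is sound for \<open>a = 0\<close> as well.\<close>

lemma sqrt_of_square:
  fixes a :: "'h::sep_inf_chilbert \<Rightarrow> 'h"
  assumes a: "self_adjoint a"
  obtains s where "self_adjoint s" "\<And>x. s (s x) = a (a x)" "\<And>x. 0 \<le> Re \<langle>x, s x\<rangle>"
    "\<And>T. bounded_op T \<Longrightarrow> commute T a \<Longrightarrow> commute T s"
proof -
  obtain K where K: "K > 0" "\<And>x. \<parallel>a x\<parallel> \<le> K * \<parallel>x\<parallel>"
    using bounded_opE[OF self_adjoint_bounded[OF a]] by metis
  define c where "c = complex_of_real K"
  have c: "c \<noteq> 0" using K by (simp add: c_def)
  define b where "b x = complex_of_real (1/K) *\<^sub>C a x" for x
  have b_sa: "self_adjoint b" unfolding b_def by (rule self_adjoint_cmult[OF a])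
  have ab: "a x = c *\<^sub>C b x" for x using K by (simp add: b_def c_def hs_scale_scale)
  have "\<parallel>b x\<parallel> \<le> \<parallel>x\<parallel>" for x using K by (simp add: b_def hnorm_scale norm_divide divide_le_eq mult.commute)
  then obtain s where s: "self_adjoint s" "\<And>x. s (s x) = b (b x)" "\<And>x. 0 \<le> Re \<langle>x, s x\<rangle>"
    "\<And>T. bounded_op T \<Longrightarrow> commute T b \<Longrightarrow> commute T s"
    using sqrt_of_square_contraction[OF b_sa] by metis
  show thesis
  proof (rule that[of "\<lambda>x. c *\<^sub>C s x"])
    show "self_adjoint (\<lambda>x. c *\<^sub>C s x)" unfolding c_def by (rule self_adjoint_cmult[OF s(1)])
    show "c *\<^sub>C s (c *\<^sub>C s x) = a (a x)" for x
      by (simp add: ab s(2) bounded_op_scale[OF self_adjoint_bounded[OF s(1)]]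
          bounded_op_scale[OF self_adjoint_bounded[OF b_sa]])
    show "0 \<le> Re \<langle>x, c *\<^sub>C s x\<rangle>" for x using s(3)[of x] K by (simp add: c_def inner_simps)
    fix T assume T: "bounded_op T" "commute T a"
    have "commute T b" unfolding commute_def
      by (simp add: b_def bounded_op_scale[OF T(1)] commuteD[OF T(2)])
    then have "commute T s" using s(4) T by blast
    then show "commute T (\<lambda>x. c *\<^sub>C s x)" by (simp add: commute_def bounded_op_scale[OF T(1)])
  qed
qed

text \<open>A subspace invariant under both \<open>T\<close> and its adjoint has a projection
  commuting with \<open>T\<close>; this supplies the second half of the invariance in
  \<open>sign_projection\<close>.\<close>

lemma commute_adj:
  assumes "bounded_op T" "self_adjoint a" "commute T a" shows "commute (adj T) a"
  unfolding commute_def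
proof (intro allI inner_eqI)
  fix x u
  have "\<langle>u, adj T (a x)\<rangle> = \<langle>a (T u), x\<rangle>"
    by (simp add: adj_inner[OF assms(1), symmetric] self_adjoint_inner[OF assms(2)])
  also have "\<dots> = \<langle>T (a u), x\<rangle>" by (simp add: commuteD[OF assms(3)])
  also have "\<dots> = \<langle>u, a (adj T x)\<rangle>"
    by (simp add: adj_inner[OF assms(1)] self_adjoint_inner[OF assms(2)])
  finally show "\<langle>u, adj T (a x)\<rangle> = \<langle>u, a (adj T x)\<rangle>" .
qed

text \<open>With \<open>s = \<bar>a\<bar>\<close>, the projection onto the kernel of \<open>s - a\<close> splits the operator \<open>a\<close> by sign:
  the range of \<open>s + a\<close> lies in that kernel, so \<open>a = -s\<close> on its complement.\<close>

lemma sign_projection: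
  fixes a :: "'h::sep_inf_chilbert \<Rightarrow> 'h"
  assumes a: "self_adjoint a"
  obtains E where "is_proj E" "\<And>T. bounded_op T \<Longrightarrow> commute T a \<Longrightarrow> commute T E"
    "\<And>x. 0 \<le> Re \<langle>E x, a (E x)\<rangle>" "\<And>x. Re \<langle>x - E x, a (x - E x)\<rangle> \<le> 0"
proof -
  obtain s where s: "self_adjoint s" "\<And>x. s (s x) = a (a x)" "\<And>x. 0 \<le> Re \<langle>x, s x\<rangle>"
    and sc: "\<And>T. bounded_op T \<Longrightarrow> commute T a \<Longrightarrow> commute T s" using sqrt_of_square[OF a] by metis
  have ab: "bounded_op a" and sb: "bounded_op s" using a s by (auto intro: self_adjoint_bounded)
  have as: "a (s x) = s (a x)" for x using sc[OF ab] by (simp add: commute_def)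
  \<comment> \<open>By self-adjointness the annihilator of the range of \<open>s - a\<close> is the
    kernel of \<open>s - a\<close>.\<close>
  define N where "N = {v. \<forall>u\<in>range (\<lambda>w. s w - a w). \<langle>u, v\<rangle> = 0}"
  have N: "v \<in> N \<longleftrightarrow> s v = a v" for v
  proof -
    have "\<langle>s w - a w, v\<rangle> = \<langle>w, s v - a v\<rangle>" for w
      by (simp add: inner_simps self_adjoint_inner[OF a] self_adjoint_inner[OF s(1)])
    then have "v \<in> N \<longleftrightarrow> (\<forall>w. \<langle>w, s v - a v\<rangle> = 0)" by (auto simp: N_def)
    also have "\<dots> \<longleftrightarrow> s v - a v = 0" using hs_inner_definite[of "s v - a v"] by auto
    finally show ?thesis by simp
  qed
  have "closed_subspace N" unfolding N_def by (rule closed_subspace_annihilator)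
  then obtain E where E: "is_proj E" "\<And>x. E x \<in> N" "\<And>x. x \<in> N \<Longrightarrow> E x = x"
    "\<And>u x. u \<in> N \<Longrightarrow> \<langle>u, x - E x\<rangle> = 0" by (rule projection_exists) (rule that)
  have Esa: "self_adjoint E" using E(1) by (simp add: is_proj_iff)
  have inv: "E (T (E x)) = T (E x)" if T: "bounded_op T" "commute T a" for T x
  proof (rule E(3))
    have "s (T (E x)) = a (T (E x))"
      using E(2)[of x] sc[OF T] T(2) unfolding N by (metis commuteD)
    then show "T (E x) \<in> N" by (simp add: N)
  qed
  show thesis
  proof (rule that[OF E(1)])
    fix T assume T: "bounded_op T" "commute T a"
    note T' = adj_bounded[OF T(1)] commute_adj[OF T(1) a T(2)]
    \<comment> \<open>Invariance of \<open>N\<close> under the adjoint of \<open>T\<close>, read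
      through the inner product, becomes this identity; invariance under \<open>T\<close> itself is
      the identity with \<open>T (E x)\<close> on the right.\<close>
    have "E (T (E x)) = E (T x)" for x
    proof (rule inner_eqI)
      fix u
      have "\<langle>u, E (T (E x))\<rangle> = \<langle>E (adj T (E u)), x\<rangle>"
        by (simp add: self_adjoint_inner[OF Esa] adj_inner_left[OF T(1)])
      also have "\<dots> = \<langle>u, E (T x)\<rangle>"
        by (simp add: inv[OF T'] self_adjoint_inner[OF Esa] adj_inner_left[OF T(1)])
      finally show "\<langle>u, E (T (E x))\<rangle> = \<langle>u, E (T x)\<rangle>" .
    qed
    then show "commute T E" unfolding commute_def using inv[OF T] by simp
  next
    fix x
    have "a (E x) = s (E x)" using E(2)[of x] N by simp
    then show "0 \<le> Re \<langle>E x, a (E x)\<rangle>" using s(3) by simp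
    define v where "v = x - E x"
    have "\<langle>u, s v + a v\<rangle> = 0" for u
    proof -
      have "s u + a u \<in> N" unfolding N
        by (simp add: bounded_op_add[OF ab] bounded_op_add[OF sb] s(2) as add.commute)
      from E(4)[OF this] have "\<langle>s u + a u, v\<rangle> = 0" by (simp add: v_def)
      then show ?thesis by (simp add: inner_simps self_adjoint_inner[OF a] self_adjoint_inner[OF s(1)])
    qed
    then have "s v + a v = 0" using hs_inner_definite by blast
    then have "a v = - s v" by (simp add: eq_neg_iff_add_eq_0 add.commute)
    then show "Re \<langle>x - E x, a (x - E x)\<rangle> \<le> 0" using s(3)[of v] by (simp add: v_def)
  qed
qed

text \<open>The compression of \<open>a - \<alpha>\<close> to the range of \<open>F\<close> has a
  form between 0 and \<open>w\<close>, so it is positive and the form bound is a norm bound. Taking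
  the lower end \<open>\<alpha>\<close> of the band as reference value is what makes it
  positive.\<close>

lemma narrow_bin_norm:
  assumes F: "is_proj F" "commute F a" and a: "self_adjoint a" and "0 \<le> w"
    and lo: "\<And>x. \<alpha> * \<parallel>F x\<parallel>\<^sup>2 \<le> Re \<langle>F x, a (F x)\<rangle>" and up: "\<And>x. Re \<langle>F x, a (F x)\<rangle> \<le> (\<alpha> + w) * \<parallel>F x\<parallel>\<^sup>2"
  shows "\<parallel>a (F x) - complex_of_real \<alpha> *\<^sub>C F x\<parallel> \<le> w * \<parallel>F x\<parallel>"
proof -
  have Fs: "self_adjoint F" and FF: "\<And>x. F (F x) = F x" using F by (auto simp: is_proj_iff)
  note Fb = self_adjoint_bounded[OF Fs]
  define A where "A x = F (a (F x) - complex_of_real \<alpha> *\<^sub>C F x)" for x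
  have AF: "A x = a (F x) - complex_of_real \<alpha> *\<^sub>C F x" for x
    by (simp add: A_def bounded_op_simps[OF Fb] FF commuteD[OF F(2)])
  have Ab: "bounded_op A" unfolding A_def
    by (rule bounded_op_comp[OF Fb bounded_op_minus_op[OF bounded_op_comp[OF self_adjoint_bounded[OF a] Fb]
      bounded_op_cmult[OF Fb]]])
  have q: "\<langle>x, A x\<rangle> = \<langle>F x, a (F x)\<rangle> - complex_of_real (\<alpha> * \<parallel>F x\<parallel>\<^sup>2)" for x
    by (simp add: A_def self_adjoint_inner[OF Fs, symmetric] inner_simps inner_self)
  have "positive_op A" unfolding positive_op_def q using Ab lo self_adjoint_Im[OF a] by simp
  moreover have "Re \<langle>x, A x\<rangle> \<le> w * \<parallel>x\<parallel>\<^sup>2" for x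
  proof -
    have "Re \<langle>x, A x\<rangle> \<le> w * \<parallel>F x\<parallel>\<^sup>2" using up[of x] by (simp add: q algebra_simps)
    also have "\<dots> \<le> w * \<parallel>x\<parallel>\<^sup>2" using is_proj_contraction[OF F(1), of x] \<open>0 \<le> w\<close>
      by (simp add: mult_left_mono power_mono)
    finally show ?thesis .
  qed
  ultimately have "\<parallel>A (F x)\<parallel> \<le> w * \<parallel>F x\<parallel>" using \<open>0 \<le> w\<close> by (rule positive_op_norm_bound)
  then show ?thesis by (simp add: AF FF)
qed

text \<open>For bounded \<open>G\<close> and self-adjoint \<open>a\<close> this is membership in the
  von Neumann algebra generated by \<open>a\<close>: the property that spectral projections have,
  stated without a spectral measure.\<close>

definition bicommutes :: "('h::sep_inf_chilbert \<Rightarrow> 'h) \<Rightarrow> ('h \<Rightarrow> 'h) \<Rightarrow> bool" where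
  "bicommutes a G \<longleftrightarrow> (\<forall>T. bounded_op T \<longrightarrow> commute T a \<longrightarrow> commute T G)"

lemma bicommutesI: "(\<And>T. bounded_op T \<Longrightarrow> commute T a \<Longrightarrow> commute T G) \<Longrightarrow> bicommutes a G"
  and bicommutesD: "bicommutes a G \<Longrightarrow> bounded_op T \<Longrightarrow> commute T a \<Longrightarrow> commute T G"
  by (auto simp: bicommutes_def)

text \<open>The lowest band of width \<open>w\<close> is cut off by the sign projection of
  \<open>a - \<beta>\<close>, and the induction hypothesis divides the rest. Indices run up to and
  including \<open>m\<close>, so there are \<open>m + 1\<close> bins, some of which may be
  zero.\<close>

lemma spectral_bins_aux:
  fixes a :: "'h::sep_inf_chilbert \<Rightarrow> 'h"
  assumes a: "self_adjoint a" and w: "0 \<le> w"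
    and "is_proj G" "bicommutes a G"
    and "\<And>x. \<alpha> * \<parallel>G x\<parallel>\<^sup>2 \<le> Re \<langle>G x, a (G x)\<rangle>"
    and "\<And>x. Re \<langle>G x, a (G x)\<rangle> \<le> (\<alpha> + (real m + 1) * w) * \<parallel>G x\<parallel>\<^sup>2"
  shows "\<exists>F c. (\<forall>j\<le>m. is_proj (F j) \<and> bicommutes a (F j)
       \<and> (\<forall>x. \<parallel>a (F j x) - complex_of_real (c j) *\<^sub>C F j x\<parallel> \<le> w * \<parallel>F j x\<parallel>))
     \<and> (\<forall>i\<le>m. \<forall>j\<le>m. i \<noteq> j \<longrightarrow> (\<forall>x. F i (F j x) = 0)) \<and> (\<forall>x. (\<Sum>j\<le>m. F j x) = G x)"
  using assms(3-)
proof (induction m arbitrary: G \<alpha>)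
  case 0
  have "commute a a" by (simp add: commute_def)
  then have "commute G a" using bicommutesD[OF 0(2) self_adjoint_bounded[OF a]] by (auto simp: commute_def)
  then show ?case using narrow_bin_norm[OF 0(1) _ a w, of \<alpha>] 0
    by (intro exI[of _ "\<lambda>_. G"] exI[of _ "\<lambda>_. \<alpha>"]) simp
next
  case (Suc m)
  have ab: "bounded_op a" using a by (rule self_adjoint_bounded)
  have Gs: "self_adjoint G" and GG: "\<And>x. G (G x) = G x" using Suc.prems(1) by (auto simp: is_proj_iff)
  note Gb = self_adjoint_bounded[OF Gs]
  \<comment> \<open>The cut between the first bin, projection \<open>F0\<close>, and the remainder
    \<open>G2\<close>. The upper end is consistent because \<open>\<beta> + (m + 1) * w\<close> is
    \<open>\<alpha> + (m + 2) * w\<close>.\<close>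
  define \<beta> where "\<beta> = \<alpha> + w"
  define d where "d x = a x - complex_of_real \<beta> *\<^sub>C x" for x
  have "self_adjoint d" unfolding d_def by (intro self_adjoint_diff a self_adjoint_cmult self_adjoint_id)
  then obtain E where E: "is_proj E" and Ec: "\<And>T. bounded_op T \<Longrightarrow> commute T d \<Longrightarrow> commute T E"
    and Elo: "\<And>x. 0 \<le> Re \<langle>E x, d (E x)\<rangle>" and Eup: "\<And>x. Re \<langle>x - E x, d (x - E x)\<rangle> \<le> 0"
    using sign_projection by metis
  have q: "Re \<langle>v, d v\<rangle> = Re \<langle>v, a v\<rangle> - \<beta> * \<parallel>v\<parallel>\<^sup>2" for v
    by (simp add: d_def inner_simps inner_self)
  have Es: "self_adjoint E" and EE: "\<And>x. E (E x) = E x" using E by (auto simp: is_proj_iff)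
  note Eb = self_adjoint_bounded[OF Es]
  have Ec: "commute T E" if "bounded_op T" "commute T a" for T
    using that by (intro Ec) (auto simp: d_def commute_def bounded_op_simps)
  have "commute a a" by (simp add: commute_def)
  then have aG: "commute a G" and aE: "commute a E" using ab Ec bicommutesD[OF Suc.prems(2)] by blast+
  then have GE: "G (E x) = E (G x)" for x using Ec[OF Gb] by (auto simp: commute_def)
  define F0 where "F0 x = G (x - E x)" for x
  define G2 where "G2 x = G (E x)" for x
  have F0b: "bounded_op F0" unfolding F0_def
    by (rule bounded_op_comp[OF Gb bounded_op_minus_op[OF bounded_op_id(1) Eb]])
  have G2b: "bounded_op G2" unfolding G2_def by (rule bounded_op_comp[OF Gb Eb])
  have F0p: "is_proj F0" unfolding is_proj_iff self_adjoint_def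
    by (simp add: F0b) (simp add: F0_def bounded_op_simps[OF Gb] bounded_op_simps[OF Eb] GG EE GE inner_simps
        self_adjoint_inner[OF Gs] self_adjoint_inner[OF Es])
  have G2p: "is_proj G2" unfolding is_proj_iff self_adjoint_def
    by (simp add: G2b) (simp add: G2_def GG EE GE self_adjoint_inner[OF Gs] self_adjoint_inner[OF Es])
  have F0c: "commute T F0" and G2c: "commute T G2" if "bounded_op T" "commute T a" for T
    using Ec[OF that] bicommutesD[OF Suc.prems(2) that]
    by (auto simp: F0_def G2_def commute_def bounded_op_simps[OF that(1)])
  have F0G: "F0 x = G (F0 x)" "F0 x = G x - E (G x)" and G2G: "G2 x = G (G2 x)" "G2 x = E (G x)" for x
    by (simp_all add: F0_def G2_def GG GE bounded_op_diff[OF Gb])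
  have "\<parallel>a (F0 x) - complex_of_real \<alpha> *\<^sub>C F0 x\<parallel> \<le> w * \<parallel>F0 x\<parallel>" for x
  proof (rule narrow_bin_norm[OF F0p _ a w])
    show "commute F0 a" using F0c[OF ab] by (auto simp: commute_def)
    show "\<alpha> * \<parallel>F0 y\<parallel>\<^sup>2 \<le> Re \<langle>F0 y, a (F0 y)\<rangle>" for y
      using Suc.prems(3)[of "F0 y"] by (simp flip: F0G(1))
    show "Re \<langle>F0 y, a (F0 y)\<rangle> \<le> (\<alpha> + w) * \<parallel>F0 y\<parallel>\<^sup>2" for y
      using Eup[of "G y"] unfolding F0G(2)[symmetric] q by (simp add: \<beta>_def)
  qed
  note F0n = this
  have G2bi: "bicommutes a G2" using G2c by (rule bicommutesI)
  have lo: "\<beta> * \<parallel>G2 x\<parallel>\<^sup>2 \<le> Re \<langle>G2 x, a (G2 x)\<rangle>" for x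
    using Elo[of "G x"] unfolding G2G(2)[symmetric] q by simp
  have up: "Re \<langle>G2 x, a (G2 x)\<rangle> \<le> (\<beta> + (real m + 1) * w) * \<parallel>G2 x\<parallel>\<^sup>2" for x
    using Suc.prems(4)[of "G2 x"] unfolding G2G(1)[symmetric] by (simp add: \<beta>_def algebra_simps)
  obtain F c where Fall: "\<forall>j\<le>m. is_proj (F j) \<and> bicommutes a (F j)
       \<and> (\<forall>x. \<parallel>a (F j x) - complex_of_real (c j) *\<^sub>C F j x\<parallel> \<le> w * \<parallel>F j x\<parallel>)"
     "\<forall>i\<le>m. \<forall>j\<le>m. i \<noteq> j \<longrightarrow> (\<forall>x. F i (F j x) = 0)" "\<forall>x. (\<Sum>j\<le>m. F j x) = G2 x"
    using Suc.IH[OF G2p G2bi lo up] by (elim exE conjE) (rule that)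
  have F: "\<And>j. j \<le> m \<Longrightarrow> is_proj (F j)"
    and Fc: "\<And>j T. j \<le> m \<Longrightarrow> bounded_op T \<Longrightarrow> commute T a \<Longrightarrow> commute T (F j)"
    and Fn: "\<And>j x. j \<le> m \<Longrightarrow> \<parallel>a (F j x) - complex_of_real (c j) *\<^sub>C F j x\<parallel> \<le> w * \<parallel>F j x\<parallel>"
    and Fo: "\<And>i j x. i \<le> m \<Longrightarrow> j \<le> m \<Longrightarrow> i \<noteq> j \<Longrightarrow> F i (F j x) = 0"
    and Fsum: "\<And>x. (\<Sum>j\<le>m. F j x) = G2 x"
    using Fall by (auto simp: bicommutes_def)
  have Fb: "bounded_op (F j)" if "j \<le> m" for j using F[OF that] by (simp add: is_proj_def)
  \<comment> \<open>By orthogonality only one summand of \<open>G2\<close> survives on the range of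
    \<open>F j\<close>; hence \<open>F j\<close> lies below \<open>G2\<close> and is annihilated by
    \<open>F0\<close>.\<close>
  have G2F: "G2 (F j x) = F j x" if "j \<le> m" for j x
  proof -
    have "(\<Sum>i\<le>m. F i (F j x)) = (\<Sum>i\<le>m. if i = j then F j (F j x) else 0)"
      by (rule sum.cong) (auto simp: Fo that)
    also have "\<dots> = F j x" using F[OF that] that by (simp add: is_proj_iff)
    finally show ?thesis by (simp add: Fsum)
  qed
  have F0F: "F0 (F j x) = 0" if "j \<le> m" for j x
  proof -
    have "F0 (G2 y) = 0" for y
      by (simp add: F0_def G2_def bounded_op_simps[OF Gb] GE EE)
    then show ?thesis using G2F[OF that, of x] by metis
  qed
  \<comment> \<open>The reverse product vanishes because \<open>F j\<close> commutes with
    \<open>a\<close> and therefore with \<open>F0\<close>.\<close>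
  have FF0: "F j (F0 x) = 0" if "j \<le> m" for j x
  proof -
    have "commute a (F j)" using Fc[OF that ab] \<open>commute a a\<close> by blast
    then have "commute (F j) a" by (auto simp: commute_def)
    then show ?thesis using F0c[OF Fb[OF that]] F0F[OF that] by (simp add: commute_def)
  qed
  define F' where "F' = case_nat F0 F"
  define c' where "c' = case_nat \<alpha> c"
  have "(\<Sum>j\<le>Suc m. F' j x) = G x" for x
  proof -
    have "(\<Sum>j\<le>Suc m. F' j x) = F0 x + G2 x"
      unfolding sum.atMost_Suc_shift by (simp add: F'_def Fsum)
    then show ?thesis by (simp add: F0G(2) G2G(2))
  qed
  moreover have "is_proj (F' j) \<and> bicommutes a (F' j)
       \<and> (\<forall>x. \<parallel>a (F' j x) - complex_of_real (c' j) *\<^sub>C F' j x\<parallel> \<le> w * \<parallel>F' j x\<parallel>)" if "j \<le> Suc m" for j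
    using that F0p bicommutesI[OF F0c] F0n Fall(1) by (cases j) (auto simp: F'_def c'_def)
  moreover have "F' i (F' j x) = 0" if "i \<le> Suc m" "j \<le> Suc m" "i \<noteq> j" for i j x
    using that by (cases i; cases j) (auto simp: F'_def F0F FF0 Fo)
  ultimately show ?case by blast
qed

text \<open>The form of \<open>a\<close> lies between \<open>-K\<close> and \<open>K\<close>;
  dividing this interval of length \<open>2 * K\<close> into \<open>m + 1\<close> bands gives the
  width.\<close>

lemma spectral_bins:
  fixes a :: "'h::sep_inf_chilbert \<Rightarrow> 'h"
  assumes a: "self_adjoint a" and K: "\<And>x. \<parallel>a x\<parallel> \<le> K * \<parallel>x\<parallel>" "0 \<le> K"
  obtains F c where "\<And>j. j \<le> m \<Longrightarrow> is_proj (F j)"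
    "\<And>j. j \<le> m \<Longrightarrow> bicommutes a (F j)"
    "\<And>j x. j \<le> m \<Longrightarrow> \<parallel>a (F j x) - complex_of_real (c j) *\<^sub>C F j x\<parallel> \<le> 2 * K / (real m + 1) * \<parallel>F j x\<parallel>"
    "\<And>i j x. i \<le> m \<Longrightarrow> j \<le> m \<Longrightarrow> i \<noteq> j \<Longrightarrow> F i (F j x) = 0"
    "\<And>x. (\<Sum>j\<le>m. F j x) = x"
proof -
  let ?w = "2 * K / (real m + 1)"
  have "\<bar>Re \<langle>x, a x\<rangle>\<bar> \<le> K * \<parallel>x\<parallel>\<^sup>2" for x
  proof -
    have "\<bar>Re \<langle>x, a x\<rangle>\<bar> \<le> \<parallel>x\<parallel> * \<parallel>a x\<parallel>"
      using cauchy_schwarz[of x "a x"] abs_Re_le_cmod order_trans by blast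
    also have "\<dots> \<le> \<parallel>x\<parallel> * (K * \<parallel>x\<parallel>)" by (rule mult_left_mono[OF K(1)]) simp
    finally show ?thesis by (simp add: power2_eq_square mult_ac)
  qed
  then have lo: "- K * \<parallel>x\<parallel>\<^sup>2 \<le> Re \<langle>x, a x\<rangle>" and up: "Re \<langle>x, a x\<rangle> \<le> (- K + (real m + 1) * ?w) * \<parallel>x\<parallel>\<^sup>2" for x
    by (auto simp: abs_le_iff minus_le_iff add_eq_0_iff)
  have id: "is_proj (\<lambda>x. x)" "bicommutes a (\<lambda>x. x)" "0 \<le> ?w"
    using K(2) by (simp_all add: is_proj_iff self_adjoint_id bicommutes_def commute_def)
  obtain F c where "\<forall>j\<le>m. is_proj (F j) \<and> bicommutes a (F j)
       \<and> (\<forall>x. \<parallel>a (F j x) - complex_of_real (c j) *\<^sub>C F j x\<parallel> \<le> ?w * \<parallel>F j x\<parallel>)"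
     "\<forall>i\<le>m. \<forall>j\<le>m. i \<noteq> j \<longrightarrow> (\<forall>x. F i (F j x) = 0)" "\<forall>x. (\<Sum>j\<le>m. F j x) = x"
    using spectral_bins_aux[OF a id(3,1,2) lo up] by (elim exE conjE) (rule that)
  then show thesis by (intro that[of F c]) auto
qed

subsection \<open>Finite-rank operators\<close>

text \<open>The rank-one operator of Dirac's notation |u><v|, with the inner product linear in its
  second argument.\<close>

definition rk :: "'h::sep_inf_chilbert \<Rightarrow> 'h \<Rightarrow> 'h \<Rightarrow> 'h" where
  "rk u v = (\<lambda>x. \<langle>v, x\<rangle> *\<^sub>C u)"

text \<open>The orthogonal projection onto the span when \<open>J\<close> is finite and
  \<open>f\<close> is orthonormal on it. Sets of vectors are treated as families through the
  identity function.\<close>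

definition fproj :: "('i \<Rightarrow> 'h::sep_inf_chilbert) \<Rightarrow> 'i set \<Rightarrow> 'h \<Rightarrow> 'h" where
  "fproj f J = (\<lambda>x. \<Sum>j\<in>J. rk (f j) (f j) x)"

definition orthonormal :: "('i \<Rightarrow> 'h::sep_inf_chilbert) \<Rightarrow> 'i set \<Rightarrow> bool" where
  "orthonormal f J \<longleftrightarrow> (\<forall>i\<in>J. \<forall>j\<in>J. \<langle>f i, f j\<rangle> = (if i = j then 1 else 0))"

lemma orthonormalD: "orthonormal f J \<Longrightarrow> i \<in> J \<Longrightarrow> j \<in> J \<Longrightarrow> \<langle>f i, f j\<rangle> = (if i = j then 1 else 0)"
  by (simp add: orthonormal_def)

lemma orthonormal_subset: "orthonormal f J \<Longrightarrow> K \<subseteq> J \<Longrightarrow> orthonormal f K"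
  unfolding orthonormal_def by blast

lemma unit_hnorm: "\<langle>u, u\<rangle> = 1 \<longleftrightarrow> \<parallel>u\<parallel> = 1"
  by (metis inner_self of_real_eq_1_iff power2_eq_1_iff hnorm_nonneg abs_of_nonneg abs_1 abs_neg_one)

lemma normalize_inner: "x \<noteq> 0 \<Longrightarrow> \<langle>complex_of_real (1 / \<parallel>x\<parallel>) *\<^sub>C x, complex_of_real (1 / \<parallel>x\<parallel>) *\<^sub>C x\<rangle> = 1"
  unfolding unit_hnorm by (simp add: hnorm_scale norm_divide)

lemma bounded_op_rk: "bounded_op (rk u v)"
proof (rule bounded_opI[where K = "\<parallel>u\<parallel> * \<parallel>v\<parallel>"])
  show "\<parallel>rk u v x\<parallel> \<le> \<parallel>u\<parallel> * \<parallel>v\<parallel> * \<parallel>x\<parallel>" for x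
    using mult_right_mono[OF cauchy_schwarz[of v x], of "\<parallel>u\<parallel>"] by (simp add: rk_def hnorm_scale mult_ac)
qed (simp_all add: rk_def inner_simps scale_simps)

lemma rk_inner: "\<langle>rk u v x, y\<rangle> = \<langle>x, rk v u y\<rangle>"
  using hs_inner_conj_sym[of x v] by (simp add: rk_def inner_simps)

lemma self_adjoint_rk: "self_adjoint (rk u u)"
  by (simp add: self_adjoint_def bounded_op_rk rk_inner)

lemma self_adjoint_rk_sym: "self_adjoint (\<lambda>x. rk u v x + rk v u x)"
  by (auto simp: self_adjoint_def rk_inner inner_simps intro: bounded_op_plus bounded_op_rk)

lemma self_adjoint_fproj: "self_adjoint (fproj f J)"
  unfolding fproj_def by (rule self_adjoint_sum) (rule self_adjoint_rk)

lemmas bounded_op_fproj = self_adjoint_bounded[OF self_adjoint_fproj]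

lemma fproj_basis:
  assumes "finite J" "orthonormal f J" "j \<in> J" shows "fproj f J (f j) = f j"
proof -
  have "fproj f J (f j) = (\<Sum>i\<in>J. if i = j then f j else 0)"
    unfolding fproj_def rk_def by (rule sum.cong) (use assms in \<open>auto simp: orthonormalD\<close>)
  then show ?thesis using assms by simp
qed

text \<open>A linear operator fixing each \<open>f j\<close> fixes their span. With
  \<open>g = f\<close> this is idempotence; with different families it compares nested
  spans.\<close>

lemma fproj_fproj:
  assumes "finite J" "orthonormal f J" "finite K" "orthonormal g K" "\<And>j. j \<in> J \<Longrightarrow> fproj g K (f j) = f j"
  shows "fproj g K (fproj f J x) = fproj f J x"
proof -
  have "fproj g K (fproj f J x) = (\<Sum>j\<in>J. \<langle>f j, x\<rangle> *\<^sub>C fproj g K (f j))"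
    unfolding fproj_def[of f J] rk_def by (simp add: bounded_op_simps[OF bounded_op_fproj])
  also have "\<dots> = fproj f J x" unfolding fproj_def rk_def by (rule sum.cong) (use assms(5) in \<open>auto simp: fproj_def rk_def\<close>)
  finally show ?thesis .
qed

lemma is_proj_fproj: "finite J \<Longrightarrow> orthonormal f J \<Longrightarrow> is_proj (fproj f J)"
  by (simp add: is_proj_iff self_adjoint_fproj fproj_fproj fproj_basis)

lemma inner_fproj: "finite J \<Longrightarrow> orthonormal f J \<Longrightarrow> j \<in> J \<Longrightarrow> \<langle>f j, fproj f J x\<rangle> = \<langle>f j, x\<rangle>"
  by (metis self_adjoint_inner[OF self_adjoint_fproj] fproj_basis)

text \<open>Gram-Schmidt, adding the normalized residue of one vector at a time and leaving the
  given \<open>B\<close> untouched.\<close>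

lemma orthonormal_extend:
  fixes W :: "'h::sep_inf_chilbert set"
  assumes "finite W" "finite B" "orthonormal (\<lambda>b. b) B"
  shows "\<exists>C. finite C \<and> B \<subseteq> C \<and> orthonormal (\<lambda>b. b) C \<and> (\<forall>w\<in>W. fproj (\<lambda>b. b) C w = w)"
  using assms(1)
proof induction
  case empty
  then show ?case using assms by blast
next
  case (insert w W)
  then obtain C where C: "finite C" "B \<subseteq> C" "orthonormal (\<lambda>b. b) C" "\<And>w. w \<in> W \<Longrightarrow> fproj (\<lambda>b. b) C w = w"
    by blast
  define r where "r = w - fproj (\<lambda>b. b) C w"
  show ?case
  proof (cases "r = 0")
    case True
    then show ?thesis using C by (auto simp: r_def)
  next
    case False
    define e where "e = complex_of_real (1 / \<parallel>r\<parallel>) *\<^sub>C r"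
    have ee: "\<langle>e, e\<rangle> = 1" unfolding e_def by (rule normalize_inner[OF False])
    have be: "\<langle>b, e\<rangle> = 0" if "b \<in> C" for b
      using inner_fproj[OF C(1,3) that, of w] by (simp add: e_def r_def inner_simps)
    then have eb: "\<langle>e, b\<rangle> = 0" if "b \<in> C" for b using that by (simp add: inner_commute_zero)
    have "e \<notin> C" using be ee by force
    have on: "orthonormal (\<lambda>b. b) (insert e C)"
      using C(3) ee be eb \<open>e \<notin> C\<close> by (auto simp: orthonormal_def)
    have fin: "finite (insert e C)" using C by simp
    have fixC: "fproj (\<lambda>b. b) (insert e C) (fproj (\<lambda>b. b) C x) = fproj (\<lambda>b. b) C x" for x
      by (rule fproj_fproj[OF C(1,3) fin on]) (rule fproj_basis[OF fin on], simp)
    have "fproj (\<lambda>b. b) (insert e C) r = r"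
    proof -
      have "r = complex_of_real \<parallel>r\<parallel> *\<^sub>C e" using False by (simp add: e_def hs_scale_scale)
      then show ?thesis
        using fproj_basis[OF fin on, of e] by (metis bounded_op_scale[OF bounded_op_fproj] insertI1)
    qed
    moreover have "w = fproj (\<lambda>b. b) C w + r" by (simp add: r_def)
    ultimately have "fproj (\<lambda>b. b) (insert e C) w = w"
      by (metis fixC bounded_op_add[OF bounded_op_fproj])
    moreover have "fproj (\<lambda>b. b) (insert e C) v = v" if "v \<in> W" for v
      using fixC[of v] C(4)[OF that] by simp
    ultimately show ?thesis using fin on C(2) by (intro exI[of _ "insert e C"]) auto
  qed
qed

text \<open>The witness is a finite projection that fixes the range, which is directly the upper
  bound for the range projection needed in \<open>fin_rank_FF\<close>.\<close>

definition fin_rank :: "('h::sep_inf_chilbert \<Rightarrow> 'h) \<Rightarrow> bool" where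
  "fin_rank T \<longleftrightarrow> bounded_op T \<and>
     (\<exists>B. finite B \<and> orthonormal (\<lambda>b. b) B \<and> (\<forall>x. fproj (\<lambda>b. b) B (T x) = T x))"

lemma fin_rank_bounded: "fin_rank T \<Longrightarrow> bounded_op T"
  by (simp add: fin_rank_def)

lemma fin_rank_plus:
  assumes "fin_rank S" "fin_rank T" shows "fin_rank (\<lambda>x. S x + T x)"
proof -
  obtain B C where B: "finite B" "orthonormal (\<lambda>b. b) B" "\<And>x. fproj (\<lambda>b. b) B (S x) = S x"
    and C: "finite C" "orthonormal (\<lambda>b. b) C" "\<And>x. fproj (\<lambda>b. b) C (T x) = T x"
    using assms unfolding fin_rank_def by metis
  obtain D where D: "finite D" "B \<subseteq> D" "orthonormal (\<lambda>b. b) D" "\<And>w. w \<in> C \<Longrightarrow> fproj (\<lambda>b. b) D w = w"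
    using orthonormal_extend[OF C(1) B(1,2)] by blast
  have "fproj (\<lambda>b. b) D (S x) = S x" for x
    using fproj_fproj[OF B(1,2) D(1,3), of "S x"] fproj_basis[OF D(1,3)] D(2) B(3) by auto
  moreover have "fproj (\<lambda>b. b) D (T x) = T x" for x
    using fproj_fproj[OF C(1,2) D(1,3), of "T x"] D(4) C(3) by auto
  ultimately show ?thesis unfolding fin_rank_def
    using D assms by (auto simp: bounded_op_add[OF bounded_op_fproj] fin_rank_bounded intro!: bounded_op_plus)
qed

lemma fin_rank_0: "fin_rank (\<lambda>x. 0)"
  unfolding fin_rank_def by (auto simp: orthonormal_def fproj_def intro!: exI[of _ "{}"])

lemma fin_rank_cmult: "fin_rank T \<Longrightarrow> fin_rank (\<lambda>x. c *\<^sub>C T x)"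
  unfolding fin_rank_def by (metis bounded_op_cmult bounded_op_scale bounded_op_fproj)

lemma fin_rank_uminus: "fin_rank T \<Longrightarrow> fin_rank (\<lambda>x. - T x)"
  using fin_rank_cmult[of T "-1"] by simp

lemma fin_rank_sum: "(\<And>i. i \<in> A \<Longrightarrow> fin_rank (T i)) \<Longrightarrow> fin_rank (\<lambda>x. \<Sum>i\<in>A. T i x)"
  by (induction A rule: infinite_finite_induct) (auto intro: fin_rank_plus fin_rank_0)

lemma fin_rank_rk: "fin_rank (rk u v)"
proof -
  have "orthonormal (\<lambda>b. b) ({}::'a set)" by (simp add: orthonormal_def)
  then obtain C where "finite C" "orthonormal (\<lambda>b. b) C" "fproj (\<lambda>b. b) C u = u"
    using orthonormal_extend[of "{u}" "{}"] by auto
  then show ?thesis unfolding fin_rank_def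
    by (intro conjI bounded_op_rk exI[of _ C]) (auto simp: rk_def bounded_op_scale[OF bounded_op_fproj])
qed

lemma fin_rank_fproj: "fin_rank (fproj f J)"
  unfolding fproj_def by (rule fin_rank_sum) (rule fin_rank_rk)

subsection \<open>Range projections and the trace\<close>

text \<open>Shows that the definite description in \<open>range_proj\<close> denotes: the projection
  onto the double annihilator of the range fixes the range and lies below every projection that
  does.\<close>

lemma range_proj_minimal:
  assumes T: "bounded_op T"
  shows "is_proj (range_proj T)" "\<And>x. range_proj T (T x) = T x"
    "\<And>q x. is_proj q \<Longrightarrow> (\<And>x. q (T x) = T x) \<Longrightarrow> q (range_proj T x) = range_proj T x"
proof -
  define S where "S = {u. \<forall>w. \<langle>u, T w\<rangle> = 0}"
  define N where "N = {v. \<forall>u\<in>S. \<langle>u, v\<rangle> = 0}"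
  have "closed_subspace N" unfolding N_def by (rule closed_subspace_annihilator)
  then obtain p where p: "is_proj p" "\<And>x. p x \<in> N" "\<And>x. x \<in> N \<Longrightarrow> p x = x"
    using projection_exists by metis
  have pT: "p (T x) = T x" for x by (rule p(3)) (simp add: N_def S_def)
  have min: "q (p x) = p x" if q: "is_proj q" "\<And>x. q (T x) = T x" for q x
  proof -
    have qs: "self_adjoint q" using q by (simp add: is_proj_iff)
    have "\<langle>u, p x - q (p x)\<rangle> = 0" for u
    proof -
      have "u - q u \<in> S" by (simp add: S_def inner_simps self_adjoint_inner[OF qs] q(2))
      then have "\<langle>u - q u, p x\<rangle> = 0" using p(2)[of x] by (simp add: N_def)
      then show ?thesis by (simp add: inner_simps self_adjoint_inner[OF qs])
    qed
    then have "p x - q (p x) = 0" using hs_inner_definite by blast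
    then show ?thesis by simp
  qed
  have "range_proj T = p" unfolding range_proj_def
  proof (rule the_equality)
    show "is_proj p \<and> p \<circ> T = T \<and> (\<forall>q. is_proj q \<and> q \<circ> T = T \<longrightarrow> q \<circ> p = p)"
      using p(1) pT min by (auto simp: fun_eq_iff)
    fix r assume r: "is_proj r \<and> r \<circ> T = T \<and> (\<forall>q. is_proj q \<and> q \<circ> T = T \<longrightarrow> q \<circ> r = r)"
    \<comment> \<open>Two minimal projections dominate each other, and taking adjoints in these two
      identities makes them equal.\<close>
    then have rp: "r (p x) = p x" and pr: "p (r x) = r x" for x
      using min p(1) pT by (auto simp: fun_eq_iff)
    show "r = p"
    proof (intro ext inner_eqI)
      fix x u
      have ps: "self_adjoint p" and rs: "self_adjoint r" using p(1) r by (auto simp: is_proj_iff)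
      have "\<langle>u, r x\<rangle> = \<langle>u, p (r x)\<rangle>" by (simp only: pr)
      also have "\<dots> = \<langle>r (p u), x\<rangle>" by (simp only: self_adjoint_inner[OF ps] self_adjoint_inner[OF rs])
      also have "\<dots> = \<langle>u, p x\<rangle>" by (simp add: rp self_adjoint_inner[OF ps])
      finally show "\<langle>u, r x\<rangle> = \<langle>u, p x\<rangle>" .
    qed
  qed
  with p(1) pT min show "is_proj (range_proj T)" "\<And>x. range_proj T (T x) = T x"
    "\<And>q x. is_proj q \<Longrightarrow> (\<And>x. q (T x) = T x) \<Longrightarrow> q (range_proj T x) = range_proj T x" by auto
qed

lemma positive_op_rk: "positive_op (rk u u)"
proof (rule self_adjoint_positive[OF self_adjoint_rk])
  fix x
  have "\<langle>x, rk u u x\<rangle> = \<langle>u, x\<rangle> * cnj \<langle>u, x\<rangle>"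
    using hs_inner_conj_sym[of x u] by (simp add: rk_def inner_simps)
  then have "\<langle>x, rk u u x\<rangle> = complex_of_real ((cmod \<langle>u, x\<rangle>)\<^sup>2)"
    by (metis complex_norm_square)
  then show "0 \<le> Re \<langle>x, rk u u x\<rangle>" by simp
qed

lemma positive_op_plus:
  "positive_op S \<Longrightarrow> positive_op T \<Longrightarrow> positive_op (\<lambda>x. S x + T x)"
  by (auto simp: positive_op_def inner_simps intro: bounded_op_plus)

lemma positive_op_0: "positive_op (\<lambda>x. 0)"
  by (simp add: positive_op_def)

lemma positive_op_sum:
  "(\<And>i. i \<in> A \<Longrightarrow> positive_op (T i)) \<Longrightarrow> positive_op (\<lambda>x. \<Sum>i\<in>A. T i x)"
  by (induction A rule: infinite_finite_induct) (auto intro: positive_op_plus positive_op_0)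

lemma positive_op_fproj: "positive_op (fproj f J)"
  unfolding fproj_def by (rule positive_op_sum) (rule positive_op_rk)

lemma is_proj_positive: "is_proj p \<Longrightarrow> positive_op p"
  by (rule self_adjoint_positive) (auto simp: is_proj_iff, metis hs_inner_pos self_adjoint_inner)

section \<open>Values of the trace on finite-rank operators\<close>

context
  fixes \<tau> :: "('h::sep_inf_chilbert \<Rightarrow> 'h) \<Rightarrow> ennreal"
  assumes \<tau>: "fns_trace \<tau>"
begin

lemma trace_plus: "positive_op a \<Longrightarrow> positive_op b \<Longrightarrow> \<tau> (\<lambda>x. a x + b x) = \<tau> a + \<tau> b"
  using \<tau>[unfolded fns_trace_def op_add_def, THEN conjunct1] by blast

lemma trace_scale: "positive_op a \<Longrightarrow> 0 \<le> c \<Longrightarrow> \<tau> (\<lambda>x. complex_of_real c *\<^sub>C a x) = ennreal c * \<tau> a"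
  using \<tau>[unfolded fns_trace_def op_scale_def, THEN conjunct2, THEN conjunct1] by blast

lemma trace_comm: "bounded_op x \<Longrightarrow> \<tau> (\<lambda>v. adj x (x v)) = \<tau> (\<lambda>v. x (adj x v))"
  using \<tau>[unfolded fns_trace_def comp_def, THEN conjunct2, THEN conjunct2, THEN conjunct1] by blast

lemma trace_faithful: "positive_op a \<Longrightarrow> \<tau> a = 0 \<Longrightarrow> a = (\<lambda>v. 0)"
  using \<tau>[unfolded fns_trace_def, THEN conjunct2, THEN conjunct2, THEN conjunct2, THEN conjunct1] by blast

lemma trace_semifinite:
  "positive_op a \<Longrightarrow> a \<noteq> (\<lambda>v. 0) \<Longrightarrow> \<exists>b. positive_op b \<and> b \<noteq> (\<lambda>v. 0) \<and> op_le b a \<and> \<tau> b < \<infinity>"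
  using \<tau>[unfolded fns_trace_def, THEN conjunct2, THEN conjunct2, THEN conjunct2, THEN conjunct2, THEN conjunct2] by blast

lemma trace_0: "\<tau> (\<lambda>x. 0) = 0"
  using trace_scale[OF positive_op_0, of 0] by simp

text \<open>The tracial property for the partial isometry \<open>rk u v\<close>, whose two products
  with its adjoint are the two projections.\<close>

lemma trace_rk_unit_eq:
  assumes "\<parallel>u\<parallel> = 1" "\<parallel>v\<parallel> = 1" shows "\<tau> (rk u u) = \<tau> (rk v v)"
proof -
  have "adj (rk u v) = rk v u" by (rule adj_unique) (rule rk_inner)
  moreover have "(\<lambda>x. rk v u (rk u v x)) = rk v v" "(\<lambda>x. rk u v (rk v u x)) = rk u u"
    using assms by (auto simp: rk_def inner_simps unit_hnorm[symmetric])
  ultimately show ?thesis using trace_comm[OF bounded_op_rk, of u v] by simp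
qed

lemma trace_rk_unit_nonzero:
  assumes "\<parallel>u\<parallel> = 1" shows "\<tau> (rk u u) \<noteq> 0"
proof
  assume "\<tau> (rk u u) = 0"
  then have "rk u u u = 0" using trace_faithful[OF positive_op_rk] by metis
  then show False using assms by (simp add: rk_def inner_self)
qed

text \<open>A nonzero positive operator below a rank-one projection is a multiple of it.\<close>

lemma trace_rk_unit_finite:
  assumes u: "\<parallel>u\<parallel> = 1" shows "\<tau> (rk u u) < \<infinity>"
proof -
  have uu: "\<langle>u, u\<rangle> = 1" using u by (simp add: unit_hnorm)
  have "rk u u \<noteq> (\<lambda>v. 0)" using u by (auto simp: rk_def fun_eq_iff inner_self intro!: exI[of _ u])
  then obtain b where b: "positive_op b" "b \<noteq> (\<lambda>v. 0)" "op_le b (rk u u)" "\<tau> b < \<infinity>"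
    using trace_semifinite[OF positive_op_rk] by blast
  have bs: "self_adjoint b" by (rule positive_op_self_adjoint[OF b(1)])
  have bb: "bounded_op b" by (rule self_adjoint_bounded[OF bs])
  \<comment> \<open>On the complement of \<open>u\<close> the form of \<open>b\<close> is squeezed
    between 0 and 0.\<close>
  have perp: "b v = 0" if "\<langle>u, v\<rangle> = 0" for v
  proof (rule positive_op_null[OF b(1)])
    have "0 \<le> Re \<langle>v, rk u u v - b v\<rangle>"
      using positive_op_Re b(3) unfolding op_le_def op_diff_def by blast
    then show "Re \<langle>v, b v\<rangle> = 0"
      using that positive_op_Re[OF b(1), of v] by (simp add: rk_def inner_simps)
  qed
  define c where "c = Re \<langle>u, b u\<rangle>"
  have buu: "\<langle>u, b u\<rangle> = complex_of_real c"
    by (simp add: c_def complex_eq_iff self_adjoint_Im[OF bs])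
  have bu: "b u = complex_of_real c *\<^sub>C u"
  proof -
    \<comment> \<open>The component of \<open>b u\<close> orthogonal to \<open>u\<close> is killed
      by \<open>b\<close>, so it is orthogonal to \<open>b u\<close> as well and must
      vanish.\<close>
    define r where "r = b u - complex_of_real c *\<^sub>C u"
    have "\<langle>u, r\<rangle> = 0" by (simp add: r_def inner_simps buu uu)
    then have "b r = 0" "\<langle>r, u\<rangle> = 0" using perp by (auto simp: inner_commute_zero)
    moreover have "\<langle>r, r\<rangle> = \<langle>r, b u\<rangle> - complex_of_real c * \<langle>r, u\<rangle>"
      by (subst (2) r_def) (simp only: inner_diff_right hs_inner_scale_right)
    moreover have "\<langle>r, b u\<rangle> = \<langle>b r, u\<rangle>" by (rule self_adjoint_inner[OF bs, symmetric])
    ultimately have "\<langle>r, r\<rangle> = 0" by simp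
    then show ?thesis using hs_inner_definite[of r] by (simp add: r_def)
  qed
  have b_eq: "b x = complex_of_real c *\<^sub>C rk u u x" for x
  proof -
    have "b (x - \<langle>u, x\<rangle> *\<^sub>C u) = 0" by (rule perp) (simp add: inner_simps uu)
    then show ?thesis by (simp add: bounded_op_simps[OF bb] bu rk_def scale_simps mult.commute)
  qed
  have c0: "c \<ge> 0" unfolding c_def by (rule positive_op_Re[OF b(1)])
  have "c \<noteq> 0" using b(2) by (auto simp: b_eq fun_eq_iff)
  then have "c > 0" using c0 by simp
  have "b = (\<lambda>x. complex_of_real c *\<^sub>C rk u u x)" by (rule ext) (rule b_eq)
  then have "\<tau> b = ennreal c * \<tau> (rk u u)" using trace_scale[OF positive_op_rk c0] by simp
  then show ?thesis using b(4) \<open>c > 0\<close> by (auto simp: ennreal_mult_less_top less_top[symmetric])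
qed

text \<open>All rank-one projections have the same trace, so the trace is rank times a constant;
  this translates the limit condition into a statement about ranks.\<close>

lemma trace_fproj:
  assumes "finite J" "orthonormal f J" "\<parallel>u\<parallel> = 1"
  shows "\<tau> (fproj f J) = of_nat (card J) * \<tau> (rk u u)"
  using assms(1,2)
proof (induction J)
  case (insert j J)
  have "fproj f (insert j J) = (\<lambda>x. rk (f j) (f j) x + fproj f J x)"
    using insert.hyps by (simp add: fproj_def)
  then have "\<tau> (fproj f (insert j J)) = \<tau> (rk (f j) (f j)) + \<tau> (fproj f J)"
    by (simp add: trace_plus positive_op_rk positive_op_fproj)
  moreover have "\<parallel>f j\<parallel> = 1" using insert.prems by (simp add: orthonormal_def unit_hnorm[symmetric])
  ultimately show ?case using insert orthonormal_subset[OF insert.prems, of J] trace_rk_unit_eq[OF _ assms(3), of "f j"]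
    by (auto simp: distrib_right)
qed (simp add: fproj_def trace_0)

lemma trace_fproj_finite:
  assumes "finite J" "orthonormal f J" shows "\<tau> (fproj f J) < \<infinity>"
proof (cases "J = {}")
  case True
  then show ?thesis by (simp add: fproj_def trace_0)
next
  case False
  then obtain j where j: "j \<in> J" by blast
  then have "\<parallel>f j\<parallel> = 1" using assms by (simp add: orthonormal_def unit_hnorm[symmetric])
  then show ?thesis using trace_fproj[OF assms, of "f j"] trace_rk_unit_finite[of "f j"]
    by (simp add: ennreal_mult_less_top of_nat_less_top)
qed

text \<open>The range projection lies below a finite projection of finite trace, and the difference
  of the two is positive, so additivity bounds its trace.\<close>

lemma fin_rank_FF:
  assumes "fin_rank T" shows "T \<in> FF \<tau>"
proof -
  obtain B where B: "finite B" "orthonormal (\<lambda>b. b) B" "\<And>x. fproj (\<lambda>b. b) B (T x) = T x" and T: "bounded_op T"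
    using assms unfolding fin_rank_def by metis
  let ?e = "fproj (\<lambda>b. b) B" and ?p = "range_proj T"
  have e: "is_proj ?e" by (rule is_proj_fproj[OF B(1,2)])
  note p = range_proj_minimal[OF T]
  have ps: "self_adjoint ?p" and pp: "\<And>x. ?p (?p x) = ?p x" using p(1) by (auto simp: is_proj_iff)
  have es: "self_adjoint ?e" and eee: "\<And>x. ?e (?e x) = ?e x" using e by (auto simp: is_proj_iff)
  have ep: "?e (?p x) = ?p x" for x by (rule p(3)[OF e B(3)])
  have pe: "?p (?e x) = ?p x" for x
    by (rule inner_eqI) (simp add: self_adjoint_inner[OF ps, symmetric] self_adjoint_inner[OF es, symmetric] ep)
  have pos: "positive_op (\<lambda>x. ?e x - ?p x)"
  proof (rule self_adjoint_positive[OF self_adjoint_diff[OF es ps]])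
    fix x
    have "\<langle>x, ?e x\<rangle> = \<langle>?e x, ?e x\<rangle>" "\<langle>x, ?p x\<rangle> = \<langle>?p x, ?p x\<rangle>"
      by (simp_all add: self_adjoint_inner[OF es] self_adjoint_inner[OF ps] eee pp)
    moreover have "\<parallel>?p x\<parallel> \<le> \<parallel>?e x\<parallel>" using is_proj_contraction[OF p(1), of "?e x"] by (simp add: pe)
    ultimately show "0 \<le> Re \<langle>x, ?e x - ?p x\<rangle>"
      by (simp add: inner_diff_right hnorm_sq[symmetric] power_mono)
  qed
  have "?e = (\<lambda>x. ?p x + (?e x - ?p x))" by simp
  then have "\<tau> ?e = \<tau> ?p + \<tau> (\<lambda>x. ?e x - ?p x)"
    using trace_plus[OF is_proj_positive[OF p(1)] pos] by metis
  then have "\<tau> ?p < \<infinity>" using trace_fproj_finite[OF B(1,2)] by (auto simp: less_top[symmetric])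
  then show ?thesis using T by (simp add: FF_def BH_def)
qed

lemma fproj_PF: "finite J \<Longrightarrow> orthonormal f J \<Longrightarrow> fproj f J \<in> PF \<tau>"
  by (simp add: PF_def fin_rank_FF fin_rank_fproj is_proj_fproj)

end

subsection \<open>Estimates for the ideal norm\<close>

text \<open>One vector more than \<open>card B\<close> is taken from an orthonormal family; not all
  of these fit into the span of \<open>B\<close>, and the normalized residue of one that does not is
  the required vector.\<close>

lemma orthogonal_unit_exists:
  fixes B :: "'h::sep_inf_chilbert set"
  assumes B: "finite B" "orthonormal (\<lambda>b. b) B"
  obtains e where "\<parallel>e\<parallel> = 1" "\<And>b. b \<in> B \<Longrightarrow> \<langle>b, e\<rangle> = 0"
proof -
  obtain f :: "nat \<Rightarrow> 'h" where f: "orthonormal f {..<Suc (card B)}"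
    using hs_infinite_dim[of "Suc (card B)"] unfolding orthonormal_def by (metis lessThan_iff)
  have "\<exists>i\<in>{..<Suc (card B)}. fproj (\<lambda>b. b) B (f i) \<noteq> f i"
  proof (rule ccontr)
    assume "\<not> ?thesis"
    then have fi: "fproj (\<lambda>b. b) B (f i) = f i" if "i < Suc (card B)" for i using that by blast
    \<comment> \<open>The squared moduli of the coefficients between the two families are counted in
      both orders: row by row they give \<open>card B + 1\<close>, column by column at most
      \<open>card B\<close>.\<close>
    have "complex_of_real (Suc (card B)) = (\<Sum>i<Suc (card B). \<langle>f i, f i\<rangle>)"
      using f by (simp add: orthonormal_def del: sum.lessThan_Suc of_nat_Suc)
    also have "\<dots> = (\<Sum>i<Suc (card B). \<Sum>b\<in>B. \<langle>b, f i\<rangle> * \<langle>f i, b\<rangle>)"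
    proof (rule sum.cong[OF refl])
      fix i assume "i \<in> {..<Suc (card B)}"
      then have "\<langle>f i, f i\<rangle> = \<langle>f i, fproj (\<lambda>b. b) B (f i)\<rangle>" using fi by simp
      then show "\<langle>f i, f i\<rangle> = (\<Sum>b\<in>B. \<langle>b, f i\<rangle> * \<langle>f i, b\<rangle>)"
        by (simp add: fproj_def rk_def inner_simps)
    qed
    also have "\<dots> = (\<Sum>b\<in>B. \<langle>b, fproj f {..<Suc (card B)} b\<rangle>)"
      by (subst sum.swap) (simp add: fproj_def rk_def inner_simps mult.commute del: sum.lessThan_Suc)
    finally have "real (Suc (card B)) = Re (\<Sum>b\<in>B. \<langle>b, fproj f {..<Suc (card B)} b\<rangle>)"
      by (metis Re_complex_of_real)
    also have "\<dots> \<le> (\<Sum>b\<in>B. 1)"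
      unfolding Re_sum
    proof (rule sum_mono)
      fix b assume "b \<in> B"
      then have "\<parallel>b\<parallel> = 1" using B by (simp add: orthonormal_def unit_hnorm[symmetric])
      then have "cmod \<langle>b, fproj f {..<Suc (card B)} b\<rangle> \<le> 1"
        using cauchy_schwarz[of b "fproj f {..<Suc (card B)} b"] is_proj_contraction[OF is_proj_fproj[OF _ f], of b]
        by simp
      then show "Re \<langle>b, fproj f {..<Suc (card B)} b\<rangle> \<le> 1" using complex_Re_le_cmod order_trans by blast
    qed
    finally show False by simp
  qed
  then obtain i where i: "f i - fproj (\<lambda>b. b) B (f i) \<noteq> 0" by (metis eq_iff_diff_eq_0)
  let ?r = "f i - fproj (\<lambda>b. b) B (f i)"
  show thesis
  proof (rule that)
    show "\<parallel>complex_of_real (1 / \<parallel>?r\<parallel>) *\<^sub>C ?r\<parallel> = 1"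
      using normalize_inner[OF i] unfolding unit_hnorm .
    show "\<langle>b, complex_of_real (1 / \<parallel>?r\<parallel>) *\<^sub>C ?r\<rangle> = 0" if "b \<in> B" for b
      using inner_fproj[OF B that, of "f i"] by (simp add: inner_simps)
  qed
qed

text \<open>An interval of positive length is infinite, so each value can avoid finitely many
  others. \<open>\<Lambda>\<close> will hold the eigenvalues of earlier steps.\<close>

lemma perturb_distinct:
  fixes \<mu> :: "'i \<Rightarrow> real"
  assumes "finite J" "finite \<Lambda>" "\<eta> > 0"
  shows "\<exists>t. (\<forall>j\<in>J. \<bar>t j\<bar> \<le> \<eta> \<and> \<mu> j + t j \<notin> \<Lambda>) \<and> inj_on (\<lambda>j. \<mu> j + t j) J"
  using assms(1)
proof induction
  case (insert j J)
  then obtain t where t: "\<And>i. i \<in> J \<Longrightarrow> \<bar>t i\<bar> \<le> \<eta> \<and> \<mu> i + t i \<notin> \<Lambda>" "inj_on (\<lambda>i. \<mu> i + t i) J" by blast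
  have "infinite {\<mu> j .. \<mu> j + \<eta>}" using assms(3) by (simp add: infinite_Icc)
  then obtain z where z: "z \<in> {\<mu> j .. \<mu> j + \<eta>} - (\<Lambda> \<union> (\<lambda>i. \<mu> i + t i) ` J)"
    using Diff_infinite_finite[of "\<Lambda> \<union> (\<lambda>i. \<mu> i + t i) ` J"] assms(2) insert.hyps(1)
      infinite_imp_nonempty by blast
  define t' where "t' = t(j := z - \<mu> j)"
  have same: "t' i = t i" if "i \<in> J" for i using that insert.hyps(2) by (auto simp: t'_def)
  have "inj_on (\<lambda>i. \<mu> i + t' i) J" using t(2) same by (simp add: inj_on_def)
  moreover have "\<mu> j + t' j \<notin> (\<lambda>i. \<mu> i + t' i) ` J" using z same by (auto simp: t'_def)
  ultimately show ?case using z t(1) same assms(3) by (intro exI[of _ t']) (auto simp: t'_def inj_on_insert)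
qed auto

text \<open>A self-adjoint involution. Apart from the identity, these are the only unitaries to
  which the invariance of \<open>\<Phi>\<close> is applied.\<close>

lemma unitary_reflection:
  assumes "finite J" "orthonormal f J"
  shows "unitary_op (\<lambda>x. x - 2 *\<^sub>C fproj f J x)"
proof -
  let ?R = "\<lambda>x. x - 2 *\<^sub>C fproj f J x"
  have sa: "self_adjoint ?R"
    using self_adjoint_diff[OF self_adjoint_id self_adjoint_cmult[OF self_adjoint_fproj, of 2]] by simp
  have ff: "fproj f J (fproj f J x) = fproj f J x" for x
    using is_proj_fproj[OF assms] by (simp add: is_proj_iff)
  have "?R (?R x) = x" for x
    using hs_scale_add_left[of 2 2 "fproj f J x"]
    by (simp add: bounded_op_simps[OF bounded_op_fproj] ff scale_simps)
  then show ?thesis unfolding unitary_op_def self_adjoint_adj[OF sa] comp_def id_def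
    using self_adjoint_bounded[OF sa] by auto
qed

lemma unitary_id: "unitary_op id"
proof -
  have "adj id = id" by (rule adj_unique) simp
  then show ?thesis by (simp add: unitary_op_def)
qed

text \<open>The supremum in \<open>opnorm\<close> is taken in the reals, so the set must be shown
  bounded above before the supremum bounds its elements.\<close>

lemma opnorm_bound:
  assumes T: "bounded_op T" shows "\<parallel>T x\<parallel> \<le> opnorm T * \<parallel>x\<parallel>"
proof (cases "x = 0")
  case False
  obtain K where K: "K > 0" "\<And>x. \<parallel>T x\<parallel> \<le> K * \<parallel>x\<parallel>" using bounded_opE[OF T] by metis
  let ?S = "{\<parallel>T x\<parallel> | x. \<parallel>x\<parallel> \<le> 1}" and ?u = "complex_of_real (1 / \<parallel>x\<parallel>) *\<^sub>C x"
  have "bdd_above ?S"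
  proof (rule bdd_aboveI)
    fix r assume "r \<in> ?S"
    then obtain y where "r = \<parallel>T y\<parallel>" "\<parallel>y\<parallel> \<le> 1" by blast
    moreover have "K * \<parallel>y\<parallel> \<le> K * 1" using \<open>\<parallel>y\<parallel> \<le> 1\<close> K(1) by (intro mult_left_mono) auto
    ultimately show "r \<le> K" using K(2)[of y] by simp
  qed
  moreover have "\<parallel>?u\<parallel> = 1" using False by (simp add: hnorm_scale norm_divide)
  then have "\<parallel>T ?u\<parallel> \<in> ?S" by force
  ultimately have "\<parallel>T ?u\<parallel> \<le> opnorm T" unfolding opnorm_def by (rule cSup_upper[rotated])
  then show ?thesis using False hnorm_pos[OF False]
    by (simp add: bounded_op_scale[OF T] hnorm_scale norm_divide divide_le_eq)
qed (simp add: bounded_op_zero[OF T])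

locale ideal_setup =
  fixes \<tau> :: "('h::sep_inf_chilbert \<Rightarrow> 'h) \<Rightarrow> ennreal"
    and I :: "('h \<Rightarrow> 'h) set"
    and \<Phi> :: "('h \<Rightarrow> 'h) \<Rightarrow> real"
  assumes tr: "fns_trace \<tau>" and ni: "normed_ideal \<tau> I \<Phi>" and lc: "limit_condition \<tau> \<Phi>"
begin

lemma ideal_facts:
  "I \<subseteq> BH" "\<forall>x\<in>I. \<forall>y\<in>I. op_add x y \<in> I" "\<forall>c. \<forall>x\<in>I. op_scale c x \<in> I" "\<forall>x\<in>I. 0 \<le> \<Phi> x"
  "\<forall>c. \<forall>x\<in>I. \<Phi> (op_scale c x) = cmod c * \<Phi> x" "\<forall>x\<in>I. \<forall>y\<in>I. \<Phi> (op_add x y) \<le> \<Phi> x + \<Phi> y"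
  "\<forall>x\<in>I. \<forall>u v. unitary_op u \<and> unitary_op v \<longrightarrow> \<Phi> (u \<circ> x \<circ> v) = \<Phi> x"
  "\<exists>c>0. \<forall>x\<in>I. c * opnorm x \<le> \<Phi> x"
  "\<forall>X. (\<forall>n. X n \<in> I) \<and> (\<forall>e>0. \<exists>N. \<forall>m\<ge>N. \<forall>n\<ge>N. \<Phi> (op_diff (X m) (X n)) < e) \<longrightarrow>
        (\<exists>L\<in>I. (\<lambda>n. \<Phi> (op_diff (X n) L)) \<longlonglongrightarrow> 0)"
  "FF \<tau> \<subseteq> I"
  using ni unfolding normed_ideal_def by - (elim conjE, assumption)+

lemma I_bounded: "x \<in> I \<Longrightarrow> bounded_op x"
  using ideal_facts(1) by (auto simp: BH_def)

lemma I_plus: "x \<in> I \<Longrightarrow> y \<in> I \<Longrightarrow> (\<lambda>v. x v + y v) \<in> I"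
  and I_cmult: "x \<in> I \<Longrightarrow> (\<lambda>v. c *\<^sub>C x v) \<in> I"
  and \<Phi>_nonneg: "x \<in> I \<Longrightarrow> 0 \<le> \<Phi> x"
  and \<Phi>_cmult: "x \<in> I \<Longrightarrow> \<Phi> (\<lambda>v. c *\<^sub>C x v) = cmod c * \<Phi> x"
  and \<Phi>_plus: "x \<in> I \<Longrightarrow> y \<in> I \<Longrightarrow> \<Phi> (\<lambda>v. x v + y v) \<le> \<Phi> x + \<Phi> y"
  using ideal_facts(2-6) unfolding op_add_def op_scale_def by blast+

lemma I_uminus: "x \<in> I \<Longrightarrow> (\<lambda>v. - x v) \<in> I"
  and \<Phi>_uminus: "x \<in> I \<Longrightarrow> \<Phi> (\<lambda>v. - x v) = \<Phi> x"
  using I_cmult[of x "-1"] \<Phi>_cmult[of x "-1"] by simp_all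

lemma I_diff: "x \<in> I \<Longrightarrow> y \<in> I \<Longrightarrow> (\<lambda>v. x v - y v) \<in> I"
  and \<Phi>_diff: "x \<in> I \<Longrightarrow> y \<in> I \<Longrightarrow> \<Phi> (\<lambda>v. x v - y v) \<le> \<Phi> x + \<Phi> y"
  using I_plus[OF _ I_uminus, of x y] \<Phi>_plus[OF _ I_uminus, of x y] \<Phi>_uminus[of y] by simp_all

lemma \<Phi>_unitary_left: "x \<in> I \<Longrightarrow> unitary_op u \<Longrightarrow> \<Phi> (\<lambda>v. u (x v)) = \<Phi> x"
  and \<Phi>_unitary_right: "x \<in> I \<Longrightarrow> unitary_op u \<Longrightarrow> \<Phi> (\<lambda>v. x (u v)) = \<Phi> x"
  using ideal_facts(7) unitary_id by (fastforce simp: comp_def)+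

lemma fin_rank_I: "fin_rank x \<Longrightarrow> x \<in> I"
  using ideal_facts(10) fin_rank_FF[OF tr] by blast

lemma \<Phi>_0: "\<Phi> (\<lambda>v. 0) = 0"
  using \<Phi>_cmult[OF fin_rank_I[OF fin_rank_0], of 0] by simp

lemma \<Phi>_sum:
  "(\<And>i. i \<in> A \<Longrightarrow> fin_rank (T i)) \<Longrightarrow> \<Phi> (\<lambda>v. \<Sum>i\<in>A. T i v) \<le> (\<Sum>i\<in>A. \<Phi> (T i))"
proof (induction A rule: infinite_finite_induct)
  case (insert i A)
  then have "\<Phi> (\<lambda>v. T i v + (\<Sum>i\<in>A. T i v)) \<le> \<Phi> (T i) + \<Phi> (\<lambda>v. \<Sum>i\<in>A. T i v)"
    by (intro \<Phi>_plus fin_rank_I fin_rank_sum) auto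
  then show ?case using insert by simp
qed (simp_all add: \<Phi>_0)

text \<open>The unitary swapping each \<open>u j\<close> with \<open>v j\<close> is the reflection in the vectors \<open>u j - v j\<close>.\<close>

lemma \<Phi>_partial_isometry:
  assumes J: "finite J" and u: "orthonormal u J" and v: "orthonormal v J"
    and uv: "\<And>i j. i \<in> J \<Longrightarrow> j \<in> J \<Longrightarrow> \<langle>u i, v j\<rangle> = 0"
  shows "\<Phi> (\<lambda>x. \<Sum>j\<in>J. rk (u j) (v j) x) = \<Phi> (fproj v J)"
proof -
  \<comment> \<open>The vectors \<open>u j\<close> and \<open>v j\<close> are orthogonal unit
    vectors, so their difference has norm \<open>sqrt 2\<close>.\<close>
  let ?s = "complex_of_real (1 / sqrt 2)"
  define w where "w j = ?s *\<^sub>C (u j - v j)" for j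
  have vu: "\<langle>v i, u j\<rangle> = 0" if "i \<in> J" "j \<in> J" for i j
    using uv[OF that(2,1)] by (simp add: inner_commute_zero)
  have ss: "?s * ?s = 1/2" by (simp flip: of_real_mult)
  have s2: "?s * (?s * 2) = 1" using ss by (simp add: mult.assoc[symmetric])
  have w: "orthonormal w J"
    unfolding orthonormal_def w_def using u v uv vu s2 by (auto simp: inner_simps orthonormal_def)
  let ?R = "\<lambda>x. x - 2 *\<^sub>C fproj w J x"
  have Ru: "?R (u j) = v j" if j: "j \<in> J" for j
  proof -
    have "fproj w J (u j) = (\<Sum>i\<in>J. if i = j then ?s *\<^sub>C w j else 0)"
      unfolding fproj_def rk_def
      by (rule sum.cong) (use j u vu in \<open>auto simp: w_def inner_simps orthonormal_def\<close>)
    then have "fproj w J (u j) = (1/2) *\<^sub>C (u j - v j)"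
      using J j ss by (simp add: w_def hs_scale_scale)
    then show ?thesis by (simp add: hs_scale_scale)
  qed
  have R: "unitary_op ?R" by (rule unitary_reflection[OF J w])
  have Rb: "bounded_op ?R" using R by (simp add: unitary_op_def)
  have "(\<lambda>x. ?R (\<Sum>j\<in>J. rk (u j) (v j) x)) = fproj v J"
  proof
    fix x
    have "?R (\<Sum>j\<in>J. rk (u j) (v j) x) = (\<Sum>j\<in>J. \<langle>v j, x\<rangle> *\<^sub>C ?R (u j))"
      using bounded_op_sum[OF Rb, of "\<lambda>j. rk (u j) (v j) x" J] bounded_op_scale[OF Rb]
      by (simp only: rk_def)
    also have "\<dots> = fproj v J x"
      unfolding fproj_def[of v J] rk_def by (rule sum.cong) (simp_all only: Ru)
    finally show "?R (\<Sum>j\<in>J. rk (u j) (v j) x) = fproj v J x" .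
  qed
  moreover have "(\<lambda>x. \<Sum>j\<in>J. rk (u j) (v j) x) \<in> I"
    by (intro fin_rank_I fin_rank_sum fin_rank_rk)
  ultimately show ?thesis using \<Phi>_unitary_left[OF _ R, of "\<lambda>x. \<Sum>j\<in>J. rk (u j) (v j) x"] by simp
qed

text \<open>For orthogonal unit vectors a reflection on the left and one on the right exchange the
  two vectors. Arbitrary \<open>u\<close> and \<open>v\<close> are linked through a unit vector
  orthogonal to both.\<close>

lemma \<Phi>_unit:
  assumes "\<parallel>u\<parallel> = 1" "\<parallel>v\<parallel> = 1" shows "\<Phi> (rk u u) = \<Phi> (rk v v)"
proof -
  have swap: "\<Phi> (rk a b) = \<Phi> (rk b b)" if "\<parallel>a\<parallel> = 1" "\<parallel>b\<parallel> = 1" "\<langle>a, b\<rangle> = 0" for a b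
    using \<Phi>_partial_isometry[of "{()}" "\<lambda>_. a" "\<lambda>_. b"] that
    by (simp add: orthonormal_def fproj_def inner_self)
  have swap': "\<Phi> (rk a a) = \<Phi> (rk a b)" if "\<parallel>a\<parallel> = 1" "\<parallel>b\<parallel> = 1" "\<langle>a, b\<rangle> = 0" for a b
  proof -
    let ?s = "complex_of_real (1 / sqrt 2)"
    define w where "w = ?s *\<^sub>C (a - b)"
    have ba: "\<langle>b, a\<rangle> = 0" and aa: "\<langle>a, a\<rangle> = 1" "\<langle>b, b\<rangle> = 1"
      using that by (simp_all add: inner_commute_zero unit_hnorm)
    have ss: "?s * ?s = 1/2" by (simp flip: of_real_mult)
    have s2: "?s * (?s * 2) = 1" using ss by (simp add: mult.assoc[symmetric])
    have w: "orthonormal (\<lambda>_. w) {()}"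
      using that(3) ba s2 aa by (simp add: orthonormal_def w_def inner_simps)
    let ?R = "\<lambda>x. x - 2 *\<^sub>C fproj (\<lambda>_. w) {()} x"
    have Rx: "?R x = x - \<langle>a - b, x\<rangle> *\<^sub>C (a - b)" for x
      using ss by (simp add: fproj_def rk_def w_def hs_scale_scale inner_scale_left mult_ac)
    have "rk a b (?R x) = rk a a x" for x
      unfolding Rx using that(3) ba aa by (simp add: rk_def inner_simps scale_simps)
    then have "(\<lambda>x. rk a b (?R x)) = rk a a" by (rule ext)
    then show ?thesis
      using \<Phi>_unitary_right[OF fin_rank_I[OF fin_rank_rk] unitary_reflection[OF _ w], of a b] by simp
  qed
  obtain C where C: "finite C" "orthonormal (\<lambda>b. b) C" "\<forall>w\<in>{u, v}. fproj (\<lambda>b. b) C w = w"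
    using orthonormal_extend[of "{u, v}" "{}"] by (auto simp: orthonormal_def)
  obtain e where e: "\<parallel>e\<parallel> = 1" "\<And>b. b \<in> C \<Longrightarrow> \<langle>b, e\<rangle> = 0"
    using orthogonal_unit_exists[OF C(1,2)] by metis
  have "fproj (\<lambda>b. b) C e = 0" unfolding fproj_def rk_def by (rule sum.neutral) (simp add: e(2))
  then have "\<langle>w, e\<rangle> = 0" if "w \<in> {u, v}" for w
    using C(3) that self_adjoint_inner[OF self_adjoint_fproj, of "\<lambda>b. b" C w e] by auto
  then have "\<langle>u, e\<rangle> = 0" "\<langle>v, e\<rangle> = 0" by auto
  then show ?thesis using swap[OF _ e(1)] swap'[OF _ e(1)] assms by metis
qed

text \<open>Flipping the sign of one coefficient is a reflection, so by convexity each coefficient may be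
  raised to \<open>w\<close>.\<close>

lemma \<Phi>_raise_coefficient:
  assumes Y: "fin_rank Y" and v: "\<parallel>v\<parallel> = 1" and Yv: "Y v = 0" and s: "\<bar>s\<bar> \<le> w"
  shows "\<Phi> (\<lambda>x. Y x + complex_of_real s *\<^sub>C rk u v x) \<le> \<Phi> (\<lambda>x. Y x + complex_of_real w *\<^sub>C rk u v x)"
proof (cases "w = 0")
  case True
  then show ?thesis using s by simp
next
  case False
  then have w: "w > 0" using s by linarith
  have vv: "\<langle>v, v\<rangle> = 1" using v by (simp add: unit_hnorm)
  let ?P = "\<lambda>x. Y x + complex_of_real w *\<^sub>C rk u v x"
  let ?M = "\<lambda>x. Y x + complex_of_real (- w) *\<^sub>C rk u v x"
  let ?R = "\<lambda>x. x - 2 *\<^sub>C fproj (\<lambda>_. v) {()} x"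
  \<comment> \<open>The weight that writes \<open>s\<close> as a convex combination of
    \<open>w\<close> and \<open>-w\<close>.\<close>
  define \<theta> where "\<theta> = (w + s) / (2 * w)"
  have \<theta>: "0 \<le> \<theta>" "\<theta> \<le> 1" and \<theta>s: "\<theta> * w + (1 - \<theta>) * (- w) = s"
    using s w by (auto simp: \<theta>_def field_simps)
  have P: "fin_rank ?P" and M: "fin_rank ?M" by (intro fin_rank_plus Y fin_rank_cmult fin_rank_rk)+
  have PI: "?P \<in> I" and MI: "?M \<in> I" using P M by (auto intro: fin_rank_I)
  have on: "orthonormal (\<lambda>_. v) {()}" by (simp add: orthonormal_def vv)
  have Rx: "?R x = x - (2 * \<langle>v, x\<rangle>) *\<^sub>C v" for x by (simp add: fproj_def rk_def hs_scale_scale)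
  \<comment> \<open>The reflection in \<open>v\<close> flips the sign of \<open>rk u v\<close> and
    leaves \<open>Y\<close> alone because \<open>Y v = 0\<close>; hence both extreme operators have
    the same norm.\<close>
  have "rk u v (?R x) = - rk u v x" for x
    unfolding Rx by (simp add: rk_def inner_simps vv scale_simps flip: scale_minus_left)
  moreover have "Y (?R x) = Y x" for x
    unfolding Rx by (simp add: bounded_op_simps[OF fin_rank_bounded[OF Y]] Yv)
  ultimately have "(\<lambda>x. ?P (?R x)) = ?M" by (simp add: fun_eq_iff)
  then have M_eq: "\<Phi> ?M = \<Phi> ?P" using \<Phi>_unitary_right[OF PI unitary_reflection[OF _ on]] by simp
  have "(\<lambda>x. Y x + complex_of_real s *\<^sub>C rk u v x)
      = (\<lambda>x. complex_of_real \<theta> *\<^sub>C ?P x + complex_of_real (1 - \<theta>) *\<^sub>C ?M x)"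
  proof
    fix x
    have "complex_of_real \<theta> *\<^sub>C ?P x + complex_of_real (1 - \<theta>) *\<^sub>C ?M x
      = complex_of_real (\<theta> + (1 - \<theta>)) *\<^sub>C Y x + complex_of_real (\<theta> * w + (1 - \<theta>) * (- w)) *\<^sub>C rk u v x"
      unfolding of_real_add of_real_mult hs_scale_add_left hs_scale_add_right hs_scale_scale by (simp add: algebra_simps)
    then show "Y x + complex_of_real s *\<^sub>C rk u v x
      = complex_of_real \<theta> *\<^sub>C ?P x + complex_of_real (1 - \<theta>) *\<^sub>C ?M x"
      unfolding \<theta>s by simp
  qed
  then have "\<Phi> (\<lambda>x. Y x + complex_of_real s *\<^sub>C rk u v x)
      = \<Phi> (\<lambda>x. complex_of_real \<theta> *\<^sub>C ?P x + complex_of_real (1 - \<theta>) *\<^sub>C ?M x)" by (rule arg_cong)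
  also have "\<dots> \<le> \<Phi> (\<lambda>x. complex_of_real \<theta> *\<^sub>C ?P x) + \<Phi> (\<lambda>x. complex_of_real (1 - \<theta>) *\<^sub>C ?M x)"
    by (rule \<Phi>_plus[OF I_cmult[OF PI] I_cmult[OF MI]])
  also have "\<dots> = \<theta> * \<Phi> ?P + (1 - \<theta>) * \<Phi> ?M"
    unfolding \<Phi>_cmult[OF PI] \<Phi>_cmult[OF MI] norm_of_real using \<theta> by simp
  also have "\<dots> = \<Phi> ?P" unfolding M_eq by (simp add: algebra_simps)
  finally show ?thesis .
qed

text \<open>Takes the place of an ideal inequality for diagonal multipliers. The induction is over
  the set \<open>K\<close> of indices whose coefficient has already been raised.\<close>

lemma \<Phi>_raise_coefficients:
  assumes J: "finite J" and v: "orthonormal v J" and s: "\<And>j. j \<in> J \<Longrightarrow> \<bar>s j\<bar> \<le> w"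
  shows "\<Phi> (\<lambda>x. \<Sum>j\<in>J. complex_of_real (s j) *\<^sub>C rk (u j) (v j) x)
    \<le> \<bar>w\<bar> * \<Phi> (\<lambda>x. \<Sum>j\<in>J. rk (u j) (v j) x)"
proof -
  have "\<Phi> (\<lambda>x. \<Sum>j\<in>J. complex_of_real (s j) *\<^sub>C rk (u j) (v j) x)
    \<le> \<Phi> (\<lambda>x. \<Sum>j\<in>J. complex_of_real (if j \<in> K then w else s j) *\<^sub>C rk (u j) (v j) x)" if "finite K" "K \<subseteq> J" for K
    using that
  proof (induction K)
    case (insert k K)
    define t where "t j = (if j \<in> K then w else s j)" for j
    define Y where "Y x = (\<Sum>j\<in>J - {k}. complex_of_real (t j) *\<^sub>C rk (u j) (v j) x)" for x
    have k: "k \<in> J" and tk: "t k = s k" using insert by (auto simp: t_def)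
    have "fin_rank Y" unfolding Y_def by (intro fin_rank_sum fin_rank_cmult fin_rank_rk)
    moreover have "Y (v k) = 0" unfolding Y_def rk_def
      by (rule sum.neutral) (use v k in \<open>auto simp: orthonormal_def\<close>)
    moreover have "\<parallel>v k\<parallel> = 1" using v k by (simp add: orthonormal_def unit_hnorm[symmetric])
    ultimately have le: "\<Phi> (\<lambda>x. Y x + complex_of_real (s k) *\<^sub>C rk (u k) (v k) x)
        \<le> \<Phi> (\<lambda>x. Y x + complex_of_real w *\<^sub>C rk (u k) (v k) x)"
      by (intro \<Phi>_raise_coefficient s k)
    have 1: "(\<lambda>x. \<Sum>j\<in>J. complex_of_real (t j) *\<^sub>C rk (u j) (v j) x)
        = (\<lambda>x. Y x + complex_of_real (s k) *\<^sub>C rk (u k) (v k) x)"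
      unfolding Y_def by (simp add: sum.remove[OF J k] tk add.commute)
    have 2: "(\<lambda>x. \<Sum>j\<in>J. complex_of_real (if j \<in> insert k K then w else s j) *\<^sub>C rk (u j) (v j) x)
        = (\<lambda>x. Y x + complex_of_real w *\<^sub>C rk (u k) (v k) x)"
    proof
      fix x
      have "(\<Sum>j\<in>J - {k}. complex_of_real (if j \<in> insert k K then w else s j) *\<^sub>C rk (u j) (v j) x) = Y x"
        unfolding Y_def by (rule sum.cong) (auto simp: t_def)
      then show "(\<Sum>j\<in>J. complex_of_real (if j \<in> insert k K then w else s j) *\<^sub>C rk (u j) (v j) x)
        = Y x + complex_of_real w *\<^sub>C rk (u k) (v k) x"
        by (simp add: sum.remove[OF J k] add.commute)
    qed
    show ?case using insert.IH insert.prems le unfolding 2 unfolding t_def[symmetric] 1 by simp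
  qed simp
  from this[OF J] have "\<Phi> (\<lambda>x. \<Sum>j\<in>J. complex_of_real (s j) *\<^sub>C rk (u j) (v j) x)
    \<le> \<Phi> (\<lambda>x. \<Sum>j\<in>J. complex_of_real (if j \<in> J then w else s j) *\<^sub>C rk (u j) (v j) x)" by simp
  also have "(\<lambda>x. \<Sum>j\<in>J. complex_of_real (if j \<in> J then w else s j) *\<^sub>C rk (u j) (v j) x)
    = (\<lambda>x. complex_of_real w *\<^sub>C (\<Sum>j\<in>J. rk (u j) (v j) x))"
    by (simp add: scale_sum)
  also have "\<Phi> \<dots> = \<bar>w\<bar> * \<Phi> (\<lambda>x. \<Sum>j\<in>J. rk (u j) (v j) x)"
    by (simp only: \<Phi>_cmult[OF fin_rank_I[OF fin_rank_sum[OF fin_rank_rk]]] norm_of_real)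
  finally show ?thesis .
qed

text \<open>The limit condition controls only projections of large trace; the constant
  \<open>C\<close> pays for the remaining ones, whose rank is bounded.\<close>

lemma \<Phi>_fproj_sublinear:
  assumes "(\<delta>::real) > 0"
  obtains C where "C \<ge> 0" "\<And>(f :: nat \<Rightarrow> 'h) J. finite J \<Longrightarrow> orthonormal f J \<Longrightarrow> \<Phi> (fproj f J) \<le> \<delta> * card J + C"
proof -
  obtain u :: 'h where u: "\<parallel>u\<parallel> = 1"
    using orthogonal_unit_exists[of "{}::'h set"] by (auto simp: orthonormal_def)
  define t where "t = enn2real (\<tau> (rk u u))"
  have tfin: "\<tau> (rk u u) = ennreal t"
    using trace_rk_unit_finite[OF tr u] by (simp add: t_def)
  have t: "t > 0" using trace_rk_unit_nonzero[OF tr u] tfin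
    by (metis ennreal_eq_0_iff not_le)
  \<comment> \<open>A projection of rank \<open>n\<close> has trace \<open>n * t\<close>, so a ratio
    below \<open>\<delta> / t\<close> means \<open>\<Phi>\<close> below
    \<open>\<delta> * n\<close>.\<close>
  obtain N :: real where N: "\<And>e. e \<in> PF \<tau> \<Longrightarrow> \<tau> e > ennreal N \<Longrightarrow> \<Phi> e / enn2real (\<tau> e) < \<delta> / t"
    using lc assms t unfolding limit_condition_def by (meson divide_pos_pos)
  \<comment> \<open>A negative \<open>N\<close> would be truncated to 0 by \<open>ennreal\<close>;
    with a nonnegative threshold the comparison can be made in the reals.\<close>
  define M where "M = max N 0"
  \<comment> \<open>Rank at most \<open>M / t\<close> times the norm of one rank-one projection, by
    the triangle inequality.\<close>
  define C where "C = M / t * \<Phi> (rk u u)"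
  have \<Phi>u: "0 \<le> \<Phi> (rk u u)" by (intro \<Phi>_nonneg fin_rank_I fin_rank_rk)
  have C0: "C \<ge> 0" using \<Phi>u t by (simp add: C_def M_def)
  have "\<Phi> (fproj f J) \<le> \<delta> * card J + C" if J: "finite J" and f: "orthonormal f J" for f :: "nat \<Rightarrow> 'h" and J
  proof (cases "real (card J) * t > M")
    case True
    have \<tau>e: "\<tau> (fproj f J) = ennreal (real (card J) * t)"
      using trace_fproj[OF tr J f u] t by (simp add: tfin ennreal_mult' ennreal_of_nat_eq_real_of_nat)
    have pos: "real (card J) * t > 0" using True by (simp add: M_def)
    have "\<tau> (fproj f J) > ennreal N"
    proof -
      have "ennreal N \<le> ennreal M" by (simp add: M_def ennreal_leI)
      also have "\<dots> < ennreal (real (card J) * t)" using True by (simp add: ennreal_less_iff M_def)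
      finally show ?thesis by (simp add: \<tau>e)
    qed
    from N[OF fproj_PF[OF tr J f] this] have "\<Phi> (fproj f J) / (real (card J) * t) < \<delta> / t"
      using pos by (simp add: \<tau>e)
    moreover have "real (card J) > 0" using pos t by (simp add: zero_less_mult_iff)
    ultimately have "\<Phi> (fproj f J) < \<delta> * card J" using t by (simp add: field_simps)
    then show ?thesis using C0 by simp
  next
    case False
    have "\<Phi> (fproj f J) \<le> (\<Sum>j\<in>J. \<Phi> (rk (f j) (f j)))"
      unfolding fproj_def by (rule \<Phi>_sum) (rule fin_rank_rk)
    also have "\<dots> = (\<Sum>j\<in>J. \<Phi> (rk u u))"
      by (rule sum.cong[OF refl], rule \<Phi>_unit[OF _ u]) (use f in \<open>simp add: orthonormal_def unit_hnorm[symmetric]\<close>)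
    also have "\<dots> = card J * \<Phi> (rk u u)" by simp
    also have "\<dots> \<le> C" unfolding C_def using False t \<Phi>u
      by (intro mult_right_mono) (auto simp: field_simps)
    finally show ?thesis using assms mult_nonneg_nonneg[of \<delta> "real (card J)"] by linarith
  qed
  with C0 that show thesis by blast
qed

text \<open>Normalizing the nonzero \<open>g j\<close> exhibits a partial isometry with coefficients
  at most \<open>w\<close>; raising these to \<open>w\<close> and moving one family onto the other
  by a reflection leaves a projection. Zero vectors are dropped, hence the bound \<open>D\<close>
  for all subsets \<open>K\<close>. The two estimates end at the families \<open>h\<close> and
  \<open>e\<close> respectively, hence the bound for all orthonormal families.\<close>

lemma \<Phi>_off_diagonal:
  fixes g h :: "nat \<Rightarrow> 'h"
  assumes J: "finite J" and h: "orthonormal h J" and w: "0 \<le> w" and D: "0 \<le> D"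
    and gh: "\<And>i j. i \<in> J \<Longrightarrow> j \<in> J \<Longrightarrow> \<langle>g i, h j\<rangle> = 0"
    and gg: "\<And>i j. i \<in> J \<Longrightarrow> j \<in> J \<Longrightarrow> i \<noteq> j \<Longrightarrow> \<langle>g i, g j\<rangle> = 0"
    and g: "\<And>j. j \<in> J \<Longrightarrow> \<parallel>g j\<parallel> \<le> w"
    and bd: "\<And>(f :: nat \<Rightarrow> 'h) K. K \<subseteq> J \<Longrightarrow> orthonormal f K \<Longrightarrow> \<Phi> (fproj f K) \<le> D"
  shows "\<Phi> (\<lambda>x. \<Sum>j\<in>J. rk (g j) (h j) x) \<le> w * D" "\<Phi> (\<lambda>x. \<Sum>j\<in>J. rk (h j) (g j) x) \<le> w * D"
proof -
  define K where "K = {j \<in> J. g j \<noteq> 0}"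
  define e where "e j = complex_of_real (1 / \<parallel>g j\<parallel>) *\<^sub>C g j" for j
  have K: "finite K" "K \<subseteq> J" using J by (auto simp: K_def)
  have hK: "orthonormal h K" using orthonormal_subset[OF h K(2)] .
  have eK: "orthonormal e K" unfolding orthonormal_def
  proof (intro ballI)
    fix i j assume ij: "i \<in> K" "j \<in> K"
    then show "\<langle>e i, e j\<rangle> = (if i = j then 1 else 0)"
      using normalize_inner[of "g j"] gg[of i j] K(2) by (auto simp: e_def inner_simps K_def)
  qed
  have ge: "g j = complex_of_real \<parallel>g j\<parallel> *\<^sub>C e j" if "j \<in> K" for j
    using that by (simp add: e_def hs_scale_scale K_def)
  have eh: "\<langle>e i, h j\<rangle> = 0" "\<langle>h j, e i\<rangle> = 0" if "i \<in> K" "j \<in> K" for i j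
    using gh[of i j] that K(2) by (auto simp: e_def inner_simps inner_commute_zero[of "h j"])
  have gw: "\<bar>\<parallel>g j\<parallel>\<bar> \<le> w" if "j \<in> K" for j using g[of j] that K(2) by auto
  have 1: "(\<lambda>x. \<Sum>j\<in>J. rk (g j) (h j) x) = (\<lambda>x. \<Sum>j\<in>K. complex_of_real \<parallel>g j\<parallel> *\<^sub>C rk (e j) (h j) x)"
  proof
    fix x
    have "(\<Sum>j\<in>J. rk (g j) (h j) x) = (\<Sum>j\<in>K. rk (g j) (h j) x)"
      by (rule sum.mono_neutral_right[OF J K(2)]) (auto simp: K_def rk_def)
    also have "\<dots> = (\<Sum>j\<in>K. complex_of_real \<parallel>g j\<parallel> *\<^sub>C rk (e j) (h j) x)"
    proof (rule sum.cong[OF refl])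
      fix j assume "j \<in> K"
      have "rk (complex_of_real \<parallel>g j\<parallel> *\<^sub>C e j) (h j) x = complex_of_real \<parallel>g j\<parallel> *\<^sub>C rk (e j) (h j) x"
        by (simp add: rk_def hs_scale_scale mult.commute)
      then show "rk (g j) (h j) x = complex_of_real \<parallel>g j\<parallel> *\<^sub>C rk (e j) (h j) x"
        using ge[OF \<open>j \<in> K\<close>] by metis
    qed
    finally show "(\<Sum>j\<in>J. rk (g j) (h j) x) = (\<Sum>j\<in>K. complex_of_real \<parallel>g j\<parallel> *\<^sub>C rk (e j) (h j) x)" .
  qed
  have 2: "(\<lambda>x. \<Sum>j\<in>J. rk (h j) (g j) x) = (\<lambda>x. \<Sum>j\<in>K. complex_of_real \<parallel>g j\<parallel> *\<^sub>C rk (h j) (e j) x)"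
  proof
    fix x
    have "(\<Sum>j\<in>J. rk (h j) (g j) x) = (\<Sum>j\<in>K. rk (h j) (g j) x)"
      by (rule sum.mono_neutral_right[OF J K(2)]) (auto simp: K_def rk_def)
    also have "\<dots> = (\<Sum>j\<in>K. complex_of_real \<parallel>g j\<parallel> *\<^sub>C rk (h j) (e j) x)"
    proof (rule sum.cong[OF refl])
      fix j assume "j \<in> K"
      have "rk (h j) (complex_of_real \<parallel>g j\<parallel> *\<^sub>C e j) x = complex_of_real \<parallel>g j\<parallel> *\<^sub>C rk (h j) (e j) x"
        by (simp add: rk_def hs_scale_scale inner_simps)
      then show "rk (h j) (g j) x = complex_of_real \<parallel>g j\<parallel> *\<^sub>C rk (h j) (e j) x"
        using ge[OF \<open>j \<in> K\<close>] by metis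
    qed
    finally show "(\<Sum>j\<in>J. rk (h j) (g j) x) = (\<Sum>j\<in>K. complex_of_real \<parallel>g j\<parallel> *\<^sub>C rk (h j) (e j) x)" .
  qed
  have "\<Phi> (\<lambda>x. \<Sum>j\<in>J. rk (g j) (h j) x) \<le> \<bar>w\<bar> * \<Phi> (\<lambda>x. \<Sum>j\<in>K. rk (e j) (h j) x)"
    unfolding 1 by (rule \<Phi>_raise_coefficients[OF K(1) hK gw])
  also have "\<Phi> (\<lambda>x. \<Sum>j\<in>K. rk (e j) (h j) x) = \<Phi> (fproj h K)"
    by (rule \<Phi>_partial_isometry[OF K(1) eK hK eh(1)])
  also have "\<bar>w\<bar> * \<Phi> (fproj h K) \<le> w * D" using bd[OF K(2) hK] w by (simp add: mult_left_mono)
  finally show "\<Phi> (\<lambda>x. \<Sum>j\<in>J. rk (g j) (h j) x) \<le> w * D" .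
  have "\<Phi> (\<lambda>x. \<Sum>j\<in>J. rk (h j) (g j) x) \<le> \<bar>w\<bar> * \<Phi> (\<lambda>x. \<Sum>j\<in>K. rk (h j) (e j) x)"
    unfolding 2 by (rule \<Phi>_raise_coefficients[OF K(1) eK gw])
  also have "\<Phi> (\<lambda>x. \<Sum>j\<in>K. rk (h j) (e j) x) = \<Phi> (fproj e K)"
    by (rule \<Phi>_partial_isometry[OF K(1) hK eK eh(2)])
  also have "\<bar>w\<bar> * \<Phi> (fproj e K) \<le> w * D" using bd[OF K(2) eK] w by (simp add: mult_left_mono)
  finally show "\<Phi> (\<lambda>x. \<Sum>j\<in>J. rk (h j) (g j) x) \<le> w * D" .
qed

end

subsection \<open>Diagonalization up to a small perturbation\<close>

text \<open>The eigenvalue is read off from the vector as a real number, so no separate eigenvalue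
  function is carried along; the injectivity says that the eigenvalues are distinct.\<close>

definition diagonal_on :: "('h::sep_inf_chilbert \<Rightarrow> 'h) \<Rightarrow> 'h set \<Rightarrow> bool" where
  "diagonal_on a B \<longleftrightarrow> orthonormal (\<lambda>b. b) B \<and> (\<forall>b\<in>B. a b = complex_of_real (Re \<langle>b, a b\<rangle>) *\<^sub>C b)
     \<and> inj_on (\<lambda>b. Re \<langle>b, a b\<rangle>) B"

context ideal_setup
begin

text \<open>The normalized bin components \<open>h j\<close> of the part of \<open>d\<close> outside
  the span of \<open>B\<close> become eigenvectors once the residues \<open>g j\<close> of
  \<open>a (h j)\<close> are subtracted symmetrically. A further shift of each eigenvalue separates
  it from all others. Nothing changes on \<open>B\<close>, because \<open>B\<close> is orthogonal to
  every \<open>h j\<close> and every \<open>g j\<close>.\<close>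

lemma diagonalize_step:
  fixes d :: 'h
  assumes a: "self_adjoint a" and B: "finite B" "diagonal_on a B" and \<epsilon>: "\<epsilon> > 0"
  shows "\<exists>k C. fin_rank k \<and> self_adjoint k \<and> \<Phi> k \<le> \<epsilon> \<and> (\<forall>b\<in>B. k b = 0) \<and> finite C \<and> B \<subseteq> C
    \<and> diagonal_on (\<lambda>x. a x + k x) C \<and> fproj (\<lambda>b. b) C d = d"
proof -
  have Bo: "orthonormal (\<lambda>b. b) B" and Be: "\<And>b. b \<in> B \<Longrightarrow> a b = complex_of_real (Re \<langle>b, a b\<rangle>) *\<^sub>C b"
    and Bi: "inj_on (\<lambda>b. Re \<langle>b, a b\<rangle>) B" using B by (auto simp: diagonal_on_def)
  have ab: "bounded_op a" by (rule self_adjoint_bounded[OF a])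
  obtain K where K: "K > 0" "\<And>x. \<parallel>a x\<parallel> \<le> K * \<parallel>x\<parallel>" using bounded_opE[OF ab] by metis
  \<comment> \<open>Times \<open>m + 1\<close> and the width \<open>2 * K / (m + 1)\<close>, this
    slope contributes \<open>\<epsilon> / 8\<close> whatever \<open>m\<close> is.\<close>
  have "\<epsilon> / (16 * K) > 0" using \<epsilon> K by simp
  then obtain D where D: "D \<ge> 0"
    "\<And>(f :: nat \<Rightarrow> 'h) J. finite J \<Longrightarrow> orthonormal f J \<Longrightarrow> \<Phi> (fproj f J) \<le> \<epsilon> / (16 * K) * card J + D"
    using \<Phi>_fproj_sublinear by metis
  \<comment> \<open>Large enough that the additive constant \<open>D\<close> times the width is also
    at most \<open>\<epsilon> / 8\<close>.\<close>
  obtain m :: nat where m: "16 * K * D / \<epsilon> < real m" using reals_Archimedean2 by blast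
  define w where "w = 2 * K / (real m + 1)"
  have w: "w \<ge> 0" using K by (simp add: w_def)
  obtain F c where F: "\<And>j. j \<le> m \<Longrightarrow> is_proj (F j)" and Fc: "\<And>j. j \<le> m \<Longrightarrow> bicommutes a (F j)"
    and Fn: "\<And>j x. j \<le> m \<Longrightarrow> \<parallel>a (F j x) - complex_of_real (c j) *\<^sub>C F j x\<parallel> \<le> w * \<parallel>F j x\<parallel>"
    and Fo: "\<And>i j x. i \<le> m \<Longrightarrow> j \<le> m \<Longrightarrow> i \<noteq> j \<Longrightarrow> F i (F j x) = 0"
    and Fsum: "\<And>x. (\<Sum>j\<le>m. F j x) = x"
    by (rule spectral_bins[OF a K(2) less_imp_le[OF K(1)], of m, folded w_def]) (rule that)
  have Fs: "self_adjoint (F j)" and FF: "F j (F j x) = F j x" if "j \<le> m" for j x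
    using F[OF that] by (auto simp: is_proj_iff)
  note Fb = self_adjoint_bounded[OF Fs]
  have Fa: "F j (a x) = a (F j x)" if "j \<le> m" for j x
    using bicommutesD[OF Fc[OF that] ab] by (simp add: commute_def)
  define f where "f = d - fproj (\<lambda>b. b) B d"
  \<comment> \<open>The span of the eigenvectors in \<open>B\<close> reduces \<open>a\<close>, so
    its projection commutes with \<open>a\<close> and hence with every bin. Each bin therefore keeps
    \<open>f\<close> in the complement of \<open>B\<close>.\<close>
  have bf: "\<langle>b, F j f\<rangle> = 0" if b: "b \<in> B" and j: "j \<le> m" for b j
  proof -
    let ?P = "fproj (\<lambda>b. b) B"
    have "?P (a x) = a (?P x)" for x
    proof -
      have "?P (a x) = (\<Sum>b\<in>B. \<langle>a b, x\<rangle> *\<^sub>C b)"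
        by (simp add: fproj_def rk_def self_adjoint_inner[OF a])
      also have "\<dots> = (\<Sum>b\<in>B. \<langle>b, x\<rangle> *\<^sub>C a b)"
      proof (rule sum.cong[OF refl])
        fix b assume "b \<in> B"
        obtain r where "a b = complex_of_real r *\<^sub>C b" using Be[OF \<open>b \<in> B\<close>] by blast
        then show "\<langle>a b, x\<rangle> *\<^sub>C b = \<langle>b, x\<rangle> *\<^sub>C a b"
          by (simp add: inner_simps hs_scale_scale mult.commute)
      qed
      finally show ?thesis by (simp add: fproj_def rk_def bounded_op_simps[OF ab])
    qed
    then have "commute ?P a" by (simp add: commute_def)
    then have "commute ?P (F j)" by (rule bicommutesD[OF Fc[OF j] bounded_op_fproj])
    moreover have "?P f = 0"
      using fproj_fproj[OF B(1) Bo B(1) Bo fproj_basis[OF B(1) Bo], of d]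
      by (simp add: f_def bounded_op_simps[OF bounded_op_fproj])
    ultimately have "?P (F j f) = 0" by (simp add: commute_def bounded_op_zero[OF Fb[OF j]])
    then show ?thesis using inner_fproj[OF B(1) Bo b, of "F j f"] by simp
  qed
  define J where "J = {j. j \<le> m \<and> F j f \<noteq> 0}"
  have J: "finite J" and Jm: "\<And>j. j \<in> J \<Longrightarrow> j \<le> m" by (auto simp: J_def)
  have cardJ: "card J \<le> m + 1" using card_mono[of "{..m}" J] Jm by fastforce
  define h where "h j = complex_of_real (1 / \<parallel>F j f\<parallel>) *\<^sub>C F j f" for j
  have Fh: "F j (h j) = h j" if "j \<in> J" for j
    using FF[OF Jm[OF that]] by (simp add: h_def bounded_op_scale[OF Fb[OF Jm[OF that]]])
  have Forth: "\<langle>F i x, F j y\<rangle> = 0" if "i \<in> J" "j \<in> J" "i \<noteq> j" for i j x y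
    using that Jm by (simp add: self_adjoint_inner[OF Fs] Fo)
  have hh: "\<langle>h j, h j\<rangle> = 1" if "j \<in> J" for j
    unfolding h_def by (rule normalize_inner) (use that in \<open>simp add: J_def\<close>)
  have h1: "\<parallel>h j\<parallel> = 1" if "j \<in> J" for j using hh[OF that] by (simp add: unit_hnorm)
  have ho: "orthonormal h J" unfolding orthonormal_def
  proof (intro ballI)
    fix i j assume "i \<in> J" "j \<in> J"
    then show "\<langle>h i, h j\<rangle> = (if i = j then 1 else 0)"
      using hh Forth[of i j "h i" "h j"] Fh by auto
  qed
  define \<mu> where "\<mu> j = Re \<langle>h j, a (h j)\<rangle>" for j
  have \<mu>: "\<langle>h j, a (h j)\<rangle> = complex_of_real (\<mu> j)" for j
    by (simp add: \<mu>_def complex_eq_iff self_adjoint_Im[OF a])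
  \<comment> \<open>The off-diagonal part of \<open>a (h j)\<close>: it stays in the bin of
    \<open>h j\<close>, so it is orthogonal to every \<open>h i\<close> and to the residues of the
    other bins.\<close>
  define g where "g j = a (h j) - complex_of_real (\<mu> j) *\<^sub>C h j" for j
  have Fg: "F j (g j) = g j" if "j \<in> J" for j
    using Jm[OF that] by (simp add: g_def bounded_op_simps[OF Fb] Fa Fh[OF that])
  have hg: "\<langle>h i, g j\<rangle> = 0" if "i \<in> J" "j \<in> J" for i j
  proof (cases "i = j")
    case True
    then show ?thesis using that hh by (simp add: g_def inner_simps \<mu>)
  next
    case False
    then show ?thesis using Forth[OF that, of "h i" "g j"] Fh Fg that by simp
  qed
  then have gh: "\<langle>g j, h i\<rangle> = 0" if "i \<in> J" "j \<in> J" for i j using that by (simp add: inner_commute_zero)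
  have gg: "\<langle>g i, g j\<rangle> = 0" if "i \<in> J" "j \<in> J" "i \<noteq> j" for i j
    using Forth[OF that, of "g i" "g j"] Fg that by simp
  \<comment> \<open>The bin estimate uses the reference value \<open>c j\<close>. Passing to the
    mean value \<open>\<mu> j\<close> only shortens the vector, by Pythagoras.\<close>
  have gw: "\<parallel>g j\<parallel> \<le> w" if j: "j \<in> J" for j
  proof -
    define r where "r = complex_of_real (\<mu> j - c j) *\<^sub>C h j"
    have "a (h j) - complex_of_real (c j) *\<^sub>C h j = g j + r"
      by (simp add: g_def r_def scale_diff_left)
    then have "\<parallel>g j + r\<parallel> \<le> w" using Fn[OF Jm[OF j], of "h j"] by (simp add: Fh[OF j] h1[OF j])
    moreover have "\<parallel>g j + r\<parallel>\<^sup>2 = \<parallel>g j\<parallel>\<^sup>2 + \<parallel>r\<parallel>\<^sup>2"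
      by (rule hnorm_add_orthogonal) (simp add: r_def inner_simps gh[OF j j])
    then have "\<parallel>g j\<parallel>\<^sup>2 \<le> \<parallel>g j + r\<parallel>\<^sup>2" by simp
    from power2_le_imp_le[OF this] have "\<parallel>g j\<parallel> \<le> \<parallel>g j + r\<parallel>" by simp
    ultimately show ?thesis by linarith
  qed
  have bh: "\<langle>b, h j\<rangle> = 0" if "b \<in> B" "j \<in> J" for b j
    using bf[OF that(1) Jm[OF that(2)]] by (simp add: h_def inner_simps)
  have bg: "\<langle>b, g j\<rangle> = 0" if b: "b \<in> B" and j: "j \<in> J" for b j
  proof -
    obtain r where "a b = complex_of_real r *\<^sub>C b" using Be[OF b] by blast
    then have "\<langle>b, a (h j)\<rangle> = 0" using bh[OF b j] by (simp add: self_adjoint_inner[OF a, symmetric] inner_simps)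
    then show ?thesis using bh[OF b j] by (simp add: g_def inner_simps)
  qed
  obtain u :: 'h where u: "\<parallel>u\<parallel> = 1"
    using orthogonal_unit_exists[of "{}::'h set"] by (auto simp: orthonormal_def)
  define \<phi> where "\<phi> = \<Phi> (rk u u)"
  have \<phi>: "0 \<le> \<phi>" unfolding \<phi>_def by (intro \<Phi>_nonneg fin_rank_I fin_rank_rk)
  \<comment> \<open>At most \<open>m + 1\<close> shifts of size \<open>\<eta>\<close>, each costing
    \<open>\<phi>\<close> per unit, sum to at most \<open>\<epsilon> / 2\<close>; using
    \<open>\<phi> + 1\<close> keeps the denominator positive.\<close>
  define \<eta> where "\<eta> = \<epsilon> / (2 * (real m + 1) * (\<phi> + 1))"
  have \<eta>: "\<eta> > 0" using \<epsilon> \<phi> by (simp add: \<eta>_def)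
  obtain t where t: "\<And>j. j \<in> J \<Longrightarrow> \<bar>t j\<bar> \<le> \<eta> \<and> \<mu> j + t j \<notin> (\<lambda>b. Re \<langle>b, a b\<rangle>) ` B"
    and tinj: "inj_on (\<lambda>j. \<mu> j + t j) J"
    using perturb_distinct[OF J finite_imageI[OF B(1), of "\<lambda>b. Re \<langle>b, a b\<rangle>"] \<eta>, of \<mu>] by blast
  define k1 where "k1 x = (\<Sum>j\<in>J. rk (g j) (h j) x)" for x
  define k2 where "k2 x = (\<Sum>j\<in>J. rk (h j) (g j) x)" for x
  define k3 where "k3 x = (\<Sum>j\<in>J. complex_of_real (t j) *\<^sub>C rk (h j) (h j) x)" for x
  \<comment> \<open>\<open>k1\<close> and its adjoint \<open>k2\<close> cancel the off-diagonal
    part, and \<open>k3\<close> shifts the eigenvalues. Their shares of the budget are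
    \<open>\<epsilon> / 4\<close>, \<open>\<epsilon> / 4\<close> and
    \<open>\<epsilon> / 2\<close>.\<close>
  define k where "k x = k3 x - (k1 x + k2 x)" for x
  have fr: "fin_rank k1" "fin_rank k2" "fin_rank k3"
    unfolding k1_def k2_def k3_def by (intro fin_rank_sum fin_rank_rk fin_rank_cmult)+
  note frI = fr[THEN fin_rank_I]
  have k_eq: "k = (\<lambda>x. k3 x + (- (k1 x + k2 x)))" by (simp add: k_def fun_eq_iff)
  have kfr: "fin_rank k" unfolding k_eq by (intro fin_rank_plus fin_rank_uminus fr)
  have k12: "(\<lambda>x. k1 x + k2 x) = (\<lambda>x. \<Sum>j\<in>J. rk (g j) (h j) x + rk (h j) (g j) x)"
    by (simp add: k1_def k2_def sum.distrib fun_eq_iff)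
  have ksa: "self_adjoint k" unfolding k_def
    by (rule self_adjoint_diff)
       (unfold k12 k3_def, (intro self_adjoint_sum self_adjoint_rk_sym self_adjoint_cmult self_adjoint_rk)+)
  have bd: "\<Phi> (fproj f' K') \<le> \<epsilon> / (16 * K) * (real m + 1) + D" if "K' \<subseteq> J" "orthonormal f' K'" for f' :: "nat \<Rightarrow> 'h" and K'
  proof -
    have "\<Phi> (fproj f' K') \<le> \<epsilon> / (16 * K) * card K' + D"
      using D(2)[of K' f'] that J finite_subset by blast
    moreover have "real (card K') \<le> real m + 1" using card_mono[OF J that(1)] cardJ by linarith
    then have "\<epsilon> / (16 * K) * card K' \<le> \<epsilon> / (16 * K) * (real m + 1)" using \<epsilon> K by (intro mult_left_mono) auto
    ultimately show ?thesis by linarith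
  qed
  have D': "0 \<le> \<epsilon> / (16 * K) * (real m + 1) + D" using \<epsilon> K D by simp
  have wD: "w * (\<epsilon> / (16 * K) * (real m + 1) + D) \<le> \<epsilon> / 4"
  proof -
    have "2 * K / M * (\<epsilon> / (16 * K) * M + D) = \<epsilon> / 8 + 2 * (K * D) / M" if "M > 0" for M
      using K(1) that by (simp add: field_simps)
    from this[of "real m + 1"] have eq: "w * (\<epsilon> / (16 * K) * (real m + 1) + D) = \<epsilon> / 8 + 2 * (K * D) / (real m + 1)"
      by (simp add: w_def)
    have "16 * (K * D) < \<epsilon> * (real m + 1)"
      using m \<epsilon> by (simp add: field_simps)
    then have "2 * (K * D) / (real m + 1) \<le> \<epsilon> / 8" by (simp add: field_simps)
    then show ?thesis unfolding eq by simp
  qed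
  have k1: "\<Phi> k1 \<le> \<epsilon> / 4" and k2: "\<Phi> k2 \<le> \<epsilon> / 4"
    using \<Phi>_off_diagonal[where g = g, OF J ho w D' gh gg gw bd] wD unfolding k1_def k2_def by fastforce+
  have "\<Phi> k3 \<le> \<epsilon> / 2"
  proof -
    have "\<Phi> k3 \<le> (\<Sum>j\<in>J. \<Phi> (\<lambda>x. complex_of_real (t j) *\<^sub>C rk (h j) (h j) x))"
      unfolding k3_def by (intro \<Phi>_sum fin_rank_cmult fin_rank_rk)
    also have "\<dots> \<le> (\<Sum>j\<in>J. \<eta> * \<phi>)"
    proof (rule sum_mono)
      fix j assume j: "j \<in> J"
      have "\<Phi> (\<lambda>x. complex_of_real (t j) *\<^sub>C rk (h j) (h j) x) = \<bar>t j\<bar> * \<phi>"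
        unfolding \<phi>_def \<Phi>_unit[OF u h1[OF j]] by (simp add: \<Phi>_cmult fin_rank_I fin_rank_rk)
      then show "\<Phi> (\<lambda>x. complex_of_real (t j) *\<^sub>C rk (h j) (h j) x) \<le> \<eta> * \<phi>"
        using t[OF j] \<phi> by (simp add: mult_right_mono)
    qed
    also have "\<dots> = real (card J) * (\<eta> * \<phi>)" by simp
    also have "\<dots> \<le> (real m + 1) * (\<eta> * (\<phi> + 1))"
      using cardJ \<eta> \<phi> by (intro mult_mono) auto
    also have "\<dots> = \<epsilon> / 2"
    proof -
      have "M * (\<epsilon> / (2 * M * P) * P) = \<epsilon> / 2" if "M > 0" "P > 0" for M P using that by simp
      from this[of "real m + 1" "\<phi> + 1"] show ?thesis using \<phi> by (simp add: \<eta>_def)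
    qed
    finally show ?thesis .
  qed
  then have k\<Phi>: "\<Phi> k \<le> \<epsilon>"
    using \<Phi>_diff[OF frI(3) I_plus[OF frI(1,2)]] \<Phi>_plus[OF frI(1,2)] k1 k2 unfolding k_def by linarith
  have kb: "k b = 0" if b: "b \<in> B" for b
  proof -
    have "\<langle>h j, b\<rangle> = 0" "\<langle>g j, b\<rangle> = 0" if "j \<in> J" for j
      using bh[OF b that] bg[OF b that] by (simp_all add: inner_commute_zero)
    then show ?thesis by (simp add: k_def k1_def k2_def k3_def rk_def)
  qed
  have kh: "k (h i) = complex_of_real (t i) *\<^sub>C h i - g i" if i: "i \<in> J" for i
  proof -
    have "k1 (h i) = (\<Sum>j\<in>J. if j = i then g j else 0)" unfolding k1_def rk_def
      by (rule sum.cong) (use i ho in \<open>auto simp: orthonormal_def\<close>)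
    moreover have "k2 (h i) = 0" unfolding k2_def rk_def
      by (rule sum.neutral) (simp add: gh i)
    moreover have "k3 (h i) = (\<Sum>j\<in>J. if j = i then complex_of_real (t j) *\<^sub>C h j else 0)" unfolding k3_def rk_def
      by (rule sum.cong) (use i ho in \<open>auto simp: orthonormal_def\<close>)
    ultimately show ?thesis using i J by (simp add: k_def)
  qed
  define a' where "a' x = a x + k x" for x
  have a'b: "a' b = a b" if "b \<in> B" for b by (simp add: a'_def kb[OF that])
  have a'h: "a' (h i) = complex_of_real (\<mu> i + t i) *\<^sub>C h i" if "i \<in> J" for i
    by (simp add: a'_def kh[OF that] g_def scale_simps)
  have a'hr: "Re \<langle>h i, a' (h i)\<rangle> = \<mu> i + t i" if "i \<in> J" for i
    unfolding a'h[OF that] hs_inner_scale_right hh[OF that] by simp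
  define C where "C = B \<union> h ` J"
  have Cfin: "finite C" using B(1) J by (simp add: C_def)
  have hb: "\<langle>h j, b\<rangle> = 0" if "b \<in> B" "j \<in> J" for b j using bh[OF that] by (simp add: inner_commute_zero)
  have disj: "h j \<notin> B" if "j \<in> J" for j using bh[of "h j" j] hh that by auto
  have Co: "orthonormal (\<lambda>b. b) C" unfolding orthonormal_def C_def
  proof (intro ballI)
    fix x y assume "x \<in> B \<union> h ` J" "y \<in> B \<union> h ` J"
    then consider "x \<in> B" "y \<in> B" | j where "x \<in> B" "j \<in> J" "y = h j" | j where "y \<in> B" "j \<in> J" "x = h j"
      | i j where "i \<in> J" "j \<in> J" "x = h i" "y = h j" by blast
    then show "\<langle>x, y\<rangle> = (if x = y then 1 else 0)"
    proof cases
      case 1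
      then show ?thesis using Bo by (simp add: orthonormal_def)
    next
      case 2
      then show ?thesis using bh disj by auto
    next
      case 3
      then show ?thesis using hb disj by auto
    next
      case 4
      then show ?thesis using orthonormalD[OF ho, of i j] orthonormalD[OF ho, of j j] by (cases "i = j") auto
    qed
  qed
  have Ce: "a' x = complex_of_real (Re \<langle>x, a' x\<rangle>) *\<^sub>C x" if "x \<in> C" for x
  proof -
    from that consider "x \<in> B" | j where "j \<in> J" "x = h j" by (auto simp: C_def)
    then show ?thesis
    proof cases
      case 1
      show ?thesis unfolding a'b[OF 1] by (rule Be[OF 1])
    next
      case 2
      show ?thesis unfolding 2 a'hr[OF 2(1)] by (rule a'h[OF 2(1)])
    qed
  qed
  have Ci: "inj_on (\<lambda>b. Re \<langle>b, a' b\<rangle>) C" unfolding C_def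
  proof (rule inj_onI)
    fix x y assume xy: "x \<in> B \<union> h ` J" "y \<in> B \<union> h ` J" "Re \<langle>x, a' x\<rangle> = Re \<langle>y, a' y\<rangle>"
    then consider "x \<in> B" "y \<in> B" | j where "x \<in> B" "j \<in> J" "y = h j" | j where "y \<in> B" "j \<in> J" "x = h j"
      | i j where "i \<in> J" "j \<in> J" "x = h i" "y = h j" by blast
    then show "x = y"
    proof cases
      case 1
      then show ?thesis using Bi xy(3) by (simp add: a'b inj_on_def)
    next
      case 2
      then have "\<mu> j + t j = Re \<langle>x, a x\<rangle>" using xy(3) a'hr a'b by simp
      then show ?thesis using t 2 by blast
    next
      case 3
      then have "\<mu> j + t j = Re \<langle>y, a y\<rangle>" using xy(3) a'hr a'b by simp
      then show ?thesis using t 3 by blast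
    next
      case 4
      then have "\<mu> i + t i = \<mu> j + t j" using xy(3) a'hr by simp
      then show ?thesis using inj_onD[OF tinj] 4 by blast
    qed
  qed
  \<comment> \<open>\<open>d\<close> is its projection to the span of \<open>B\<close> plus
    \<open>f\<close>, and \<open>f\<close> is the sum of its bin components, each a multiple of some
    \<open>h j\<close> or zero.\<close>
  have "fproj (\<lambda>b. b) C d = d"
  proof -
    let ?P = "fproj (\<lambda>b. b) C"
    have PB: "?P (fproj (\<lambda>b. b) B d) = fproj (\<lambda>b. b) B d"
      by (rule fproj_fproj[OF B(1) Bo Cfin Co]) (rule fproj_basis[OF Cfin Co], simp add: C_def)
    have PF: "?P (F j f) = F j f" if "j \<le> m" for j
    proof (cases "j \<in> J")
      case True
      then have Pe: "?P (h j) = h j" by (intro fproj_basis[OF Cfin Co]) (simp add: C_def)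
      have Fh_eq: "F j f = complex_of_real \<parallel>F j f\<parallel> *\<^sub>C h j" using True by (simp add: h_def hs_scale_scale J_def)
      show ?thesis by (subst (1 2) Fh_eq) (simp only: bounded_op_scale[OF bounded_op_fproj] Pe)
    next
      case False
      then have "F j f = 0" using that by (simp add: J_def)
      then show ?thesis by (simp add: bounded_op_zero[OF bounded_op_fproj])
    qed
    have "?P f = (\<Sum>j\<le>m. ?P (F j f))"
      by (subst Fsum[of f, symmetric]) (rule bounded_op_sum[OF bounded_op_fproj])
    also have "\<dots> = f" using PF by (simp add: Fsum)
    finally have "?P (fproj (\<lambda>b. b) B d + f) = fproj (\<lambda>b. b) B d + f"
      by (simp add: bounded_op_add[OF bounded_op_fproj] PB)
    then show ?thesis by (simp add: f_def)
  qed
  moreover have "diagonal_on (\<lambda>x. a x + k x) C"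
    using Co Ce Ci unfolding diagonal_on_def a'_def[symmetric] by blast
  ultimately show ?thesis using kfr ksa k\<Phi> kb Cfin unfolding C_def by blast
qed

section \<open>Summing the perturbations over a dense sequence\<close>

lemma op_diff_eq: "op_diff x y = (\<lambda>v. x v - y v)"
  by (simp add: op_diff_def)

text \<open>Geometric bounds adding up to \<open>\<epsilon>\<close> make the partial sums Cauchy in
  \<open>\<Phi>\<close>, and completeness of the ideal gives the sum. The approximation by
  finite-rank operators is kept because membership in \<open>K0\<close> will follow from it.\<close>

lemma small_series:
  assumes k: "\<And>n. fin_rank (k n)" "\<And>n. self_adjoint (k n)" and \<Phi>k: "\<And>n. \<Phi> (k n) \<le> \<epsilon> * (1/2) ^ Suc n" and \<epsilon>: "\<epsilon> > 0"
  obtains L where "\<And>e. e > 0 \<Longrightarrow> \<exists>S. fin_rank S \<and> \<Phi> (\<lambda>x. L x - S x) < e" "L \<in> I" "self_adjoint L" "\<Phi> L \<le> \<epsilon>"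
    "\<And>x. hlim (\<lambda>n. \<Sum>i<n. k i x) (L x)"
proof -
  define S where "S n = (\<lambda>x. \<Sum>i<n. k i x)" for n
  have Sfr: "fin_rank (S n)" for n unfolding S_def by (rule fin_rank_sum) (rule k)
  note SI = fin_rank_I[OF Sfr]
  have tail: "\<Phi> (\<lambda>x. S (n + p) x - S n x) \<le> \<epsilon> * (1/2) ^ n - \<epsilon> * (1/2) ^ (n + p)" for n p
  proof (induction p)
    case (Suc p)
    have "(\<lambda>x. S (n + Suc p) x - S n x) = (\<lambda>x. (S (n + p) x - S n x) + k (n + p) x)"
      by (simp add: S_def fun_eq_iff)
    then have "\<Phi> (\<lambda>x. S (n + Suc p) x - S n x) \<le> \<Phi> (\<lambda>x. S (n + p) x - S n x) + \<Phi> (k (n + p))"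
      using \<Phi>_plus[OF I_diff[OF SI SI] fin_rank_I[OF k(1)]] by simp
    then show ?case using Suc \<Phi>k[of "n + p"] by simp
  qed (simp add: \<Phi>_0)
  have tail': "\<Phi> (\<lambda>x. S m x - S n x) \<le> \<epsilon> * (1/2) ^ n" if "n \<le> m" for m n
    using tail[of n "m - n"] that \<epsilon> by (simp add: order_trans)
  have sym: "\<Phi> (\<lambda>x. A x - B x) = \<Phi> (\<lambda>x. B x - A x)" if "A \<in> I" "B \<in> I" for A B
    using \<Phi>_uminus[OF I_diff[OF that]] by simp
  have "\<exists>N. \<forall>m\<ge>N. \<forall>n\<ge>N. \<Phi> (op_diff (S m) (S n)) < e" if e: "e > 0" for e
  proof -
    obtain N where N: "(1/2::real) ^ N < e / \<epsilon>"
      using real_arch_pow_inv[of "e / \<epsilon>" "1/2"] e \<epsilon> by auto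
    have "\<Phi> (op_diff (S m) (S n)) < e" if "m \<ge> N" "n \<ge> N" for m n
    proof -
      have "\<Phi> (\<lambda>x. S m x - S n x) \<le> \<epsilon> * (1/2) ^ min m n"
        using tail'[of n m] tail'[of m n] sym[OF SI SI, of m n] by (cases "n \<le> m") (auto simp: min_def)
      also have "\<dots> \<le> \<epsilon> * (1/2) ^ N"
        using that \<epsilon> by (intro mult_left_mono power_decreasing) auto
      also have "\<dots> < e" using N \<epsilon> by (simp add: field_simps)
      finally show ?thesis by (simp add: op_diff_eq)
    qed
    then show ?thesis by blast
  qed
  then have "\<exists>L\<in>I. (\<lambda>n. \<Phi> (op_diff (S n) L)) \<longlonglongrightarrow> 0"
    using SI by (intro ideal_facts(9)[THEN spec, THEN mp]) simp
  then obtain L where L: "L \<in> I" and lim: "(\<lambda>n. \<Phi> (op_diff (S n) L)) \<longlonglongrightarrow> 0"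
    by blast
  have dI: "(\<lambda>x. S n x - L x) \<in> I" for n by (rule I_diff[OF SI L])
  \<comment> \<open>Domination of the operator norm turns convergence in \<open>\<Phi>\<close> into
    pointwise convergence, through which self-adjointness passes to the limit.\<close>
  obtain c where c: "c > 0" "\<And>x. x \<in> I \<Longrightarrow> c * opnorm x \<le> \<Phi> x" using ideal_facts(8) by auto
  have hl: "hlim (\<lambda>n. S n x) (L x)" for x
    unfolding hlim_def
  proof (rule Lim_null_comparison)
    show "\<forall>\<^sub>F n in sequentially. norm \<parallel>S n x - L x\<parallel> \<le> \<Phi> (op_diff (S n) L) * (\<parallel>x\<parallel> / c)"
    proof (intro always_eventually allI)
      fix n
      have "\<parallel>S n x - L x\<parallel> \<le> opnorm (\<lambda>x. S n x - L x) * \<parallel>x\<parallel>"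
        using opnorm_bound[OF I_bounded[OF dI], of n x] .
      also have "\<dots> \<le> \<Phi> (\<lambda>x. S n x - L x) / c * \<parallel>x\<parallel>"
        using c(2)[OF dI, of n] c(1) by (intro mult_right_mono) (auto simp: field_simps)
      finally show "norm \<parallel>S n x - L x\<parallel> \<le> \<Phi> (op_diff (S n) L) * (\<parallel>x\<parallel> / c)" by (simp add: op_diff_eq)
    qed
    show "(\<lambda>n. \<Phi> (op_diff (S n) L) * (\<parallel>x\<parallel> / c)) \<longlonglongrightarrow> 0" by (rule tendsto_mult_left_zero[OF lim])
  qed
  have approx: "\<exists>n. \<Phi> (\<lambda>x. L x - S n x) < e" if "e > 0" for e
  proof -
    have "\<exists>n. \<Phi> (op_diff (S n) L) < e" using order_tendstoD(2)[OF lim that] eventually_sequentially by auto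
    then show ?thesis using sym[OF SI L] by (simp add: op_diff_eq)
  qed
  show thesis
  proof (rule that[OF _ L])
    show "\<exists>S. fin_rank S \<and> \<Phi> (\<lambda>x. L x - S x) < e" if "e > 0" for e using approx[OF that] Sfr by blast
    have "self_adjoint (S n)" for n unfolding S_def by (rule self_adjoint_sum) (rule k)
    then show "self_adjoint L" using self_adjoint_limit[OF I_bounded[OF L] _ hl] by blast
    show "hlim (\<lambda>n. \<Sum>i<n. k i x) (L x)" for x using hl[of x] by (simp add: S_def)
    show "\<Phi> L \<le> \<epsilon>"
    proof (rule field_le_epsilon)
      fix e :: real assume "e > 0"
      then obtain n where n: "\<Phi> (\<lambda>x. L x - S n x) < e" using approx by blast
      have "\<Phi> L = \<Phi> (\<lambda>x. S n x + (L x - S n x))" by simp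
      also have "\<dots> \<le> \<Phi> (S n) + \<Phi> (\<lambda>x. L x - S n x)" by (rule \<Phi>_plus[OF SI I_diff[OF L SI]])
      finally have "\<Phi> L \<le> \<Phi> (S n) + \<Phi> (\<lambda>x. L x - S n x)" .
      moreover have "\<Phi> (S n) \<le> \<epsilon>" using tail'[of 0 n] by (simp add: S_def)
      ultimately show "\<Phi> L \<le> \<epsilon> + e" using n by linarith
    qed
  qed
qed

text \<open>Step \<open>n\<close> brings the \<open>n\<close>-th vector of a dense sequence into the
  span of the eigenvectors at cost \<open>\<epsilon> * (1/2) ^ Suc n\<close>. Later corrections
  vanish on eigenvectors already found, so the union of all stages is a diagonalizing set.\<close>

lemma diagonalize:
  assumes a: "self_adjoint a" and \<epsilon>: "\<epsilon> > 0"
  obtains L B where "\<And>e. e > 0 \<Longrightarrow> \<exists>S. fin_rank S \<and> \<Phi> (\<lambda>x. L x - S x) < e" "L \<in> I" "self_adjoint L" "\<Phi> L \<le> \<epsilon>"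
    "countable B" "diagonal_on (\<lambda>x. a x + L x) B" "\<forall>v. (\<forall>b\<in>B. \<langle>b, v\<rangle> = 0) \<longrightarrow> v = 0"
proof -
  obtain D :: "'h set" where D: "countable D" "\<And>x e. e > 0 \<Longrightarrow> \<exists>d\<in>D. \<parallel>x - d\<parallel> < e"
    using hs_separable unfolding hnorm_def by metis
  have "D \<noteq> {}" using D(2)[of 1 0] by auto
  define d where "d = from_nat_into D"
  have rd: "range d = D" unfolding d_def using range_from_nat_into[OF \<open>D \<noteq> {}\<close> D(1)] .
  \<comment> \<open>A state holds the current operator, the last correction and the current
    eigenvectors. The clause for \<open>n = 0\<close> fixes the start, which the choice principle
    otherwise constrains only through this predicate.\<close>
  define good where "good = (\<lambda>(n::nat) (s, k :: 'h \<Rightarrow> 'h, B). self_adjoint s \<and> finite B \<and> diagonal_on s B \<and> (n = 0 \<longrightarrow> s = a \<and> B = {}))"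
  define step where "step = (\<lambda>(n::nat) (s, k :: 'h \<Rightarrow> 'h, B) (s', k', B').
       fin_rank k' \<and> self_adjoint k' \<and> \<Phi> k' \<le> \<epsilon> * (1/2) ^ Suc n \<and> (\<forall>b\<in>B. k' b = 0) \<and> B \<subseteq> B'
       \<and> s' = (\<lambda>x. s x + k' x) \<and> fproj (\<lambda>b. b) B' (d n) = d n)"
  \<comment> \<open>Before the first step there is no correction; \<open>a\<close> in the second
    component is a placeholder.\<close>
  have ex0: "\<exists>st. good 0 st"
    by (rule exI[of _ "(a, a, {})"]) (simp add: good_def a diagonal_on_def orthonormal_def)
  have exS: "\<exists>st'. good (Suc n) st' \<and> step n st st'" if "good n st" for st n
  proof -
    obtain s k B where st: "st = (s, k, B)" by (cases st)
    have s: "self_adjoint s" "finite B" "diagonal_on s B" using that by (auto simp: good_def st)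
    have "\<epsilon> * (1/2) ^ Suc n > 0" using \<epsilon> by simp
    from diagonalize_step[OF s this, of "d n"] obtain k' C where
      kC: "fin_rank k'" "self_adjoint k'" "\<Phi> k' \<le> \<epsilon> * (1/2) ^ Suc n" "\<forall>b\<in>B. k' b = 0" "finite C" "B \<subseteq> C"
        "diagonal_on (\<lambda>x. s x + k' x) C" "fproj (\<lambda>b. b) C (d n) = d n" by blast
    then have "good (Suc n) (\<lambda>x. s x + k' x, k', C)" by (simp add: good_def self_adjoint_plus s)
    moreover have "step n st (\<lambda>x. s x + k' x, k', C)"
      unfolding step_def st prod.case using kC by (intro conjI) simp_all
    ultimately show ?thesis by blast
  qed
  obtain st where st: "\<And>n. good n (st n)" and stS: "\<And>n. step n (st n) (st (Suc n))"
    using dependent_nat_choice[of good step, OF ex0 exS] by blast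
  define s where "s n = fst (st n)" for n
  define k where "k n = fst (snd (st (Suc n)))" for n
  define E where "E n = snd (snd (st n))" for n
  have E: "finite (E n)" "diagonal_on (s n) (E n)" for n
    using st[of n] by (auto simp: good_def s_def E_def split: prod.splits)
  have s0: "s 0 = a" using st[of 0] by (auto simp: good_def s_def split: prod.splits)
  have kn: "fin_rank (k n)" "self_adjoint (k n)" "\<Phi> (k n) \<le> \<epsilon> * (1/2) ^ Suc n" "\<And>b. b \<in> E n \<Longrightarrow> k n b = 0"
    "E n \<subseteq> E (Suc n)" "s (Suc n) = (\<lambda>x. s n x + k n x)" "fproj (\<lambda>b. b) (E (Suc n)) (d n) = d n" for n
    using stS[of n] unfolding s_def k_def E_def step_def by (auto split: prod.splits)
  have sn: "s n x = a x + (\<Sum>i<n. k i x)" for n x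
    by (induction n) (simp_all add: s0 kn(6) add.assoc)
  obtain L where L: "\<And>e. e > 0 \<Longrightarrow> \<exists>S. fin_rank S \<and> \<Phi> (\<lambda>x. L x - S x) < e" "L \<in> I" "self_adjoint L" "\<Phi> L \<le> \<epsilon>"
    "\<And>x. hlim (\<lambda>n. \<Sum>i<n. k i x) (L x)"
    by (rule small_series[OF kn(1-3) \<epsilon>]) (rule that)
  have mono: "E m \<subseteq> E n" if "m \<le> n" for m n
    using lift_Suc_mono_le[of E, OF kn(5) that] .
  define B where "B = (\<Union>n. E n)"
  \<comment> \<open>From stage \<open>n\<close> on all corrections vanish on \<open>E n\<close>, so
    the series for \<open>L b\<close> stops there.\<close>
  have aL: "a b + L b = s n b" if b: "b \<in> E n" for n b
  proof -
    have "(\<Sum>i<n + p. k i b) = (\<Sum>i<n. k i b)" for p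
    proof (induction p)
      case (Suc p)
      have "k (n + p) b = 0" using kn(4) mono[of n "n + p"] b by auto
      then show ?case using Suc by simp
    qed simp
    then have "hlim (\<lambda>p. \<Sum>i<p + n. k i b) (\<Sum>i<n. k i b)" by (simp add: add.commute)
    moreover have "hlim (\<lambda>p. \<Sum>i<p + n. k i b) (L b)"
      using LIMSEQ_ignore_initial_segment[OF L(5)[of b, unfolded hlim_def], of n] unfolding hlim_def .
    ultimately show ?thesis using hlim_unique sn by metis
  qed
  have common: "\<exists>n. x \<in> E n \<and> y \<in> E n" if xy: "x \<in> B" "y \<in> B" for x y
  proof -
    obtain m n where "x \<in> E m" "y \<in> E n" using xy unfolding B_def by blast
    then show ?thesis using mono[of m "max m n"] mono[of n "max m n"] by auto
  qed
  have "diagonal_on (\<lambda>x. a x + L x) B"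
    unfolding diagonal_on_def
  proof (intro conjI ballI inj_onI)
    show "orthonormal (\<lambda>b. b) B" unfolding orthonormal_def
    proof (intro ballI)
      fix x y assume "x \<in> B" "y \<in> B"
      then obtain n where "x \<in> E n" "y \<in> E n" using common by blast
      then show "\<langle>x, y\<rangle> = (if x = y then 1 else 0)" using E(2)[of n] by (auto simp: diagonal_on_def orthonormal_def)
    qed
    show "a b + L b = complex_of_real (Re \<langle>b, a b + L b\<rangle>) *\<^sub>C b" if bB: "b \<in> B" for b
    proof -
      obtain n where n: "b \<in> E n" using bB unfolding B_def by blast
      show ?thesis unfolding aL[OF n] using E(2)[of n] n by (auto simp: diagonal_on_def)
    qed
    fix x y assume xy: "x \<in> B" "y \<in> B" "Re \<langle>x, a x + L x\<rangle> = Re \<langle>y, a y + L y\<rangle>"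
    then obtain n where n: "x \<in> E n" "y \<in> E n" using common by blast
    then have "Re \<langle>x, s n x\<rangle> = Re \<langle>y, s n y\<rangle>" using xy(3) aL by simp
    then show "x = y" using E(2)[of n] n unfolding diagonal_on_def inj_on_def by blast
  qed
  moreover have "countable B" unfolding B_def using E(1) by (intro countable_UN) (auto intro: countable_finite)
  \<comment> \<open>A vector orthogonal to \<open>B\<close> is orthogonal to every
    \<open>d n\<close>, hence at distance at least its own norm from the dense set.\<close>
  moreover have "v = 0" if v: "\<And>b. b \<in> B \<Longrightarrow> \<langle>b, v\<rangle> = 0" for v
  proof (rule ccontr)
    assume "v \<noteq> 0"
    then obtain x where x: "x \<in> D" "\<parallel>v - x\<parallel> < \<parallel>v\<parallel>" using D(2)[of "\<parallel>v\<parallel>" v] hnorm_pos by blast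
    then obtain n where n: "x = d n" using rd by blast
    have "\<langle>x, v\<rangle> = \<langle>fproj (\<lambda>b. b) (E (Suc n)) x, v\<rangle>" using kn(7)[of n] n by simp
    also have "\<dots> = \<langle>x, fproj (\<lambda>b. b) (E (Suc n)) v\<rangle>" by (rule self_adjoint_inner[OF self_adjoint_fproj])
    also have "fproj (\<lambda>b. b) (E (Suc n)) v = 0"
      unfolding fproj_def rk_def using v unfolding B_def by (intro sum.neutral ballI) (metis UNIV_I UN_I scale_zero_left)
    finally have "\<langle>v - x, v\<rangle> = complex_of_real (\<parallel>v\<parallel>\<^sup>2)" by (simp add: inner_diff_left inner_self)
    then have "\<parallel>v\<parallel>\<^sup>2 \<le> \<parallel>v - x\<parallel> * \<parallel>v\<parallel>" using cauchy_schwarz[of "v - x" v] by (simp add: norm_power)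
    then show False using x(2) hnorm_pos[OF \<open>v \<noteq> 0\<close>] by (simp add: power2_eq_square)
  qed
  ultimately show thesis using that[of L B] L(1-4) by blast
qed

end

subsection \<open>Irreducibility\<close>

text \<open>Distinct eigenvalues of \<open>A\<close> force \<open>T\<close> to be diagonal along
  \<open>B\<close>; the nonzero entries of \<open>C\<close> from \<open>b0\<close> to each other
  basis vector then tie every diagonal entry of \<open>T\<close> to the one at
  \<open>b0\<close>.\<close>

lemma scalar_commutant:
  fixes b0 :: "'h::sep_inf_chilbert"
  assumes A: "self_adjoint A" "diagonal_on A B" and total: "\<And>v. (\<And>b. b \<in> B \<Longrightarrow> \<langle>b, v\<rangle> = 0) \<Longrightarrow> v = 0"
    and b0: "b0 \<in> B" "\<And>b. b \<in> B \<Longrightarrow> b \<noteq> b0 \<Longrightarrow> \<langle>b, C b0\<rangle> \<noteq> 0" and C: "bounded_op C"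
    and T: "bounded_op T" "commute T A" "commute T C"
  obtains t where "\<And>v. T v = t *\<^sub>C v"
proof -
  define l where "l b = Re \<langle>b, A b\<rangle>" for b
  define t where "t b = \<langle>b, T b\<rangle>" for b
  have on: "\<And>b c. b \<in> B \<Longrightarrow> c \<in> B \<Longrightarrow> \<langle>b, c\<rangle> = (if b = c then 1 else 0)"
    and ev: "\<And>b. b \<in> B \<Longrightarrow> A b = complex_of_real (l b) *\<^sub>C b" and inj: "inj_on l B"
    using A(2) unfolding diagonal_on_def orthonormal_def l_def by blast+
  have off: "\<langle>c, T b\<rangle> = 0" if "b \<in> B" "c \<in> B" "c \<noteq> b" for b c
  proof -
    have "complex_of_real (l c) * \<langle>c, T b\<rangle> = \<langle>A c, T b\<rangle>" using ev[OF that(2)] by (simp add: inner_simps)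
    also have "\<dots> = \<langle>c, T (A b)\<rangle>" by (simp add: self_adjoint_inner[OF A(1)] commuteD[OF T(2)])
    also have "\<dots> = complex_of_real (l b) * \<langle>c, T b\<rangle>"
      using ev[OF that(1)] by (simp add: bounded_op_scale[OF T(1)] inner_simps)
    finally have "l c = l b \<or> \<langle>c, T b\<rangle> = 0" by auto
    then show ?thesis using inj that unfolding inj_on_def by blast
  qed
  have entry: "\<langle>c, T b\<rangle> = (if b = c then t b else 0)" if "b \<in> B" "c \<in> B" for b c
    using off[OF that] by (auto simp: t_def)
  have Tb: "T b = t b *\<^sub>C b" if "b \<in> B" for b
  proof -
    have "T b - t b *\<^sub>C b = 0"
      by (rule total) (use that on entry in \<open>auto simp: inner_simps\<close>)
    then show ?thesis by simp
  qed
  \<comment> \<open>Knowing the adjoint on \<open>B\<close> yields the coefficients of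
    \<open>T v\<close> for arbitrary \<open>v\<close> without expanding \<open>v\<close> in a
    series; \<open>T\<close> itself need not be self-adjoint.\<close>
  have adjT: "adj T b = cnj (t b) *\<^sub>C b" if "b \<in> B" for b
  proof -
    have "adj T b - cnj (t b) *\<^sub>C b = 0"
    proof (rule total)
      fix c assume c: "c \<in> B"
      have "\<langle>c, adj T b\<rangle> = \<langle>T c, b\<rangle>" by (rule adj_inner[OF T(1), symmetric])
      then show "\<langle>c, adj T b - cnj (t b) *\<^sub>C b\<rangle> = 0"
        using on[OF c that] by (auto simp: inner_simps Tb[OF c])
    qed
    then show ?thesis by simp
  qed
  have coeff: "\<langle>b, T v\<rangle> = t b * \<langle>b, v\<rangle>" if "b \<in> B" for b v
    using adj_inner_left[OF T(1), of b v] by (simp add: adjT[OF that] inner_simps)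
  have const: "t b = t b0" if "b \<in> B" for b
  proof (cases "b = b0")
    case False
    have "t b * \<langle>b, C b0\<rangle> = \<langle>b, C (T b0)\<rangle>" by (simp add: coeff[OF that, symmetric] commuteD[OF T(3)])
    also have "\<dots> = t b0 * \<langle>b, C b0\<rangle>" by (simp add: Tb[OF b0(1)] bounded_op_scale[OF C] inner_simps)
    finally show ?thesis using b0(2)[OF that False] by simp
  qed simp
  have "T v = t b0 *\<^sub>C v" for v
  proof -
    have "T v - t b0 *\<^sub>C v = 0" by (rule total) (simp add: inner_simps coeff const)
    then show ?thesis by simp
  qed
  then show thesis by (rule that)
qed

lemma von_neumann_BH: "von_neumann_subalg (BH :: ('h::sep_inf_chilbert \<Rightarrow> 'h) set)"
  unfolding von_neumann_subalg_def BH_def op_add_def op_scale_def comp_def wot_closed_def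
  by (auto intro: bounded_op_plus bounded_op_comp bounded_op_cmult adj_bounded)

text \<open>The generated algebra contains \<open>y\<close> and its adjoint, so its commutant lies
  in theirs. Conversely the algebra is contained in \<open>BH\<close>, which is itself a von Neumann
  algebra, so scalars commute with it.\<close>

lemma irreducible_opI:
  fixes y :: "'h::sep_inf_chilbert \<Rightarrow> 'h"
  assumes y: "bounded_op y"
    and scalar: "\<And>T. bounded_op T \<Longrightarrow> commute T y \<Longrightarrow> commute T (adj y) \<Longrightarrow> \<exists>t. \<forall>v. T v = t *\<^sub>C v"
  shows "irreducible_op y"
  unfolding irreducible_op_def
proof (intro subset_antisym subsetI)
  have W: "y \<in> Wstar y" "adj y \<in> Wstar y" by (auto simp: Wstar_def von_neumann_subalg_def)
  fix T assume "T \<in> commutant_in_BH (Wstar y)"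
  then have T: "bounded_op T" and "y \<circ> T = T \<circ> y" "adj y \<circ> T = T \<circ> adj y"
    using W by (auto simp: commutant_in_BH_def BH_def)
  then have "commute T y" "commute T (adj y)" by (auto simp: commute_def fun_eq_iff)
  then obtain t where "\<And>v. T v = t *\<^sub>C v" using scalar[OF T] by blast
  then have "T = op_scale t id" by (simp add: op_scale_def fun_eq_iff)
  then show "T \<in> {op_scale c id |c. True}" by blast
next
  fix T :: "'h \<Rightarrow> 'h" assume "T \<in> {op_scale c id |c. True}"
  then obtain c where T: "T = (\<lambda>v. c *\<^sub>C v)" by (auto simp: op_scale_def)
  have "Wstar y \<subseteq> BH" using von_neumann_BH y by (auto simp: Wstar_def BH_def)
  then show "T \<in> commutant_in_BH (Wstar y)"
    using bounded_op_cmult[OF bounded_op_id(1), of c]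
    by (auto simp: commutant_in_BH_def BH_def T fun_eq_iff bounded_op_scale subset_iff)
qed

text \<open>The vector is the sum of the basis vectors with weights \<open>(1/2) ^ i\<close>. The
  enumeration repeats vectors when \<open>B\<close> is finite, but repetitions only add positive
  weights, so each coefficient stays positive.\<close>

lemma nonorthogonal_vector:
  fixes B :: "'h::sep_inf_chilbert set"
  assumes B: "countable B" "B \<noteq> {}" "orthonormal (\<lambda>b. b) B"
  obtains v where "\<And>b. b \<in> B \<Longrightarrow> \<langle>b, v\<rangle> \<noteq> 0"
proof -
  define e where "e = from_nat_into B"
  have re: "range e = B" unfolding e_def by (rule range_from_nat_into[OF B(2,1)])
  then have eB: "e i \<in> B" for i by auto
  have e1: "\<parallel>e i\<parallel> = 1" for i using B(3) eB by (simp add: orthonormal_def unit_hnorm[symmetric])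
  define X where "X n = (\<Sum>i<n. complex_of_real ((1/2) ^ i) *\<^sub>C e i)" for n
  define r :: "nat \<Rightarrow> real" where "r n = 2 - 2 * (1/2) ^ n" for n
  have "\<parallel>X (Suc n) - X n\<parallel> \<le> r (Suc n) - r n" for n
    by (simp add: X_def r_def hnorm_scale e1 norm_power norm_divide)
  then obtain v where "(\<lambda>n. \<parallel>X n - v\<parallel>) \<longlonglongrightarrow> 0"
    by (rule hcauchy_increments[where B = 2]) (simp add: r_def)
  then have v: "hlim X v" by (simp add: hlim_def)
  have "\<langle>b, v\<rangle> \<noteq> 0" if b: "b \<in> B" for b
  proof -
    obtain i where i: "b = e i" using b re by auto
    have lim: "(\<lambda>n. Re \<langle>b, X n\<rangle>) \<longlonglongrightarrow> Re \<langle>b, v\<rangle>" by (rule tendsto_Re[OF hlim_inner[OF v]])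
    have "(1/2) ^ i \<le> Re \<langle>b, X n\<rangle>" if "n \<ge> Suc i" for n
    proof -
      have Xn: "Re \<langle>b, X n\<rangle> = (\<Sum>j<n. if b = e j then (1/2) ^ j else 0)"
        unfolding X_def inner_sum_right Re_sum
        by (rule sum.cong[OF refl])
           (use B(3) b eB in \<open>simp add: hs_inner_scale_right orthonormal_def del: of_real_power\<close>)
      have "(if b = e i then (1/2) ^ i else 0) \<le> (\<Sum>j<n. if b = e j then (1/2::real) ^ j else 0)"
        by (rule member_le_sum) (use that in auto)
      then show ?thesis using i Xn by simp
    qed
    then have "(1/2) ^ i \<le> Re \<langle>b, v\<rangle>" using LIMSEQ_le_const[OF lim] by blast
    moreover have "0 < (1/2::real) ^ i" by simp
    ultimately show ?thesis by (metis not_le zero_complex.sel(1))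
  qed
  then show thesis by (rule that)
qed

section \<open>Perturbing the real and the imaginary part\<close>

context ideal_setup
begin

lemma irreducible_perturbation:
  assumes x: "x \<in> BH" and \<epsilon>: "\<epsilon> > 0"
  shows "\<exists>y\<in>BH. irreducible_op y \<and> op_diff x y \<in> K0 \<tau> I \<Phi> \<and> \<Phi> (op_diff x y) \<le> \<epsilon>"
proof -
  have xb: "bounded_op x" using x by (simp add: BH_def)
  define a where "a v = (1/2) *\<^sub>C (x v + adj x v)" for v
  define b where "b v = (- \<i>/2) *\<^sub>C (x v - adj x v)" for v
  have a: "self_adjoint a" unfolding a_def by (rule self_adjoint_re[OF xb])
  have b: "self_adjoint b" unfolding b_def by (rule self_adjoint_im[OF xb])
  have xab: "x v = a v + \<i> *\<^sub>C b v" for v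
  proof -
    have "a v + \<i> *\<^sub>C b v = (1/2 + 1/2) *\<^sub>C x v"
      unfolding a_def b_def hs_scale_add_left scale_diff_right hs_scale_add_right hs_scale_scale by simp
    then show ?thesis by simp
  qed
  \<comment> \<open>The budget is shared equally between the real and the imaginary part.\<close>
  have \<epsilon>2: "\<epsilon> / 2 > 0" using \<epsilon> by simp
  obtain L B where Lapprox: "\<And>e. e > 0 \<Longrightarrow> \<exists>S. fin_rank S \<and> \<Phi> (\<lambda>x. L x - S x) < e"
    and L: "L \<in> I" "self_adjoint L" "\<Phi> L \<le> \<epsilon> / 2"
    and B: "countable B" "diagonal_on (\<lambda>x. a x + L x) B" "\<forall>v. (\<forall>b\<in>B. \<langle>b, v\<rangle> = 0) \<longrightarrow> v = 0"
    by (rule diagonalize[OF a \<epsilon>2]) (rule that)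
  obtain u :: 'h where "\<parallel>u\<parallel> = 1"
    using orthogonal_unit_exists[of "{}::'h set"] by (auto simp: orthonormal_def)
  then have "B \<noteq> {}" using B(3) by (auto dest: spec[of _ u])
  then obtain b0 where b0: "b0 \<in> B" by blast
  have total: "v = 0" if "\<And>b. b \<in> B \<Longrightarrow> \<langle>b, v\<rangle> = 0" for v using B(3) that by blast
  have on: "orthonormal (\<lambda>b. b) B" using B(2) by (simp add: diagonal_on_def)
  obtain \<eta> where \<eta>: "\<And>b. b \<in> B \<Longrightarrow> \<langle>b, \<eta>\<rangle> \<noteq> 0" using nonorthogonal_vector[OF B(1) \<open>B \<noteq> {}\<close> on] by metis
  \<comment> \<open>For \<open>\<beta>\<close> in \<open>B\<close> other than \<open>b0\<close>, the
    entry of \<open>q b0\<close> at \<open>\<beta>\<close> is the inner product of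
    \<open>\<beta>\<close> with \<open>\<eta>\<close>, which is nonzero.\<close>
  define q where "q v = rk \<eta> b0 v + rk b0 \<eta> v" for v
  have q: "fin_rank q" "self_adjoint q" unfolding q_def by (intro fin_rank_plus fin_rank_rk self_adjoint_rk_sym)+
  define M where "M = \<epsilon> / (2 * (\<Phi> q + 1))"
  have q0: "0 \<le> \<Phi> q" by (rule \<Phi>_nonneg[OF fin_rank_I[OF q(1)]])
  then have M: "M > 0" using \<epsilon> by (simp add: M_def)
  \<comment> \<open>For each basis vector at most one real \<open>c\<close> makes the perturbed
    entry vanish. These are countably many values, while the admissible interval is
    uncountable.\<close>
  have "countable ((\<lambda>\<beta>. Re (- \<langle>\<beta>, b b0\<rangle> / \<langle>\<beta>, \<eta>\<rangle>)) ` B)" using B(1) by simp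
  then have "\<not> {0<..<M} \<subseteq> (\<lambda>\<beta>. Re (- \<langle>\<beta>, b b0\<rangle> / \<langle>\<beta>, \<eta>\<rangle>)) ` B"
    using uncountable_open_interval[of 0 M] M countable_subset by blast
  then obtain c where c: "0 < c" "c < M" "c \<notin> (\<lambda>\<beta>. Re (- \<langle>\<beta>, b b0\<rangle> / \<langle>\<beta>, \<eta>\<rangle>)) ` B"
    unfolding subset_iff greaterThanLessThan_iff by blast
  define p where "p v = complex_of_real c *\<^sub>C q v" for v
  have p: "fin_rank p" "self_adjoint p" unfolding p_def by (intro fin_rank_cmult self_adjoint_cmult q)+
  have p\<Phi>: "\<Phi> p \<le> \<epsilon> / 2"
  proof -
    have "\<Phi> p = c * \<Phi> q" unfolding p_def using c by (simp add: \<Phi>_cmult[OF fin_rank_I[OF q(1)]])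
    also have "\<dots> \<le> M * (\<Phi> q + 1)" using c q0 by (intro mult_mono) auto
    also have "\<dots> = \<epsilon> / 2" using q0 by (simp add: M_def field_simps)
    finally show ?thesis .
  qed
  define A where "A v = a v + L v" for v
  define C where "C v = b v + p v" for v
  define y where "y v = A v + \<i> *\<^sub>C C v" for v
  have As: "self_adjoint A" and Cs: "self_adjoint C"
    unfolding A_def C_def by (intro self_adjoint_plus a b L p)+
  have yb: "bounded_op y" unfolding y_def
    by (intro bounded_op_plus bounded_op_cmult self_adjoint_bounded As Cs)
  have yadj: "adj y = (\<lambda>v. A v - \<i> *\<^sub>C C v)"
    by (rule adj_unique) (simp add: y_def inner_simps self_adjoint_inner[OF As] self_adjoint_inner[OF Cs])
  have Cb0: "\<langle>\<beta>, C b0\<rangle> \<noteq> 0" if \<beta>: "\<beta> \<in> B" "\<beta> \<noteq> b0" for \<beta>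
  proof
    assume "\<langle>\<beta>, C b0\<rangle> = 0"
    moreover have "\<langle>\<beta>, b0\<rangle> = 0" "\<langle>b0, b0\<rangle> = 1" using on \<beta> b0 by (auto simp: orthonormal_def)
    ultimately have "\<langle>\<beta>, b b0\<rangle> + complex_of_real c * \<langle>\<beta>, \<eta>\<rangle> = 0"
      by (simp add: C_def p_def q_def rk_def inner_simps)
    then have "complex_of_real c = - \<langle>\<beta>, b b0\<rangle> / \<langle>\<beta>, \<eta>\<rangle>"
      using \<eta>[OF \<beta>(1)] by (simp add: field_simps add_eq_0_iff)
    then have "c = Re (- \<langle>\<beta>, b b0\<rangle> / \<langle>\<beta>, \<eta>\<rangle>)" by (metis Re_complex_of_real)
    then show False using c(3) \<beta>(1) by blast
  qed
  have "irreducible_op y"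
  proof (rule irreducible_opI[OF yb])
    fix T assume T: "bounded_op T" "commute T y" "commute T (adj y)"
    \<comment> \<open>Recovering both parts from \<open>y\<close> and \<open>adj y\<close> lets
      commutation with these two pass to \<open>A\<close> and \<open>C\<close>.\<close>
    have Ay: "A v = (1/2) *\<^sub>C (y v + adj y v)" for v
    proof -
      have "(1/2) *\<^sub>C (y v + adj y v) = (1/2 + 1/2) *\<^sub>C A v"
        unfolding y_def yadj hs_scale_add_left by (simp add: scale_simps)
      then show ?thesis by simp
    qed
    have Cy: "C v = (- \<i>/2) *\<^sub>C (y v - adj y v)" for v
    proof -
      have "(- \<i>/2) *\<^sub>C (y v - adj y v) = (1/2 + 1/2) *\<^sub>C C v"
        unfolding y_def yadj hs_scale_add_left by (simp add: scale_simps)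
      then show ?thesis by simp
    qed
    have "commute T A" "commute T C"
      unfolding commute_def Ay Cy by (simp_all only: bounded_op_simps[OF T(1)] commuteD[OF T(2)] commuteD[OF T(3)] simp_thms)
    then obtain t where "\<And>v. T v = t *\<^sub>C v"
      using scalar_commutant[OF As _ total b0 Cb0 self_adjoint_bounded[OF Cs] T(1)] B(2) unfolding A_def by metis
    then show "\<exists>t. \<forall>v. T v = t *\<^sub>C v" by blast
  qed
  moreover have diff: "op_diff x y = (\<lambda>v. - (L v + \<i> *\<^sub>C p v))"
    by (simp add: op_diff_def fun_eq_iff xab y_def A_def C_def hs_scale_add_right)
  have pI: "(\<lambda>v. \<i> *\<^sub>C p v) \<in> I" by (rule I_cmult[OF fin_rank_I[OF p(1)]])
  have LpI: "(\<lambda>v. L v + \<i> *\<^sub>C p v) \<in> I" by (rule I_plus[OF L(1) pI])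
  have "\<Phi> (op_diff x y) \<le> \<epsilon>"
    unfolding diff \<Phi>_uminus[OF LpI]
    using \<Phi>_plus[OF L(1) pI] \<Phi>_cmult[OF fin_rank_I[OF p(1)], of \<i>] L(3) p\<Phi> by simp
  moreover have "op_diff x y \<in> K0 \<tau> I \<Phi>"
    unfolding K0_def
  proof (intro CollectI conjI allI impI)
    show "op_diff x y \<in> I" unfolding diff by (rule I_uminus[OF LpI])
    fix e :: real assume "0 < e"
    then obtain S where S: "fin_rank S" "\<Phi> (\<lambda>x. L x - S x) < e" using Lapprox by blast
    \<comment> \<open>The perturbation \<open>p\<close> already has finite rank and is taken over
      exactly; only \<open>L\<close> is approximated.\<close>
    define f where "f v = - (S v + \<i> *\<^sub>C p v)" for v
    have "fin_rank f" unfolding f_def by (intro fin_rank_uminus fin_rank_plus fin_rank_cmult S(1) p(1))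
    moreover have "op_diff (op_diff x y) f = (\<lambda>v. - (L v - S v))"
      unfolding diff by (simp add: op_diff_def f_def fun_eq_iff)
    ultimately show "\<exists>f\<in>FF \<tau>. \<Phi> (op_diff (op_diff x y) f) < e"
      using S \<Phi>_uminus[OF I_diff[OF L(1) fin_rank_I[OF S(1)]]] fin_rank_FF[OF tr] by force
  qed
  ultimately show ?thesis using yb by (auto simp: BH_def)
qed

end

theorem theorem3p3:
  fixes \<tau> :: "('h::sep_inf_chilbert \<Rightarrow> 'h) \<Rightarrow> ennreal"
    and I :: "('h \<Rightarrow> 'h) set"
    and \<Phi> :: "('h \<Rightarrow> 'h) \<Rightarrow> real"
  assumes "fns_trace \<tau>"
    and "normed_ideal \<tau> I \<Phi>"
    and "limit_condition \<tau> \<Phi>"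
    and "x \<in> BH"
    and "\<epsilon> > 0"
  shows "\<exists>y\<in>BH. irreducible_op y \<and> op_diff x y \<in> K0 \<tau> I \<Phi> \<and> \<Phi> (op_diff x y) \<le> \<epsilon>"
proof -
  interpret ideal_setup \<tau> I \<Phi> by unfold_locales (fact assms)+
  show ?thesis by (rule irreducible_perturbation[OF assms(4,5)])
qed

end
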